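(* Suppose the spin system has SSM with constants $a,b>0$. Then there is $L_0$ (depending only on $d,a,b$) such that for every odd integer $L\ge L_0$ there is a constant $C$ (independent of $n$) with the following property: for every $d$-dimensional cube $V\subset\mathbb{Z}^d$ of volume $n\ge 2$ and every boundary condition $\psi$ on $\partial V$, the heat-bath tiled block dynamics $\mathcal{B}_\mathcal{D}$ on $V$ (with stationary distribution $\mu=\mu^\psi$) satisfies $\tau_{\rm mix}(\mathcal{B}_\mathcal{D})\le C\log n$ and $\lambda(\mathcal{B}_\mathcal{D})\ge 1/8$.
   Context: Fix $d\ge1$. $\mathbb{Z}^d$ is viewed as a graph with $u\sim v$ iff $\|u-v\|_1=1$. For finite $V\subset\mathbb{Z}^d$, $G=(V,E)$ is the induced subgraph and $\partial V$ is the set of vertices of $\mathbb{Z}^d\setminus V$ adjacent to some vertex of $V$. A spin system consists of spins $S=\{1,\dots,q\}$, a symmetric edge potential $U:S\times S\to\mathbb{R}\cup\{-\infty\}$ and a vertex potential $W:S\to\mathbb{R}$. A boundary condition is a map $\psi:A^\psi\to S$ with $A^\psi\subseteq\partial V$. The Gibbs distribution on $S^V$ is $\mu^\psi(\sigma)=e^{-H^\psi(\sigma)}/Z$ with $H^\psi(\sigma)=-\sum_{(u,v)\in E}U(\sigma(u),\sigma(v))-\sum_{u\in A^\psi,v\in V,u\sim v}U(\psi(u),\sigma(v))-\sum_{u\in V}W(\sigma(u))$. The system is assumed permissive (for every finite $V$ and every configuration outside $V$ some configuration on $V$ has positive conditional probability); $\Omega$ denotes the set of valid (positive-probability) configurations,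 and it is assumed that the heat-bath Glauber dynamics (pick a uniform vertex and resample its spin from the conditional distribution given all other spins) is irreducible on $\Omega$. SSM: for finite $\Lambda\subset\mathbb{Z}^d$ and $a,b>0$, condition $\mathcal{C}(\Lambda,a,b)$ says that for all $B\subseteq\Lambda$, all $u\in\partial\Lambda$ and all pairs of boundary conditions $\psi,\psi_u$ on $\partial\Lambda$ differing only at $u$, $\|\mu^\psi_B-\mu^{\psi_u}_B\|_{TV}\le b\exp(-a\,\mathrm{dist}(u,B))$, where $\mu_B$ denotes the marginal on $B$ and $\mathrm{dist}(u,B)=\min_{v\in B}\|u-v\|_1$. The system has SSM if there exist $a,b>0$ such that $\mathcal{C}(\Lambda,a,b)$ holds for every $d$-dimensional cube $\Lambda\subset\mathbb{Z}^d$. Tilings: let $L$ be an odd integer. For $x\in\{0,\dots,L+2\}^d$ let $C(x)$ be the union over $h\in\mathbb{Z}^d$ of the cubes $\{y\in\mathbb{Z}^d:\|y-(x+(L+3)h)\|_\infty\le (L-1)/2\}$ (cubes of side length $L-1$, volume $L^d$, at mutual distance 4). The tilings are $B_x=C(x)\cap V$; write $\mathcal{D}=\{B_1,\dots,B_m\}$, $m=(L+3)^d$. The heat-bath tiled block dynamics $\mathcal{B}_\mathcal{D}$: from $\sigma_t$, pick $k\in\{1,\dots,m\}$ uniformly at random and replace the configuration on $B_k$ by a sample from $\mu(\cdot\mid\sigma_t(V\setminus B_k))$. For a transition matrix $P$ reversible w.r.t. $\mu$ with eigenvalues $1=\lambda_1\ge\lambda_2\ge\dots\ge\lambda_N$,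 the (absolute) spectral gap is $\lambda(P)=1-\max\{|\lambda_2|,|\lambda_N|\}$. The mixing time is $\tau_{\rm mix}(P)=\max_{x\in\Omega}\min\{t\ge0:\|P^t(x,\cdot)-\mu\|_{TV}\le1/4\}$. *)

theory Defs
  imports "HOL-Analysis.Analysis"
begin

text \<open>Points of Z^d are vectors int^'d; the dimension d = CARD('d) \<ge> 1.\<close>

definition l1dist :: "int^'d \<Rightarrow> int^'d \<Rightarrow> int" where
  "l1dist u v = (\<Sum>i\<in>UNIV. \<bar>u$i - v$i\<bar>)"

definition adj :: "int^'d \<Rightarrow> int^'d \<Rightarrow> bool" where
  "adj u v \<longleftrightarrow> l1dist u v = 1"

definition linf :: "int^'d \<Rightarrow> int" where
  "linf x = Max (range (\<lambda>i. \<bar>x$i\<bar>))"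

definition bdry :: "(int^'d) set \<Rightarrow> (int^'d) set" where
  "bdry V = {u. u \<notin> V \<and> (\<exists>v\<in>V. adj u v)}"

text \<open>Edges of the induced subgraph, each undirected edge listed exactly once
  (oriented in the positive coordinate direction).\<close>
definition edges :: "(int^'d) set \<Rightarrow> ((int^'d) \<times> (int^'d)) set" where
  "edges V = {(u,v). u \<in> V \<and> v \<in> V \<and> (\<exists>i. v = u + axis i 1)}"

definition dist_set :: "int^'d \<Rightarrow> (int^'d) set \<Rightarrow> int" where
  "dist_set u B = Min ((\<lambda>v. l1dist u v) ` B)"

definition is_cube :: "(int^'d) set \<Rightarrow> bool" where
  "is_cube V \<longleftrightarrow> (\<exists>(c::int^'d) (l::nat). l \<ge> 1 \<and> V = {y. \<forall>i. c$i \<le> y$i \<and> y$i < c$i + int l})"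

text \<open>Spins are S = {1..q}; U : S x S -> R \<union> {-\<infinity>} (as ereal, never +\<infinity>), W : S -> R.\<close>

definition spin_system :: "nat \<Rightarrow> (nat \<Rightarrow> nat \<Rightarrow> ereal) \<Rightarrow> bool" where
  "spin_system q U \<longleftrightarrow> q \<ge> 1 \<and> (\<forall>s\<in>{1..q}. \<forall>t\<in>{1..q}. U s t = U t s \<and> U s t \<noteq> \<infinity>)"

definition eU :: "(nat \<Rightarrow> nat \<Rightarrow> ereal) \<Rightarrow> nat \<Rightarrow> nat \<Rightarrow> real" where
  "eU U s t = (if U s t = -\<infinity> then 0 else exp (real_of_ereal (U s t)))"

definition configs :: "nat \<Rightarrow> (int^'d) set \<Rightarrow> (int^'d \<Rightarrow> nat) set" where
  "configs q V = PiE V (\<lambda>_. {1..q})"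

definition is_bc :: "nat \<Rightarrow> (int^'d) set \<Rightarrow> (int^'d \<Rightarrow> nat option) \<Rightarrow> bool" where
  "is_bc q V \<psi> \<longleftrightarrow> dom \<psi> \<subseteq> bdry V \<and> ran \<psi> \<subseteq> {1..q}"

definition gweight :: "(nat \<Rightarrow> nat \<Rightarrow> ereal) \<Rightarrow> (nat \<Rightarrow> real) \<Rightarrow> (int^'d) set
    \<Rightarrow> (int^'d \<Rightarrow> nat option) \<Rightarrow> (int^'d \<Rightarrow> nat) \<Rightarrow> real" where
  "gweight U W V \<psi> \<sigma> =
     (\<Prod>(u,v)\<in>edges V. eU U (\<sigma> u) (\<sigma> v)) *
     (\<Prod>(u,v)\<in>{(u,v). u \<in> dom \<psi> \<and> v \<in> V \<and> adj u v}. eU U (the (\<psi> u)) (\<sigma> v)) *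
     (\<Prod>v\<in>V. exp (W (\<sigma> v)))"

definition gibbs :: "nat \<Rightarrow> (nat \<Rightarrow> nat \<Rightarrow> ereal) \<Rightarrow> (nat \<Rightarrow> real) \<Rightarrow> (int^'d) set
    \<Rightarrow> (int^'d \<Rightarrow> nat option) \<Rightarrow> (int^'d \<Rightarrow> nat) \<Rightarrow> real" where
  "gibbs q U W V \<psi> \<sigma> =
     (if \<sigma> \<in> configs q V then gweight U W V \<psi> \<sigma> / (\<Sum>\<rho>\<in>configs q V. gweight U W V \<psi> \<rho>) else 0)"

definition Omega :: "nat \<Rightarrow> (nat \<Rightarrow> nat \<Rightarrow> ereal) \<Rightarrow> (nat \<Rightarrow> real) \<Rightarrow> (int^'d) set
    \<Rightarrow> (int^'d \<Rightarrow> nat option) \<Rightarrow> (int^'d \<Rightarrow> nat) set" where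
  "Omega q U W V \<psi> = {\<sigma> \<in> configs q V. gibbs q U W V \<psi> \<sigma> > 0}"

definition permissive :: "nat \<Rightarrow> (nat \<Rightarrow> nat \<Rightarrow> ereal) \<Rightarrow> (nat \<Rightarrow> real) \<Rightarrow> 'd::finite itself \<Rightarrow> bool" where
  "permissive q U W (_::'d::finite itself) \<longleftrightarrow>
     (\<forall>(V::(int^'d) set). finite V \<longrightarrow> (\<forall>\<tau>. (\<forall>x. \<tau> x \<in> {1..q}) \<longrightarrow>
        (\<exists>\<sigma>\<in>configs q V. gweight U W V (\<lambda>u. if u \<in> bdry V then Some (\<tau> u) else None) \<sigma> > 0)))"

definition hb :: "nat \<Rightarrow> (nat \<Rightarrow> nat \<Rightarrow> ereal) \<Rightarrow> (nat \<Rightarrow> real) \<Rightarrow> (int^'d) set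
    \<Rightarrow> (int^'d \<Rightarrow> nat option) \<Rightarrow> (int^'d) set \<Rightarrow> (int^'d \<Rightarrow> nat) \<Rightarrow> (int^'d \<Rightarrow> nat) \<Rightarrow> real" where
  "hb q U W V \<psi> B \<sigma> \<tau> =
     (if \<tau> \<in> configs q V \<and> (\<forall>x\<in>V - B. \<tau> x = \<sigma> x)
      then gibbs q U W V \<psi> \<tau> /
           (\<Sum>\<rho>\<in>{\<rho> \<in> configs q V. \<forall>x\<in>V - B. \<rho> x = \<sigma> x}. gibbs q U W V \<psi> \<rho>)
      else 0)"

definition glauber :: "nat \<Rightarrow> (nat \<Rightarrow> nat \<Rightarrow> ereal) \<Rightarrow> (nat \<Rightarrow> real) \<Rightarrow> (int^'d) set
    \<Rightarrow> (int^'d \<Rightarrow> nat option) \<Rightarrow> (int^'d \<Rightarrow> nat) \<Rightarrow> (int^'d \<Rightarrow> nat) \<Rightarrow> real" where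
  "glauber q U W V \<psi> \<sigma> \<tau> = (1 / real (card V)) * (\<Sum>v\<in>V. hb q U W V \<psi> {v} \<sigma> \<tau>)"

definition tile_index :: "nat \<Rightarrow> (int^'d) set" where
  "tile_index L = {x. \<forall>i. 0 \<le> x$i \<and> x$i \<le> int L + 2}"

definition tileC :: "nat \<Rightarrow> int^'d \<Rightarrow> (int^'d) set" where
  "tileC L x = {y. \<exists>h::int^'d. linf (y - (x + of_int (int L + 3) *s h)) \<le> (int L - 1) div 2}"

definition block_dyn :: "nat \<Rightarrow> (nat \<Rightarrow> nat \<Rightarrow> ereal) \<Rightarrow> (nat \<Rightarrow> real) \<Rightarrow> nat \<Rightarrow> (int^'d) set
    \<Rightarrow> (int^'d \<Rightarrow> nat option) \<Rightarrow> (int^'d \<Rightarrow> nat) \<Rightarrow> (int^'d \<Rightarrow> nat) \<Rightarrow> real" where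
  "block_dyn q U W L V \<psi> \<sigma> \<tau> =
     (1 / real ((L + 3) ^ CARD('d))) * (\<Sum>x\<in>tile_index L. hb q U W V \<psi> (tileC L x \<inter> V) \<sigma> \<tau>)"

fun mpow :: "'a set \<Rightarrow> ('a \<Rightarrow> 'a \<Rightarrow> real) \<Rightarrow> nat \<Rightarrow> 'a \<Rightarrow> 'a \<Rightarrow> real" where
  "mpow \<Omega> P 0 x y = (if x = y then 1 else 0)"
| "mpow \<Omega> P (Suc t) x y = (\<Sum>z\<in>\<Omega>. P x z * mpow \<Omega> P t z y)"

definition irreducible_on :: "'a set \<Rightarrow> ('a \<Rightarrow> 'a \<Rightarrow> real) \<Rightarrow> bool" where
  "irreducible_on \<Omega> P \<longleftrightarrow> (\<forall>x\<in>\<Omega>. \<forall>y\<in>\<Omega>. \<exists>t. mpow \<Omega> P t x y > 0)"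

definition tv_dist :: "'a set \<Rightarrow> ('a \<Rightarrow> real) \<Rightarrow> ('a \<Rightarrow> real) \<Rightarrow> real" where
  "tv_dist \<Omega> p r = (1/2) * (\<Sum>y\<in>\<Omega>. \<bar>p y - r y\<bar>)"

definition mixing_time :: "'a set \<Rightarrow> ('a \<Rightarrow> 'a \<Rightarrow> real) \<Rightarrow> ('a \<Rightarrow> real) \<Rightarrow> nat" where
  "mixing_time \<Omega> P \<mu> = Max ((\<lambda>x. LEAST t. tv_dist \<Omega> (mpow \<Omega> P t x) \<mu> \<le> 1/4) ` \<Omega>)"

text \<open>(Real) eigenvalues of P on functions \<Omega> \<rightarrow> R; for P reversible w.r.t. a positive
  distribution, P is real diagonalisable, so these are all eigenvalues.\<close>
definition is_eigenvalue :: "'a set \<Rightarrow> ('a \<Rightarrow> 'a \<Rightarrow> real) \<Rightarrow> real \<Rightarrow> bool" where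
  "is_eigenvalue \<Omega> P l \<longleftrightarrow>
     (\<exists>f. (\<exists>x\<in>\<Omega>. f x \<noteq> 0) \<and> (\<forall>x\<in>\<Omega>. (\<Sum>y\<in>\<Omega>. P x y * f y) = l * f x))"

text \<open>Eigenvalue 1 has multiplicity at least 2 (i.e. lambda_2 = 1).\<close>
definition eig1_multiple :: "'a set \<Rightarrow> ('a \<Rightarrow> 'a \<Rightarrow> real) \<Rightarrow> bool" where
  "eig1_multiple \<Omega> P \<longleftrightarrow>
     (\<exists>f g. (\<forall>x\<in>\<Omega>. (\<Sum>y\<in>\<Omega>. P x y * f y) = f x) \<and> (\<forall>x\<in>\<Omega>. (\<Sum>y\<in>\<Omega>. P x y * g y) = g x) \<and>
        (\<forall>c1 c2::real. (\<forall>x\<in>\<Omega>. c1 * f x + c2 * g x = 0) \<longrightarrow> c1 = 0 \<and> c2 = 0))"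

text \<open>Absolute spectral gap 1 - max(|lambda_2|, |lambda_N|).\<close>
definition abs_spectral_gap :: "'a set \<Rightarrow> ('a \<Rightarrow> 'a \<Rightarrow> real) \<Rightarrow> real" where
  "abs_spectral_gap \<Omega> P =
     1 - Max ({0} \<union> {\<bar>l\<bar> | l. is_eigenvalue \<Omega> P l \<and> l \<noteq> 1} \<union> (if eig1_multiple \<Omega> P then {1} else {}))"

definition marginal :: "nat \<Rightarrow> (nat \<Rightarrow> nat \<Rightarrow> ereal) \<Rightarrow> (nat \<Rightarrow> real) \<Rightarrow> (int^'d) set
    \<Rightarrow> (int^'d \<Rightarrow> nat option) \<Rightarrow> (int^'d) set \<Rightarrow> (int^'d \<Rightarrow> nat) \<Rightarrow> real" where
  "marginal q U W \<Lambda> \<psi> B \<eta> = (\<Sum>\<sigma>\<in>{\<sigma> \<in> configs q \<Lambda>. restrict \<sigma> B = \<eta>}. gibbs q U W \<Lambda> \<psi> \<sigma>)"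

definition ssm_cond :: "nat \<Rightarrow> (nat \<Rightarrow> nat \<Rightarrow> ereal) \<Rightarrow> (nat \<Rightarrow> real) \<Rightarrow> (int^'d) set \<Rightarrow> real \<Rightarrow> real \<Rightarrow> bool" where
  "ssm_cond q U W \<Lambda> a b \<longleftrightarrow>
     (\<forall>B \<subseteq> \<Lambda>. \<forall>u\<in>bdry \<Lambda>. \<forall>\<psi> \<psi>u. is_bc q \<Lambda> \<psi> \<and> is_bc q \<Lambda> \<psi>u \<and> (\<forall>v. v \<noteq> u \<longrightarrow> \<psi> v = \<psi>u v) \<longrightarrow>
        (1/2) * (\<Sum>\<eta>\<in>configs q B. \<bar>marginal q U W \<Lambda> \<psi> B \<eta> - marginal q U W \<Lambda> \<psi>u B \<eta>\<bar>)
          \<le> b * exp (- a * real_of_int (dist_set u B)))"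

definition has_SSM :: "nat \<Rightarrow> (nat \<Rightarrow> nat \<Rightarrow> ereal) \<Rightarrow> (nat \<Rightarrow> real) \<Rightarrow> real \<Rightarrow> real \<Rightarrow> 'd::finite itself \<Rightarrow> bool" where
  "has_SSM q U W a b (_::'d::finite itself) \<longleftrightarrow>
     a > 0 \<and> b > 0 \<and> (\<forall>\<Lambda>::(int^'d) set. is_cube \<Lambda> \<longrightarrow> ssm_cond q U W \<Lambda> a b)"

definition glauber_irreducible :: "nat \<Rightarrow> (nat \<Rightarrow> nat \<Rightarrow> ereal) \<Rightarrow> (nat \<Rightarrow> real) \<Rightarrow> 'd::finite itself \<Rightarrow> bool" where
  "glauber_irreducible q U W (_::'d::finite itself) \<longleftrightarrow>
     (\<forall>(V::(int^'d) set) \<psi>. finite V \<and> is_bc q V \<psi> \<longrightarrow>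
        irreducible_on (Omega q U W V \<psi>) (glauber q U W V \<psi>))"

end

theory Submission
  imports Defs "HOL-Real_Asymp.Real_Asymp" "Jordan_Normal_Form.Spectral_Radius"
begin

text \<open>
  Couplings are replaced by their dual, the action of the dynamics on functions that are Lipschitz
  for the Hamming distance. Strong spatial mixing bounds the influence of a boundary site on the Gibbs
  expectation of a Lipschitz function on a cube. A tile meets the cube \<open>V\<close> in a box rather than a
  cube; if all sides of the box are at least a constant, the box is filled with cubes of a fixed side,
  and a Dobrushin comparison with the heat-bath dynamics of these cubes bounds the influence on it.

  Tilings with a thin piece at the boundary of \<open>V\<close> are out of reach of the hypothesis. Their
  proportion is \<open>O(1/L)\<close>, and they multiply the Hamming distance by at most \<open>1 + L^d\<close>, while all the
  others together contract it by a factor \<open>O(1/L)\<close>. In the metric \<open>hdist powr \<alpha>\<close> with \<open>\<alpha> = 1/(2 d)\<close>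
  the thin tilings therefore contribute only \<open>O(1/L) * O(L^(1/2))\<close>, and one step is a contraction by \<open>1/2\<close>.
  After \<open>O(log n)\<close> steps the law forgets its initial state, and every eigenvalue other than 1 has
  modulus at most \<open>1/2\<close>.
\<close>

text \<open>The width \<open>s\<close> of the small cubes and the bound \<open>\<phi>\<close> on
  their influence seem to depend on each other: the comparison that fills a box needs
  \<open>s\<close> to be at least of order \<open>\<phi>\<close> squared, while the bound drawn from
  strong spatial mixing contains the volume \<open>s^d\<close>. The way out is that the sites within
  distance \<open>r\<close> of the changed boundary site cost O(r^d) whatever \<open>s\<close> is,
  and the remaining ones cost O(s^d exp(- a r)). So \<open>s\<close> may be a power of
  \<open>r\<close>, and one large \<open>r\<close> settles both requirements. Everything is then
  fixed by d, a and b.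

  A thin slab is hard because it resembles a lower-dimensional system, of which mixing on
  d-dimensional cubes says nothing; only its volume bounds the influence. An average of Lipschitz
  constants over all tilings would be of order \<open>L^(d-1)\<close>, and no contraction follows.
  In the concave metric the good factor 1/L also weakens, to a multiple of
  \<open>L powr (- \<alpha>)\<close>, but it still tends to 0.\<close>

no_notation vec_index (infixl "$" 100)

subsection \<open>Gibbs expectations and heat-bath updates\<close>

lemma adj_iff: "adj u v \<longleftrightarrow> (\<exists>i. v = u + axis i 1 \<or> u = v + axis i 1)" for u v :: "int^'d"
proof
  assume "adj u v"
  hence s: "(\<Sum>i\<in>UNIV. \<bar>u$i - v$i\<bar>) = 1" by (simp add: adj_def l1dist_def)
  then obtain i where i: "\<bar>u$i - v$i\<bar> \<noteq> 0"
    by (metis (no_types, lifting) sum.neutral zero_neq_one)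
  have s2: "\<bar>u$i - v$i\<bar> + (\<Sum>j\<in>UNIV - {i}. \<bar>u$j - v$j\<bar>) = 1"
    using s by (simp add: sum.remove[of UNIV i])
  have nn: "(\<Sum>j\<in>UNIV - {i}. \<bar>u$j - v$j\<bar>) \<ge> 0" by (simp add: sum_nonneg)
  have i1: "\<bar>u$i - v$i\<bar> = 1" and z: "(\<Sum>j\<in>UNIV - {i}. \<bar>u$j - v$j\<bar>) = 0"
    using s2 nn i by linarith+
  have o: "u$j = v$j" if "j \<noteq> i" for j
    using z that by (subst (asm) sum_nonneg_eq_0_iff) auto
  show "\<exists>i. v = u + axis i 1 \<or> u = v + axis i 1"
    using i1 o by (intro exI[of _ i]) (auto simp: Finite_Cartesian_Product.vec_eq_iff axis_def abs_if split: if_splits)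
next
  have *: "adj (w + axis i 1) w \<and> adj w (w + axis i 1)" for i and w :: "int^'d"
  proof -
    have "(\<Sum>j\<in>UNIV. \<bar>axis i (1::int) $ j\<bar>) = (\<Sum>j\<in>UNIV. if j = i then 1 else 0)"
      by (rule sum.cong) (auto simp: axis_def)
    thus ?thesis by (simp add: adj_def l1dist_def)
  qed
  assume "\<exists>i. v = u + axis i 1 \<or> u = v + axis i 1"
  thus "adj u v" using * by auto
qed

lemma finite_bdry:
  assumes "finite (V :: (int^'d) set)"
  shows "finite (bdry V)"
proof -
  have "bdry V \<subseteq> (\<Union>i. (\<lambda>v. v + axis i 1) ` V) \<union> (\<Union>i. (\<lambda>v. v - axis i 1) ` V)"
    by (force simp: bdry_def adj_iff)
  thus ?thesis using assms by (meson finite_UN finite_UnI finite_imageI finite_subset finite)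
qed

lemma finite_configs: "finite V \<Longrightarrow> finite (configs q V)"
  by (auto simp: configs_def intro: finite_PiE)

lemma configs_override:
  assumes "\<sigma> \<in> configs q V" "\<eta> \<in> configs q K" "K \<subseteq> V"
  shows "override_on \<sigma> \<eta> K \<in> configs q V"
  using assms by (auto simp: configs_def PiE_def extensional_def override_on_def Pi_iff)

lemma configs_upd:
  assumes "\<sigma> \<in> configs q V" "v \<in> V" "s \<in> {1..q}"
  shows "\<sigma>(v := s) \<in> configs q V"
  using assms by (auto simp: configs_def PiE_def extensional_def Pi_iff)

lemma sum_configs_split:
  assumes "K \<subseteq> V"
  shows "(\<Sum>\<sigma>\<in>configs q V. F \<sigma>)
    = (\<Sum>\<xi>\<in>configs q (V - K). \<Sum>\<eta>\<in>configs q K. F (override_on \<xi> \<eta> K))"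
  unfolding sum.cartesian_product
  by (rule sum.reindex_bij_witness[of _ "\<lambda>(\<xi>,\<eta>). override_on \<xi> \<eta> K" "\<lambda>\<sigma>. (restrict \<sigma> (V-K), restrict \<sigma> K)"])
    (use assms in \<open>auto simp: configs_def PiE_def extensional_def Pi_iff override_on_def fun_eq_iff restrict_def split: if_splits intro!: arg_cong[of _ _ F]\<close>)

lemma sum_configs_agreeing:
  assumes "K \<subseteq> V" "\<sigma> \<in> configs q V"
  shows "(\<Sum>\<rho>\<in>{\<rho> \<in> configs q V. \<forall>x\<in>V - K. \<rho> x = \<sigma> x}. F \<rho>)
    = (\<Sum>\<eta>\<in>configs q K. F (override_on \<sigma> \<eta> K))"
  by (rule sum.reindex_bij_witness[of _ "\<lambda>\<eta>. override_on \<sigma> \<eta> K" "\<lambda>\<rho>. restrict \<rho> K"])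
    (use assms in \<open>auto simp: configs_def PiE_def extensional_def Pi_iff override_on_def fun_eq_iff restrict_def split: if_splits intro!: arg_cong[of _ _ F]\<close>;
      metis Diff_iff)+

text \<open>The boundary condition under which the conditional law on \<open>K\<close>, given a
  valid \<open>\<sigma>\<close> off \<open>K\<close>, is again a Gibbs law.\<close>

definition inner_bc :: "(int^'d) set \<Rightarrow> (int^'d) set \<Rightarrow> (int^'d \<Rightarrow> nat option) \<Rightarrow> (int^'d \<Rightarrow> nat)
    \<Rightarrow> int^'d \<Rightarrow> nat option" where
  "inner_bc V K \<psi> \<sigma> = (\<lambda>w. if w \<in> bdry K then (if w \<in> V then Some (\<sigma> w) else \<psi> w) else None)"

lemma is_bc_inner:
  assumes "is_bc q V \<psi>" "\<sigma> \<in> configs q V" "K \<subseteq> V"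
  shows "is_bc q K (inner_bc V K \<psi> \<sigma>)"
  unfolding is_bc_def
proof
  show "dom (inner_bc V K \<psi> \<sigma>) \<subseteq> bdry K" by (auto simp: inner_bc_def dom_def split: if_splits)
  show "ran (inner_bc V K \<psi> \<sigma>) \<subseteq> {1..q}"
  proof
    fix s assume "s \<in> ran (inner_bc V K \<psi> \<sigma>)"
    then obtain w where "inner_bc V K \<psi> \<sigma> w = Some s" by (auto simp: ran_def)
    hence "(w \<in> V \<and> s = \<sigma> w) \<or> \<psi> w = Some s" by (auto simp: inner_bc_def split: if_splits)
    thus "s \<in> {1..q}" using assms by (auto simp: is_bc_def configs_def PiE_def Pi_iff ran_def)
  qed
qed

lemma inner_bc_override: "K \<subseteq> V \<Longrightarrow> inner_bc V K \<psi> (override_on \<sigma> \<eta> K) = inner_bc V K \<psi> \<sigma>"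
  by (auto simp: inner_bc_def bdry_def override_on_def fun_eq_iff)

text \<open>Collects the factors of \<open>gweight\<close> that see no site of \<open>K\<close>; it
  cancels when the weights on \<open>K\<close> are normalised.\<close>

definition outer_weight :: "(nat \<Rightarrow> nat \<Rightarrow> ereal) \<Rightarrow> (nat \<Rightarrow> real) \<Rightarrow> (int^'d) set \<Rightarrow> (int^'d) set
    \<Rightarrow> (int^'d \<Rightarrow> nat option) \<Rightarrow> (int^'d \<Rightarrow> nat) \<Rightarrow> real" where
  "outer_weight U W V K \<psi> \<sigma> =
     (\<Prod>(u,v)\<in>{(u,v) \<in> edges V. u \<notin> K \<and> v \<notin> K}. eU U (\<sigma> u) (\<sigma> v)) *
     (\<Prod>(u,v)\<in>{(u,v). u \<in> dom \<psi> \<and> v \<in> V - K \<and> adj u v}. eU U (the (\<psi> u)) (\<sigma> v)) *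
     (\<Prod>v\<in>V - K. exp (W (\<sigma> v)))"

lemma outer_weight_override: "outer_weight U W V K \<psi> (override_on \<sigma> \<eta> K) = outer_weight U W V K \<psi> \<sigma>"
  by (auto simp: outer_weight_def override_on_def intro!: arg_cong2[of _ _ _ _ "(*)"] prod.cong)

lemma gweight_cong: "(\<And>v. v \<in> V \<Longrightarrow> \<sigma> v = \<tau> v) \<Longrightarrow> gweight U W V \<psi> \<sigma> = gweight U W V \<psi> \<tau>"
  by (auto simp: gweight_def edges_def intro!: arg_cong2[of _ _ _ _ "(*)"] prod.cong)

lemma gweight_override: "gweight U W K \<psi> (override_on \<sigma> \<eta> K) = gweight U W K \<psi> \<eta>"
  by (rule gweight_cong) auto

lemma eU_nonneg: "eU U s t \<ge> 0"
  by (simp add: eU_def)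

lemma gweight_nonneg: "gweight U W V \<psi> \<sigma> \<ge> 0"
  by (auto simp: gweight_def intro!: mult_nonneg_nonneg prod_nonneg eU_nonneg)

lemma eU_sym: "spin_system q U \<Longrightarrow> s \<in> {1..q} \<Longrightarrow> t \<in> {1..q} \<Longrightarrow> eU U s t = eU U t s"
  by (simp add: eU_def spin_system_def)

lemma finite_edges: "finite V \<Longrightarrow> finite (edges V)"
  by (rule finite_subset[of _ "V \<times> V"]) (auto simp: edges_def)

lemma finite_bc_pairs:
  assumes "finite (V::(int^'d) set)"
  shows "finite {(u,v). u \<in> dom \<psi> \<and> v \<in> V \<and> adj u v}"
proof (rule finite_subset[of _ "(V \<union> bdry V) \<times> V"])
  show "finite ((V \<union> bdry V) \<times> V)" using assms finite_bdry by auto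
qed (auto simp: bdry_def)

text \<open>The spatial Markov property. \<open>edges\<close> lists an edge once, in the positive
  direction, but boundary pairs list the outer site first, so the edges that leave \<open>K\<close>
  in the positive direction have to be reversed; this is where the symmetry of \<open>U\<close>
  enters.\<close>

lemma gweight_factor:
  fixes V K :: "(int^'d) set"
  assumes ss: "spin_system q U" and fin: "finite V" and K: "K \<subseteq> V" and bc: "is_bc q V \<psi>"
    and \<sigma>: "\<sigma> \<in> configs q V"
  shows "gweight U W V \<psi> \<sigma> = gweight U W K (inner_bc V K \<psi> \<sigma>) \<sigma> * outer_weight U W V K \<psi> \<sigma>"
proof -
  let ?e = "\<lambda>(u,v). eU U (\<sigma> u) (\<sigma> v)" and ?b = "\<lambda>(u,v). eU U (the (\<psi> u)) (\<sigma> v)"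
  let ?E1 = "{(u,v) \<in> edges V. u \<notin> K \<and> v \<in> K}"
  let ?E2 = "{(u,v) \<in> edges V. u \<in> K \<and> v \<notin> K}"
  let ?E3 = "{(u,v) \<in> edges V. u \<notin> K \<and> v \<notin> K}"
  have fK: "finite K" using fin K finite_subset by auto
  have feV: "finite (edges V)" using fin finite_edges by auto
  have eq: "edges V = ((edges K \<union> ?E1) \<union> ?E2) \<union> ?E3" using K by (auto simp: edges_def)
  have fE: "finite (edges K)" "finite ?E1" "finite ?E2" "finite ?E3"
    using feV eq by (metis (no_types, lifting) finite_Un)+
  have e: "prod ?e (edges V) = prod ?e (edges K) * prod ?e ?E1 * prod ?e ?E2 * prod ?e ?E3"
    apply (subst eq)
    apply (subst prod.union_disjoint; (use fE in \<open>(auto simp: edges_def; fail)\<close>)?)+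
    done
  let ?B = "{(u,v). u \<in> dom \<psi> \<and> v \<in> V \<and> adj u v}"
  let ?B1 = "{(u,v). u \<in> dom \<psi> \<and> v \<in> K \<and> adj u v}"
  let ?B2 = "{(u,v). u \<in> dom \<psi> \<and> v \<in> V - K \<and> adj u v}"
  have Beq: "?B = ?B1 \<union> ?B2" using K by auto
  have b: "prod ?b ?B = prod ?b ?B1 * prod ?b ?B2"
    by (subst Beq, subst prod.union_disjoint)
      (use finite_subset[OF _ finite_bc_pairs[OF fin, of \<psi>], of ?B2] in \<open>auto simp: finite_bc_pairs fK\<close>)
  have w: "(\<Prod>v\<in>V. exp (W (\<sigma> v))) = (\<Prod>v\<in>K. exp (W (\<sigma> v))) * (\<Prod>v\<in>V-K. exp (W (\<sigma> v)))"
    by (metis K fin mult.commute prod.subset_diff)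
  let ?\<phi> = "inner_bc V K \<psi> \<sigma>"
  let ?i = "\<lambda>(u,v). eU U (the (?\<phi> u)) (\<sigma> v)"
  let ?F = "{(u,v). u \<in> V - K \<and> v \<in> K \<and> adj u v}"
  have dis: "dom \<psi> \<inter> V = {}" using bc by (auto simp: is_bc_def bdry_def)
  have dis': "a \<notin> K \<and> a \<notin> V" if "\<psi> a = Some y" for a y using dis K that by blast
  have ieq: "{(u,v). u \<in> dom ?\<phi> \<and> v \<in> K \<and> adj u v} = ?F \<union> ?B1"
    using K dis' by (auto simp: inner_bc_def bdry_def dom_def split: if_splits)
  have fF: "finite ?F" by (rule finite_subset[of _ "V \<times> V"]) (use K fin in auto)
  have i: "prod ?i {(u,v). u \<in> dom ?\<phi> \<and> v \<in> K \<and> adj u v} = prod ?i ?F * prod ?i ?B1"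
    by (subst ieq, subst prod.union_disjoint) (use fF dis in \<open>auto simp: finite_bc_pairs fK\<close>)
  have iB1: "prod ?i ?B1 = prod ?b ?B1"
    by (rule prod.cong) (use K dis' dis in \<open>auto simp: inner_bc_def bdry_def\<close>)
  have iF: "prod ?i ?F = prod ?e ?F"
    by (rule prod.cong) (use K dis in \<open>auto simp: inner_bc_def bdry_def\<close>)
  let ?E2' = "{(u,v). u \<in> V - K \<and> v \<in> K \<and> (v,u) \<in> edges V}"
  have Feq: "?F = ?E1 \<union> ?E2'" using K by (auto simp: edges_def adj_iff)
  have ne: "axis i (1::int) + axis j 1 \<noteq> 0" for i j :: 'd
    by (auto simp: Finite_Cartesian_Product.vec_eq_iff axis_def intro!: exI[of _ i])
  \<comment> \<open>An edge and its reversal cannot both point in a positive direction, so no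
    crossing pair is counted twice.\<close>
  have disE: "?E1 \<inter> ?E2' = {}"
    using ne by (auto simp: edges_def add.assoc)
  have E2: "prod ?e ?E2' = prod ?e ?E2"
    by (rule prod.reindex_bij_witness[of _ prod.swap prod.swap])
      (use \<sigma> K in \<open>auto simp: edges_def configs_def PiE_def Pi_iff intro!: eU_sym[OF ss]\<close>)
  have F: "prod ?e ?F = prod ?e ?E1 * prod ?e ?E2"
    unfolding E2[symmetric] Feq by (rule prod.union_disjoint) (use disE fF Feq in auto)
  show ?thesis
    unfolding gweight_def outer_weight_def e b w i iB1 iF F by (simp add: mult_ac)
qed

section \<open>Gibbs expectations and conditional expectations\<close>

locale permissive_spin_system =
  fixes q :: nat and U :: "nat \<Rightarrow> nat \<Rightarrow> ereal" and W :: "nat \<Rightarrow> real" and dim :: "'d::finite itself"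
  assumes spin_system: "spin_system q U" and permissive: "permissive q U W (TYPE('d))"
begin

text \<open>\<open>permissive\<close> speaks of boundary conditions on all of \<open>bdry V\<close>,
  but \<open>\<psi>\<close> may be partial. A full extension contributes all the factors of
  \<open>\<psi>\<close> and more, so a configuration of positive weight for the extension has
  positive weight for \<open>\<psi>\<close>.\<close>

lemma partition_function_pos:
  fixes V :: "(int^'d) set"
  assumes fin: "finite V" and bc: "is_bc q V \<psi>"
  shows "(\<Sum>\<sigma>\<in>configs q V. gweight U W V \<psi> \<sigma>) > 0"
proof -
  \<comment> \<open>Sites without a value get spin 1, which exists since
    \<open>q \<ge> 1\<close>.\<close>
  define \<tau> where "\<tau> x = (case \<psi> x of Some s \<Rightarrow> s | None \<Rightarrow> 1)" for x
  have "\<tau> x \<in> {1..q}" for x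
    using bc spin_system by (auto simp: \<tau>_def is_bc_def ran_def spin_system_def split: option.split)
  then obtain \<sigma> where \<sigma>: "\<sigma> \<in> configs q V"
    and pos: "gweight U W V (\<lambda>u. if u \<in> bdry V then Some (\<tau> u) else None) \<sigma> > 0"
    using permissive fin unfolding permissive_def by blast
  let ?\<phi> = "\<lambda>u. if u \<in> bdry V then Some (\<tau> u) else None"
  let ?B = "{(u,v). u \<in> dom \<psi> \<and> v \<in> V \<and> adj u v}"
  let ?C = "{(u,v). u \<in> dom ?\<phi> \<and> v \<in> V \<and> adj u v}"
  have sub: "?B \<subseteq> ?C" using bc by (auto simp: is_bc_def)
  have nz: "(\<Prod>(u,v)\<in>edges V. eU U (\<sigma> u) (\<sigma> v)) \<noteq> 0"
    "(\<Prod>(u,v)\<in>?C. eU U (the (?\<phi> u)) (\<sigma> v)) \<noteq> 0"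
    using pos unfolding gweight_def by auto
  have fC: "finite ?C" using finite_bc_pairs[OF fin] .
  have "(\<Prod>(u,v)\<in>?B. eU U (the (\<psi> u)) (\<sigma> v)) \<noteq> 0"
  proof
    assume "(\<Prod>(u,v)\<in>?B. eU U (the (\<psi> u)) (\<sigma> v)) = 0"
    then obtain u v where uv: "(u,v) \<in> ?B" "eU U (the (\<psi> u)) (\<sigma> v) = 0"
      by (subst (asm) prod_zero_iff) (use finite_bc_pairs[OF fin] in auto)
    have "the (?\<phi> u) = the (\<psi> u)" using uv(1) bc by (auto simp: \<tau>_def is_bc_def)
    hence "(\<lambda>(u,v). eU U (the (?\<phi> u)) (\<sigma> v)) (u,v) = 0" using uv by simp
    thus False using nz(2) fC uv(1) sub by (metis (no_types, lifting) prod_zero subsetD)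
  qed
  hence "gweight U W V \<psi> \<sigma> \<noteq> 0"
    using nz fin by (auto simp: gweight_def)
  hence "gweight U W V \<psi> \<sigma> > 0" using gweight_nonneg[of U W V \<psi> \<sigma>] by simp
  thus ?thesis using \<sigma> finite_configs[OF fin]
    by (intro sum_pos2[where i=\<sigma>]) (auto simp: gweight_nonneg)
qed

definition ex :: "(int^'d) set \<Rightarrow> (int^'d \<Rightarrow> nat option) \<Rightarrow> ((int^'d \<Rightarrow> nat) \<Rightarrow> real) \<Rightarrow> real" where
  "ex V \<psi> f = (\<Sum>\<eta>\<in>configs q V. gibbs q U W V \<psi> \<eta> * f \<eta>)"

text \<open>The heat-bath update of \<open>K\<close> as an operator on functions. It makes sense at
  every configuration, valid or not, because permissiveness makes each conditional law on
  \<open>K\<close> a probability; so Lipschitz estimates need not keep to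
  \<open>Omega\<close>.\<close>

definition cond_ex :: "(int^'d) set \<Rightarrow> (int^'d) set \<Rightarrow> (int^'d \<Rightarrow> nat option)
    \<Rightarrow> ((int^'d \<Rightarrow> nat) \<Rightarrow> real) \<Rightarrow> (int^'d \<Rightarrow> nat) \<Rightarrow> real" where
  "cond_ex V K \<psi> f \<sigma> = ex K (inner_bc V K \<psi> \<sigma>) (\<lambda>\<eta>. f (override_on \<sigma> \<eta> K))"

lemma gibbs_nonneg: "gibbs q U W V \<psi> \<sigma> \<ge> 0"
  by (auto simp: gibbs_def gweight_nonneg intro!: divide_nonneg_nonneg sum_nonneg)

lemma sum_gibbs:
  fixes V :: "(int^'d) set"
  assumes "finite V" "is_bc q V \<psi>"
  shows "(\<Sum>\<sigma>\<in>configs q V. gibbs q U W V \<psi> \<sigma>) = 1"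
  using partition_function_pos[OF assms] by (simp add: gibbs_def flip: sum_divide_distrib)

lemma ex_eq: "ex V \<psi> f = (\<Sum>\<eta>\<in>configs q V. gweight U W V \<psi> \<eta> * f \<eta>) / (\<Sum>\<eta>\<in>configs q V. gweight U W V \<psi> \<eta>)"
  by (simp add: ex_def gibbs_def sum_divide_distrib)

lemma ex_const: "finite V \<Longrightarrow> is_bc q V \<psi> \<Longrightarrow> ex V \<psi> (\<lambda>_. c) = c"
  using sum_gibbs[of V \<psi>] by (simp add: ex_def flip: sum_distrib_right)

lemma ex_cong: "(\<And>\<eta>. \<eta> \<in> configs q V \<Longrightarrow> f \<eta> = g \<eta>) \<Longrightarrow> ex V \<psi> f = ex V \<psi> g"
  by (auto simp: ex_def)

lemma ex_sum: "ex V \<psi> (\<lambda>\<eta>. \<Sum>i\<in>I. f i \<eta>) = (\<Sum>i\<in>I. ex V \<psi> (f i))"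
  unfolding ex_def sum_distrib_left by (rule sum.swap)

lemma ex_cmult: "ex V \<psi> (\<lambda>\<eta>. c * f \<eta>) = c * ex V \<psi> f"
  by (simp add: ex_def sum_distrib_left mult_ac)

lemma ex_diff: "ex V \<psi> (\<lambda>\<eta>. f \<eta> - g \<eta>) = ex V \<psi> f - ex V \<psi> g"
  by (simp add: ex_def right_diff_distrib sum_subtractf)

lemma abs_ex_le:
  assumes "finite V" "is_bc q V \<psi>" "\<And>\<eta>. \<eta> \<in> configs q V \<Longrightarrow> \<bar>f \<eta>\<bar> \<le> c"
  shows "\<bar>ex V \<psi> f\<bar> \<le> c"
proof -
  have "\<bar>ex V \<psi> f\<bar> \<le> (\<Sum>\<eta>\<in>configs q V. gibbs q U W V \<psi> \<eta> * \<bar>f \<eta>\<bar>)"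
    unfolding ex_def by (rule order_trans[OF sum_abs]) (simp add: abs_mult gibbs_nonneg)
  also have "\<dots> \<le> ex V \<psi> (\<lambda>_. c)"
    unfolding ex_def by (intro sum_mono mult_left_mono assms gibbs_nonneg)
  finally show ?thesis using ex_const[OF assms(1,2)] by simp
qed

lemma abs_ex_diff_le:
  assumes "finite V" "is_bc q V \<psi>" "\<And>\<eta>. \<eta> \<in> configs q V \<Longrightarrow> \<bar>f \<eta> - g \<eta>\<bar> \<le> c"
  shows "\<bar>ex V \<psi> f - ex V \<psi> g\<bar> \<le> c"
  unfolding ex_diff[symmetric] by (rule abs_ex_le) (use assms in auto)

text \<open>Invariance of the Gibbs law under the update: with the configuration off
  \<open>K\<close> fixed, the weight is a weight on \<open>K\<close> times a constant, and replacing
  \<open>f\<close> by its weighted mean leaves the weighted sum alone.\<close>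

lemma ex_cond_ex:
  assumes fin: "finite V" and K: "K \<subseteq> V" and bc: "is_bc q V \<psi>"
  shows "ex V \<psi> (cond_ex V K \<psi> f) = ex V \<psi> f"
proof -
  have fK: "finite K" using K fin finite_subset by auto
  \<comment> \<open>\<open>is_bc_inner\<close> expects a configuration on all of \<open>V\<close>;
    \<open>\<eta>0\<close> completes one that lives on \<open>V - K\<close>.\<close>
  have "configs q K \<noteq> {}"
    using partition_function_pos[of K "\<lambda>_. None"] fK by (auto simp: is_bc_def)
  then obtain \<eta>0 where \<eta>0: "\<eta>0 \<in> configs q K" by auto
  have ov: "override_on \<xi> \<eta> K \<in> configs q V" if "\<xi> \<in> configs q (V - K)" "\<eta> \<in> configs q K" for \<xi> \<eta>
    using that K by (auto simp: configs_def PiE_def extensional_def Pi_iff override_on_def split: if_splits)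
  define w where "w \<xi> \<eta> = gweight U W K (inner_bc V K \<psi> \<xi>) \<eta>" for \<xi> \<eta>
  define o' where "o' \<xi> = outer_weight U W V K \<psi> \<xi>" for \<xi>
  have g: "gweight U W V \<psi> (override_on \<xi> \<eta> K) = w \<xi> \<eta> * o' \<xi>"
    if "\<xi> \<in> configs q (V - K)" "\<eta> \<in> configs q K" for \<xi> \<eta>
    using gweight_factor[OF spin_system fin K bc ov[OF that]]
    by (simp add: inner_bc_override[OF K] outer_weight_override gweight_override w_def o'_def)
  have Z: "(\<Sum>\<eta>\<in>configs q K. w \<xi> \<eta>) > 0" if "\<xi> \<in> configs q (V - K)" for \<xi>
  proof -
    have "is_bc q K (inner_bc V K \<psi> (override_on \<xi> \<eta>0 K))"
      by (rule is_bc_inner[OF bc ov[OF that \<eta>0] K])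
    thus ?thesis using partition_function_pos[OF fK] by (simp add: inner_bc_override[OF K] w_def)
  qed
  have c: "cond_ex V K \<psi> f (override_on \<xi> \<eta> K)
     = (\<Sum>\<zeta>\<in>configs q K. w \<xi> \<zeta> * f (override_on \<xi> \<zeta> K)) / (\<Sum>\<zeta>\<in>configs q K. w \<xi> \<zeta>)" for \<xi> \<eta>
  proof -
    have "override_on (override_on \<xi> \<eta> K) \<zeta> K = override_on \<xi> \<zeta> K" for \<zeta>
      by (auto simp: override_on_def)
    thus ?thesis by (simp add: cond_ex_def inner_bc_override[OF K] ex_eq w_def)
  qed
  have "(\<Sum>\<sigma>\<in>configs q V. gweight U W V \<psi> \<sigma> * cond_ex V K \<psi> f \<sigma>)
      = (\<Sum>\<sigma>\<in>configs q V. gweight U W V \<psi> \<sigma> * f \<sigma>)"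
    unfolding sum_configs_split[OF K]
  proof (rule sum.cong[OF refl])
    fix \<xi> assume \<xi>: "\<xi> \<in> configs q (V - K)"
    have "(\<Sum>\<eta>\<in>configs q K. gweight U W V \<psi> (override_on \<xi> \<eta> K) * cond_ex V K \<psi> f (override_on \<xi> \<eta> K))
      = (\<Sum>\<eta>\<in>configs q K. w \<xi> \<eta> * (o' \<xi> * ((\<Sum>\<zeta>\<in>configs q K. w \<xi> \<zeta> * f (override_on \<xi> \<zeta> K)) / (\<Sum>\<zeta>\<in>configs q K. w \<xi> \<zeta>))))"
      by (rule sum.cong) (auto simp: g[OF \<xi>] c)
    also have "\<dots> = o' \<xi> * (\<Sum>\<zeta>\<in>configs q K. w \<xi> \<zeta> * f (override_on \<xi> \<zeta> K))"
      using Z[OF \<xi>] unfolding sum_distrib_right[symmetric] by simp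
    also have "\<dots> = (\<Sum>\<eta>\<in>configs q K. gweight U W V \<psi> (override_on \<xi> \<eta> K) * f (override_on \<xi> \<eta> K))"
      unfolding sum_distrib_left by (rule sum.cong) (auto simp: g[OF \<xi>] mult_ac)
    finally show "(\<Sum>\<eta>\<in>configs q K. gweight U W V \<psi> (override_on \<xi> \<eta> K) * cond_ex V K \<psi> f (override_on \<xi> \<eta> K))
      = (\<Sum>\<eta>\<in>configs q K. gweight U W V \<psi> (override_on \<xi> \<eta> K) * f (override_on \<xi> \<eta> K))" .
  qed
  thus ?thesis by (simp add: ex_eq)
qed

text \<open>Ties the kernel to the operator. Validity of \<open>\<sigma>\<close> makes
  \<open>outer_weight\<close> nonzero, so that it cancels from the quotient in
  \<open>hb\<close>.\<close>

lemma sum_hb: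
  assumes fin: "finite V" and K: "K \<subseteq> V" and bc: "is_bc q V \<psi>" and \<sigma>: "\<sigma> \<in> Omega q U W V \<psi>"
  shows "(\<Sum>\<tau>\<in>Omega q U W V \<psi>. hb q U W V \<psi> K \<sigma> \<tau> * f \<tau>) = cond_ex V K \<psi> f \<sigma>"
proof -
  let ?C = "{\<rho> \<in> configs q V. \<forall>x\<in>V - K. \<rho> x = \<sigma> x}"
  have fC: "finite (configs q V)" by (rule finite_configs[OF fin])
  have \<sigma>c: "\<sigma> \<in> configs q V" using \<sigma> by (simp add: Omega_def)
  have Z: "(\<Sum>\<sigma>\<in>configs q V. gweight U W V \<psi> \<sigma>) > 0" (is "?Z > 0")
    by (rule partition_function_pos[OF fin bc])
  have "gweight U W V \<psi> \<sigma> > 0"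
    using \<sigma> \<sigma>c Z by (simp add: Omega_def gibbs_def zero_less_divide_iff)
  hence opos: "outer_weight U W V K \<psi> \<sigma> \<noteq> 0"
    using gweight_factor[OF spin_system fin K bc \<sigma>c, of W] by auto
  have "(\<Sum>\<tau>\<in>Omega q U W V \<psi>. hb q U W V \<psi> K \<sigma> \<tau> * f \<tau>) = (\<Sum>\<tau>\<in>configs q V. hb q U W V \<psi> K \<sigma> \<tau> * f \<tau>)"
  proof (rule sum.mono_neutral_left[OF fC])
    show "\<forall>\<tau>\<in>configs q V - Omega q U W V \<psi>. hb q U W V \<psi> K \<sigma> \<tau> * f \<tau> = 0"
      using gibbs_nonneg[of V \<psi>] by (auto simp: Omega_def hb_def) (metis less_eq_real_def)
  qed (auto simp: Omega_def)
  also have "\<dots> = (\<Sum>\<tau>\<in>?C. hb q U W V \<psi> K \<sigma> \<tau> * f \<tau>)"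
    by (rule sum.mono_neutral_right[OF fC]) (auto simp: hb_def)
  also have "\<dots> = (\<Sum>\<tau>\<in>?C. gibbs q U W V \<psi> \<tau> / (\<Sum>\<rho>\<in>?C. gibbs q U W V \<psi> \<rho>) * f \<tau>)"
    by (rule sum.cong) (auto simp: hb_def)
  also have "\<dots> = (\<Sum>\<tau>\<in>?C. gweight U W V \<psi> \<tau> * f \<tau>) / (\<Sum>\<rho>\<in>?C. gweight U W V \<psi> \<rho>)"
  proof -
    have "(\<Sum>\<rho>\<in>?C. gibbs q U W V \<psi> \<rho>) = (\<Sum>\<rho>\<in>?C. gweight U W V \<psi> \<rho>) / ?Z"
      by (simp add: gibbs_def sum_divide_distrib)
    hence "gibbs q U W V \<psi> \<tau> / (\<Sum>\<rho>\<in>?C. gibbs q U W V \<psi> \<rho>)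
        = gweight U W V \<psi> \<tau> / (\<Sum>\<rho>\<in>?C. gweight U W V \<psi> \<rho>)" if "\<tau> \<in> ?C" for \<tau>
      using Z that by (simp add: gibbs_def)
    thus ?thesis by (simp add: sum_divide_distrib)
  qed
  also have "\<dots> = cond_ex V K \<psi> f \<sigma>"
  proof -
    have g: "gweight U W V \<psi> (override_on \<sigma> \<eta> K) = gweight U W K (inner_bc V K \<psi> \<sigma>) \<eta> * outer_weight U W V K \<psi> \<sigma>"
      if "\<eta> \<in> configs q K" for \<eta>
      using gweight_factor[OF spin_system fin K bc configs_override[OF \<sigma>c that K]]
      by (simp add: inner_bc_override[OF K] outer_weight_override gweight_override)
    have "(\<Sum>\<tau>\<in>?C. gweight U W V \<psi> \<tau> * f \<tau>)
      = (\<Sum>\<eta>\<in>configs q K. gweight U W K (inner_bc V K \<psi> \<sigma>) \<eta> * f (override_on \<sigma> \<eta> K)) * outer_weight U W V K \<psi> \<sigma>"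
      unfolding sum_configs_agreeing[OF K \<sigma>c] sum_distrib_right by (rule sum.cong) (auto simp: g)
    moreover have "(\<Sum>\<tau>\<in>?C. gweight U W V \<psi> \<tau>)
      = (\<Sum>\<eta>\<in>configs q K. gweight U W K (inner_bc V K \<psi> \<sigma>) \<eta>) * outer_weight U W V K \<psi> \<sigma>"
      unfolding sum_configs_agreeing[OF K \<sigma>c] sum_distrib_right by (rule sum.cong) (auto simp: g)
    ultimately show ?thesis using opos by (simp add: cond_ex_def ex_eq)
  qed
  finally show ?thesis .
qed

end

subsection \<open>Influence of a boundary site\<close>

definition hdist :: "'a set \<Rightarrow> ('a \<Rightarrow> nat) \<Rightarrow> ('a \<Rightarrow> nat) \<Rightarrow> nat" where
  "hdist V \<sigma> \<tau> = card {v \<in> V. \<sigma> v \<noteq> \<tau> v}"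

text \<open>Quantifies over all configurations and not over \<open>Omega\<close>, where two points
  need not be joined by a shortest path of single-site changes.\<close>

definition lip :: "nat \<Rightarrow> (int^'d) set \<Rightarrow> real \<Rightarrow> ((int^'d \<Rightarrow> nat) \<Rightarrow> real) \<Rightarrow> bool" where
  "lip q V c f \<longleftrightarrow> (\<forall>\<sigma>\<in>configs q V. \<forall>\<tau>\<in>configs q V. \<bar>f \<sigma> - f \<tau>\<bar> \<le> c * real (hdist V \<sigma> \<tau>))"

lemma hdist_le_card: "finite V \<Longrightarrow> hdist V \<sigma> \<tau> \<le> card V"
  by (auto simp: hdist_def intro: card_mono)

lemma hdist_eq_0_configs:
  assumes "finite V" "\<sigma> \<in> configs q V" "\<tau> \<in> configs q V" "hdist V \<sigma> \<tau> = 0"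
  shows "\<sigma> = \<tau>"
proof -
  have "\<sigma> v = \<tau> v" if "v \<in> V" for v using assms(1,4) that by (auto simp: hdist_def)
  with assms(2,3) show ?thesis unfolding configs_def by (rule PiE_ext)
qed

lemma lip_abs_diff_le_card:
  assumes "lip q V c f" "c \<ge> 0" "finite V" "\<sigma> \<in> configs q V" "\<tau> \<in> configs q V"
  shows "\<bar>f \<sigma> - f \<tau>\<bar> \<le> c * real (card V)"
proof -
  have "\<bar>f \<sigma> - f \<tau>\<bar> \<le> c * real (hdist V \<sigma> \<tau>)" using assms by (simp add: lip_def)
  also have "\<dots> \<le> c * real (card V)" using hdist_le_card[OF assms(3)] assms(2) by (intro mult_left_mono) auto
  finally show ?thesis .
qed

text \<open>Moves from \<open>\<sigma>\<close> to \<open>\<tau>\<close> one disagreement at a time;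
  all intermediate points lie in \<open>configs\<close>.\<close>

lemma lip_single_flip:
  assumes fin: "finite V"
    and flip: "\<And>\<sigma> v s. \<sigma> \<in> configs q V \<Longrightarrow> v \<in> V \<Longrightarrow> s \<in> {1..q} \<Longrightarrow> \<bar>f (\<sigma>(v := s)) - f \<sigma>\<bar> \<le> c"
  shows "lip q V c f"
  unfolding lip_def
proof (intro ballI)
  fix \<sigma> \<tau> assume \<sigma>: "\<sigma> \<in> configs q V" and \<tau>: "\<tau> \<in> configs q V"
  from \<sigma> show "\<bar>f \<sigma> - f \<tau>\<bar> \<le> c * real (hdist V \<sigma> \<tau>)"
  proof (induction "hdist V \<sigma> \<tau>" arbitrary: \<sigma>)
    case 0
    hence "\<sigma> = \<tau>" using hdist_eq_0_configs[OF fin _ \<tau>] by simp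
    thus ?case by (simp add: hdist_def)
  next
    case (Suc n)
    hence "{v \<in> V. \<sigma> v \<noteq> \<tau> v} \<noteq> {}" by (metis card.empty hdist_def nat.distinct(1))
    then obtain v where v: "v \<in> V" "\<sigma> v \<noteq> \<tau> v" by auto
    define \<rho> where "\<rho> = \<sigma>(v := \<tau> v)"
    have s: "\<tau> v \<in> {1..q}" using \<tau> v by (auto simp: configs_def PiE_def Pi_iff)
    have "{w \<in> V. \<sigma> w \<noteq> \<tau> w} = insert v {w \<in> V. \<rho> w \<noteq> \<tau> w}"
      using v by (auto simp: \<rho>_def)
    hence h: "hdist V \<sigma> \<tau> = Suc (hdist V \<rho> \<tau>)"
      using fin by (simp add: hdist_def \<rho>_def)
    have "\<rho> \<in> configs q V" unfolding \<rho>_def using Suc.prems v s by (intro configs_upd) auto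
    hence "\<bar>f \<rho> - f \<tau>\<bar> \<le> c * real (hdist V \<rho> \<tau>)" using Suc.hyps h by simp
    moreover have "\<bar>f \<rho> - f \<sigma>\<bar> \<le> c" unfolding \<rho>_def by (rule flip) (use Suc.prems v s in auto)
    ultimately show ?case using h by (simp add: algebra_simps)
  qed
qed

lemma lip_flip:
  assumes "lip q V c f" "c \<ge> 0" "\<sigma> \<in> configs q V" "v \<in> V" "s \<in> {1..q}"
  shows "\<bar>f (\<sigma>(v := s)) - f \<sigma>\<bar> \<le> c"
proof -
  have "{w \<in> V. (\<sigma>(v := s)) w \<noteq> \<sigma> w} \<subseteq> {v}" by (auto split: if_splits)
  hence "hdist V (\<sigma>(v := s)) \<sigma> \<le> 1"
    unfolding hdist_def using card_mono[of "{v}"] by fastforce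
  hence "c * real (hdist V (\<sigma>(v := s)) \<sigma>) \<le> c * 1" using assms by (intro mult_left_mono) auto
  moreover have "\<bar>f (\<sigma>(v := s)) - f \<sigma>\<bar> \<le> c * real (hdist V (\<sigma>(v := s)) \<sigma>)"
    using assms(1) configs_upd[OF assms(3-5)] assms(3) unfolding lip_def by blast
  ultimately show ?thesis by linarith
qed

lemma hdist_override:
  assumes "K \<subseteq> V"
  shows "hdist V (override_on \<sigma> \<eta> K) (override_on \<sigma> \<zeta> K) = hdist K \<eta> \<zeta>"
  unfolding hdist_def by (rule arg_cong[of _ _ card]) (use assms in \<open>auto simp: override_on_def\<close>)

lemma lip_override:
  assumes "lip q V c f" "\<sigma> \<in> configs q V" "K \<subseteq> V"
  shows "lip q K c (\<lambda>\<eta>. f (override_on \<sigma> \<eta> K))"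
  using assms(1) configs_override[OF assms(2) _ assms(3)]
    hdist_override[OF assms(3), of \<sigma>]
  unfolding lip_def by metis

context permissive_spin_system
begin

text \<open>By Kantorovich duality: changing the boundary value at \<open>u\<close> moves the Gibbs
  law on \<open>K\<close> by at most \<open>\<phi>\<close> in the transport distance of the Hamming
  metric. One of the two conditions may also leave \<open>u\<close> without a value.\<close>

definition influence_le :: "(int^'d) set \<Rightarrow> int^'d \<Rightarrow> real \<Rightarrow> bool" where
  "influence_le K u \<phi> \<longleftrightarrow> (\<forall>\<psi> \<psi>' f c. is_bc q K \<psi> \<longrightarrow> is_bc q K \<psi>' \<longrightarrow> (\<forall>v. v \<noteq> u \<longrightarrow> \<psi> v = \<psi>' v) \<longrightarrow>
     c \<ge> 0 \<longrightarrow> lip q K c f \<longrightarrow> \<bar>ex K \<psi> f - ex K \<psi>' f\<bar> \<le> c * \<phi>)"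

lemma influence_leD:
  assumes "influence_le K u \<phi>" "is_bc q K \<psi>" "is_bc q K \<psi>'" "\<And>v. v \<noteq> u \<Longrightarrow> \<psi> v = \<psi>' v" "c \<ge> 0" "lip q K c f"
  shows "\<bar>ex K \<psi> f - ex K \<psi>' f\<bar> \<le> c * \<phi>"
  using assms unfolding influence_le_def by blast

text \<open>Divides \<open>f\<close> by \<open>c\<close>; for \<open>c = 0\<close> the function is
  constant on \<open>configs\<close> and both expectations agree.\<close>

lemma abs_ex_diff_le_scale:
  assumes "finite K" and bc: "is_bc q K \<psi>" "is_bc q K \<psi>'" and c: "c \<ge> 0" and f: "lip q K c f"
    and unit: "\<And>f. lip q K 1 f \<Longrightarrow> \<bar>ex K \<psi> f - ex K \<psi>' f\<bar> \<le> \<phi>"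
  shows "\<bar>ex K \<psi> f - ex K \<psi>' f\<bar> \<le> c * \<phi>"
proof (cases "c = 0")
    case True
    have "configs q K \<noteq> {}" using sum_gibbs[OF assms(1) bc(1)] by auto
    then obtain \<eta>0 where \<eta>0: "\<eta>0 \<in> configs q K" by auto
    have "ex K \<phi>' f = ex K \<phi>' (\<lambda>_. f \<eta>0)" for \<phi>'
    proof (rule ex_cong)
      fix \<eta> assume "\<eta> \<in> configs q K"
      hence "\<bar>f \<eta> - f \<eta>0\<bar> \<le> c * real (hdist K \<eta> \<eta>0)" using f \<eta>0 unfolding lip_def by blast
      thus "f \<eta> = f \<eta>0" using True by simp
    qed
    thus ?thesis using bc True assms(1) by (simp add: ex_const)
  next
    case False
    have "lip q K 1 (\<lambda>\<eta>. (1/c) * f \<eta>)" unfolding lip_def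
    proof (intro ballI)
      fix \<sigma> \<tau> assume "\<sigma> \<in> configs q K" "\<tau> \<in> configs q K"
      hence "\<bar>f \<sigma> - f \<tau>\<bar> \<le> c * real (hdist K \<sigma> \<tau>)" using f by (simp add: lip_def)
      moreover have "\<bar>(1/c) * f \<sigma> - (1/c) * f \<tau>\<bar> = \<bar>f \<sigma> - f \<tau>\<bar> / c"
      proof -
        have "(1/c) * f \<sigma> - (1/c) * f \<tau> = (f \<sigma> - f \<tau>) / c" by (simp add: diff_divide_distrib)
        thus ?thesis using c by simp
      qed
      ultimately show "\<bar>(1/c) * f \<sigma> - (1/c) * f \<tau>\<bar> \<le> 1 * real (hdist K \<sigma> \<tau>)"
        using c False by (simp add: pos_divide_le_eq mult.commute)
    qed
    hence "\<bar>ex K \<psi> (\<lambda>\<eta>. (1/c) * f \<eta>) - ex K \<psi>' (\<lambda>\<eta>. (1/c) * f \<eta>)\<bar> \<le> \<phi>"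
      by (rule unit)
    hence "\<bar>(1/c) * (ex K \<psi> f - ex K \<psi>' f)\<bar> \<le> \<phi>" by (simp only: ex_cmult right_diff_distrib)
    hence "\<bar>ex K \<psi> f - ex K \<psi>' f\<bar> / c \<le> \<phi>" using c by (simp add: abs_mult)
    thus ?thesis using c False by (simp add: pos_divide_le_eq mult.commute)
qed

lemma influence_le_unit:
  assumes "finite K"
    and "\<And>\<psi> \<psi>' f. is_bc q K \<psi> \<Longrightarrow> is_bc q K \<psi>' \<Longrightarrow> (\<And>v. v \<noteq> u \<Longrightarrow> \<psi> v = \<psi>' v) \<Longrightarrow> lip q K 1 f
      \<Longrightarrow> \<bar>ex K \<psi> f - ex K \<psi>' f\<bar> \<le> \<phi>"
  shows "influence_le K u \<phi>"
  unfolding influence_le_def using abs_ex_diff_le_scale[OF assms(1)] assms(2) by blast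

text \<open>A boundary condition is undefined off \<open>bdry K\<close>, so the two conditions
  coincide.\<close>

lemma influence_le_nonbdry:
  assumes "u \<notin> bdry K" "\<phi> \<ge> 0"
  shows "influence_le K u \<phi>"
  unfolding influence_le_def
proof (intro allI impI)
  fix \<psi> \<psi>' f and c :: real
  assume bc: "is_bc q K \<psi>" "is_bc q K \<psi>'" and d: "\<forall>v. v \<noteq> u \<longrightarrow> \<psi> v = \<psi>' v" and "c \<ge> 0"
  have "u \<notin> dom \<psi>" "u \<notin> dom \<psi>'" using bc assms by (auto simp: is_bc_def)
  hence "\<psi> u = \<psi>' u" by (simp add: domIff)
  hence "\<psi> = \<psi>'" using d by (auto simp: fun_eq_iff)
  thus "\<bar>ex K \<psi> f - ex K \<psi>' f\<bar> \<le> c * \<phi>" using assms \<open>c \<ge> 0\<close> by simp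
qed

lemma abs_ex_diff_le_card:
  assumes "finite K" "is_bc q K \<psi>" "is_bc q K \<psi>'" "lip q K c f" "c \<ge> 0"
  shows "\<bar>ex K \<psi> f - ex K \<psi>' f\<bar> \<le> c * real (card K)"
proof -
  have "\<bar>ex K \<psi> f - ex K \<psi>' f\<bar> = \<bar>ex K \<psi> (\<lambda>\<eta>. f \<eta> - ex K \<psi>' f)\<bar>"
    by (simp add: ex_diff ex_const assms)
  also have "\<dots> \<le> c * real (card K)"
  proof (rule abs_ex_le[OF assms(1,2)])
    fix \<eta> assume \<eta>: "\<eta> \<in> configs q K"
    have "\<bar>f \<eta> - ex K \<psi>' f\<bar> = \<bar>ex K \<psi>' (\<lambda>\<zeta>. f \<eta> - f \<zeta>)\<bar>" by (simp add: ex_diff ex_const assms)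
    also have "\<dots> \<le> c * real (card K)"
      by (rule abs_ex_le[OF assms(1,3)]) (use assms \<eta> in \<open>auto intro: lip_abs_diff_le_card\<close>)
    finally show "\<bar>f \<eta> - ex K \<psi>' f\<bar> \<le> c * real (card K)" .
  qed
  finally show ?thesis .
qed

lemma influence_le_card: "finite K \<Longrightarrow> influence_le K u (real (card K))"
  unfolding influence_le_def using abs_ex_diff_le_card by blast

lemma influence_le_mono: "influence_le K u \<phi> \<Longrightarrow> \<phi> \<le> \<phi>' \<Longrightarrow> influence_le K u \<phi>'"
  unfolding influence_le_def by (meson mult_left_mono order_trans)

text \<open>A site of \<open>K\<close> is resampled and its old value forgotten. Otherwise the
  flipped site itself costs 1, and it acts on \<open>K\<close> as a changed boundary value, which
  costs \<open>\<phi>\<close>.\<close>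

lemma cond_ex_flip:
  assumes fin: "finite V" and K: "K \<subseteq> V" and bc: "is_bc q V \<psi>" and f: "lip q V c f" and c: "c \<ge> 0"
    and \<sigma>: "\<sigma> \<in> configs q V" and v: "v \<in> V" and s: "s \<in> {1..q}"
    and infl: "v \<notin> K \<Longrightarrow> influence_le K v \<phi>"
  shows "\<bar>cond_ex V K \<psi> f (\<sigma>(v := s)) - cond_ex V K \<psi> f \<sigma>\<bar> \<le> c * (if v \<in> K then 0 else 1 + \<phi>)"
proof (cases "v \<in> K")
  case True
  have "override_on (\<sigma>(v := s)) \<eta> K = override_on \<sigma> \<eta> K" for \<eta>
    using True by (auto simp: override_on_def)
  moreover have "inner_bc V K \<psi> (\<sigma>(v := s)) = inner_bc V K \<psi> \<sigma>"
    using True by (auto simp: inner_bc_def bdry_def)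
  ultimately show ?thesis using True by (simp add: cond_ex_def)
next
  case False
  have fK: "finite K" using K fin finite_subset by auto
  let ?\<tau> = "\<sigma>(v := s)"
  have \<tau>: "?\<tau> \<in> configs q V" by (rule configs_upd[OF \<sigma> v s])
  let ?b = "inner_bc V K \<psi> ?\<tau>" and ?b' = "inner_bc V K \<psi> \<sigma>"
  have b: "is_bc q K ?b" "is_bc q K ?b'" using is_bc_inner[OF bc _ K] \<sigma> \<tau> by auto
  have "\<bar>ex K ?b (\<lambda>\<eta>. f (override_on ?\<tau> \<eta> K)) - ex K ?b (\<lambda>\<eta>. f (override_on \<sigma> \<eta> K))\<bar> \<le> c"
  proof (rule abs_ex_diff_le[OF fK b(1)])
    fix \<eta> assume \<eta>: "\<eta> \<in> configs q K"
    have "override_on ?\<tau> \<eta> K = (override_on \<sigma> \<eta> K)(v := s)" using False by (auto simp: override_on_def)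
    thus "\<bar>f (override_on ?\<tau> \<eta> K) - f (override_on \<sigma> \<eta> K)\<bar> \<le> c"
      using lip_flip[OF f c configs_override[OF \<sigma> \<eta> K] v s] by simp
  qed
  moreover have "\<bar>ex K ?b (\<lambda>\<eta>. f (override_on \<sigma> \<eta> K)) - ex K ?b' (\<lambda>\<eta>. f (override_on \<sigma> \<eta> K))\<bar> \<le> c * \<phi>"
    by (rule influence_leD[OF infl[OF False] b _ c lip_override[OF f \<sigma> K]]) (auto simp: inner_bc_def)
  ultimately show ?thesis using False by (simp add: cond_ex_def algebra_simps)
qed

lemma cond_ex_bc:
  assumes fin: "finite V" and K: "K \<subseteq> V" and bc: "is_bc q V \<psi>" "is_bc q V \<psi>'"
    and d: "\<And>v. v \<noteq> u \<Longrightarrow> \<psi> v = \<psi>' v"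
    and f: "lip q V c f" and c: "c \<ge> 0"
    and \<sigma>: "\<sigma> \<in> configs q V" and infl: "influence_le K u \<phi>"
  shows "\<bar>cond_ex V K \<psi> f \<sigma> - cond_ex V K \<psi>' f \<sigma>\<bar> \<le> c * \<phi>"
  unfolding cond_ex_def
  by (rule influence_leD[OF infl is_bc_inner[OF bc(1) \<sigma> K] is_bc_inner[OF bc(2) \<sigma> K] _ c lip_override[OF f \<sigma> K]])
    (use d in \<open>auto simp: inner_bc_def\<close>)

text \<open>
  A Dobrushin comparison: \<^term>\<open>ex V \<psi>\<close> is invariant under the dynamics that resamples a block
  \<open>K i\<close> chosen with probability proportional to \<open>p i\<close>. If this dynamics contracts the Lipschitz
  constant, the effect of a changed boundary site on \<^term>\<open>ex V \<psi>\<close> is at most its effect on one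
  step of the dynamics, divided by the rate of contraction.
\<close>

lemma influence_le_blocks:
  assumes fin: "finite V" and I: "finite I" and K: "\<And>i. i \<in> I \<Longrightarrow> K i \<subseteq> V"
    and p: "\<And>i. i \<in> I \<Longrightarrow> p i \<ge> 0" and \<phi>0: "\<And>i w. i \<in> I \<Longrightarrow> \<phi> i w \<ge> 0"
    and infl: "\<And>i w. i \<in> I \<Longrightarrow> w \<notin> K i \<Longrightarrow> influence_le (K i) w (\<phi> i w)"
    and u: "u \<notin> V"
    and \<delta>: "\<delta> > 0"
    and contract: "\<And>v. v \<in> V \<Longrightarrow> (\<Sum>i | i \<in> I \<and> v \<notin> K i. p i * \<phi> i v) + \<delta> \<le> (\<Sum>i | i \<in> I \<and> v \<in> K i. p i)"
  shows "influence_le V u ((\<Sum>i\<in>I. p i * \<phi> i u) / \<delta>)"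
proof (cases "V = {}")
  case True
  have "(\<Sum>i\<in>I. p i * \<phi> i u) \<ge> 0" by (auto intro!: sum_nonneg mult_nonneg_nonneg p \<phi>0)
  thus ?thesis using True \<delta> by (intro influence_le_nonbdry divide_nonneg_pos) (auto simp: bdry_def)
next
  case False
  define \<beta> where "\<beta> = (\<Sum>i\<in>I. p i * \<phi> i u)"
  have \<beta>0: "\<beta> \<ge> 0" by (auto simp: \<beta>_def intro!: sum_nonneg mult_nonneg_nonneg p \<phi>0)
  define N where "N = (\<Sum>i\<in>I. p i)"
  obtain v0 where v0: "v0 \<in> V" using False by auto
  \<comment> \<open>\<open>\<delta> \<le> N\<close> makes \<open>N - \<delta>\<close> below a
    legitimate Lipschitz constant.\<close>
  have "\<delta> \<le> (\<Sum>i | i \<in> I \<and> v0 \<notin> K i. p i * \<phi> i v0) + \<delta>"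
    by (auto intro!: sum_nonneg mult_nonneg_nonneg p \<phi>0)
  also have "\<dots> \<le> (\<Sum>i | i \<in> I \<and> v0 \<in> K i. p i)" by (rule contract[OF v0])
  also have "\<dots> \<le> N" unfolding N_def by (rule sum_mono2[OF I]) (auto simp: p)
  finally have \<delta>N: "\<delta> \<le> N" .
  have N: "N > 0" using \<delta> \<delta>N by simp
  show ?thesis
  proof (rule influence_le_unit[OF fin])
    fix \<psi> \<psi>' f0
    assume bc: "is_bc q V \<psi>" "is_bc q V \<psi>'" and d: "\<And>v. v \<noteq> u \<Longrightarrow> \<psi> v = \<psi>' v"
      and f0: "lip q V 1 f0"
    \<comment> \<open>The weights are not normalised: \<open>Q\<close> is \<open>N\<close> times one
      step of the dynamics.\<close>
    define Q where "Q \<theta> f \<sigma> = (\<Sum>i\<in>I. p i * cond_ex V (K i) \<theta> f \<sigma>)" for \<theta> f \<sigma>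
    have inv: "ex V \<theta> (Q \<theta> f) = N * ex V \<theta> f" if "is_bc q V \<theta>" for \<theta> f
    proof -
      have "ex V \<theta> (Q \<theta> f) = (\<Sum>i\<in>I. p i * ex V \<theta> (cond_ex V (K i) \<theta> f))"
        unfolding Q_def[abs_def] ex_sum by (simp add: ex_cmult)
      also have "\<dots> = (\<Sum>i\<in>I. p i * ex V \<theta> f)"
        by (rule sum.cong) (auto simp: ex_cond_ex[OF fin K that])
      finally show ?thesis by (simp add: N_def sum_distrib_right)
    qed
    have lipQ: "lip q V (N - \<delta>) (Q \<psi>' f)" if f: "lip q V 1 f" for f
    proof (rule lip_single_flip[OF fin])
      fix \<sigma> v s assume \<sigma>: "\<sigma> \<in> configs q V" and v: "v \<in> V" and s: "s \<in> {1..q}"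
      have "\<bar>Q \<psi>' f (\<sigma>(v := s)) - Q \<psi>' f \<sigma>\<bar>
        \<le> (\<Sum>i\<in>I. \<bar>p i * cond_ex V (K i) \<psi>' f (\<sigma>(v := s)) - p i * cond_ex V (K i) \<psi>' f \<sigma>\<bar>)"
        unfolding Q_def sum_subtractf[symmetric] by (rule sum_abs)
      also have "\<dots> \<le> (\<Sum>i\<in>I. p i * (if v \<in> K i then 0 else 1 + \<phi> i v))"
      proof (rule sum_mono)
        fix i assume i: "i \<in> I"
        have "\<bar>p i * cond_ex V (K i) \<psi>' f (\<sigma>(v := s)) - p i * cond_ex V (K i) \<psi>' f \<sigma>\<bar>
          = p i * \<bar>cond_ex V (K i) \<psi>' f (\<sigma>(v := s)) - cond_ex V (K i) \<psi>' f \<sigma>\<bar>"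
          using p[OF i] by (simp add: abs_mult flip: right_diff_distrib)
        also have "\<dots> \<le> p i * (1 * (if v \<in> K i then 0 else 1 + \<phi> i v))"
          by (intro mult_left_mono cond_ex_flip[OF fin K[OF i] bc(2) f _ \<sigma> v s infl[OF i]] p i) auto
        finally show "\<bar>p i * cond_ex V (K i) \<psi>' f (\<sigma>(v := s)) - p i * cond_ex V (K i) \<psi>' f \<sigma>\<bar>
          \<le> p i * (if v \<in> K i then 0 else 1 + \<phi> i v)" by simp
      qed
      also have "\<dots> = (\<Sum>i | i \<in> I \<and> v \<notin> K i. p i + p i * \<phi> i v)"
        by (subst sum.inter_filter[OF I]) (auto intro!: sum.cong simp: algebra_simps)
      also have "\<dots> = N - (\<Sum>i | i \<in> I \<and> v \<in> K i. p i) + (\<Sum>i | i \<in> I \<and> v \<notin> K i. p i * \<phi> i v)"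
      proof -
        have "N = sum p ({i. i \<in> I \<and> v \<in> K i} \<union> {i. i \<in> I \<and> v \<notin> K i})"
          unfolding N_def by (rule arg_cong[of _ _ "sum p"]) auto
        also have "\<dots> = (\<Sum>i | i \<in> I \<and> v \<in> K i. p i) + (\<Sum>i | i \<in> I \<and> v \<notin> K i. p i)"
          by (rule sum.union_disjoint) (use I in auto)
        finally show ?thesis by (simp add: sum.distrib)
      qed
      also have "\<dots> \<le> N - \<delta>" using contract[OF v] by simp
      finally show "\<bar>Q \<psi>' f (\<sigma>(v := s)) - Q \<psi>' f \<sigma>\<bar> \<le> N - \<delta>" .
    qed
    have bdQ: "\<bar>Q \<psi> f \<sigma> - Q \<psi>' f \<sigma>\<bar> \<le> \<beta>" if f: "lip q V 1 f" and \<sigma>: "\<sigma> \<in> configs q V" for f \<sigma>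
    proof -
      have "\<bar>Q \<psi> f \<sigma> - Q \<psi>' f \<sigma>\<bar> \<le> (\<Sum>i\<in>I. \<bar>p i * cond_ex V (K i) \<psi> f \<sigma> - p i * cond_ex V (K i) \<psi>' f \<sigma>\<bar>)"
        unfolding Q_def sum_subtractf[symmetric] by (rule sum_abs)
      also have "\<dots> \<le> \<beta>" unfolding \<beta>_def
      proof (rule sum_mono)
        fix i assume i: "i \<in> I"
        have "u \<notin> K i" using u K[OF i] by auto
        have "\<bar>p i * cond_ex V (K i) \<psi> f \<sigma> - p i * cond_ex V (K i) \<psi>' f \<sigma>\<bar>
          = p i * \<bar>cond_ex V (K i) \<psi> f \<sigma> - cond_ex V (K i) \<psi>' f \<sigma>\<bar>"
          using p[OF i] by (simp add: abs_mult flip: right_diff_distrib)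
        also have "\<dots> \<le> p i * (1 * \<phi> i u)"
          by (intro mult_left_mono cond_ex_bc[OF fin K[OF i] bc d f _ \<sigma> infl[OF i]] p i)
            (use \<open>u \<notin> K i\<close> in auto)
        finally show "\<bar>p i * cond_ex V (K i) \<psi> f \<sigma> - p i * cond_ex V (K i) \<psi>' f \<sigma>\<bar> \<le> p i * \<phi> i u" by simp
      qed
      finally show ?thesis .
    qed
    \<comment> \<open>The supremum is finite by the volume bound. It satisfies
      \<open>N * Sup S \<le> \<beta> + (N - \<delta>) * Sup S\<close>, and solving this gives the
      claim.\<close>
    define S where "S = {\<bar>ex V \<psi> f - ex V \<psi>' f\<bar> | f. lip q V 1 f}"
    have bdd: "bdd_above S"
      by (rule bdd_aboveI[of _ "real (card V)"])
        (use abs_ex_diff_le_card[OF fin bc, of 1] in \<open>auto simp: S_def\<close>)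
    have ne: "S \<noteq> {}" using f0 by (auto simp: S_def)
    have S: "\<bar>ex V \<psi> f - ex V \<psi>' f\<bar> \<le> c * Sup S" if f: "lip q V c f" and c: "c \<ge> 0" for f c
      by (rule abs_ex_diff_le_scale[OF fin bc c f]) (auto simp: S_def intro!: cSup_upper bdd[unfolded S_def])
    have "\<bar>ex V \<psi> f - ex V \<psi>' f\<bar> \<le> (\<beta> + (N - \<delta>) * Sup S) / N" if f: "lip q V 1 f" for f
    proof -
      \<comment> \<open>The first bracket compares the two dynamics under one law, the second
        compares the two laws on one function.\<close>
      have "N * (ex V \<psi> f - ex V \<psi>' f)
        = (ex V \<psi> (Q \<psi> f) - ex V \<psi> (Q \<psi>' f)) + (ex V \<psi> (Q \<psi>' f) - ex V \<psi>' (Q \<psi>' f))"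
        by (simp add: inv bc right_diff_distrib)
      also have "\<bar>\<dots>\<bar> \<le> \<beta> + (N - \<delta>) * Sup S"
        by (rule order_trans[OF abs_triangle_ineq add_mono])
          (use abs_ex_diff_le[OF fin bc(1) bdQ[OF f]] S[OF lipQ[OF f]] \<delta>N in auto)
      finally have "N * \<bar>ex V \<psi> f - ex V \<psi>' f\<bar> \<le> \<beta> + (N - \<delta>) * Sup S" using N by (simp add: abs_mult)
      thus ?thesis using N by (simp add: pos_le_divide_eq mult.commute)
    qed
    hence "Sup S \<le> (\<beta> + (N - \<delta>) * Sup S) / N" by (intro cSup_least[OF ne]) (auto simp: S_def)
    hence "Sup S * N \<le> \<beta> + (N - \<delta>) * Sup S" using N by (simp add: pos_le_divide_eq)
    hence "Sup S * \<delta> \<le> \<beta>" by (simp add: algebra_simps)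
    hence "Sup S \<le> \<beta> / \<delta>" using \<delta> by (simp add: pos_le_divide_eq)
    moreover have "\<bar>ex V \<psi> f0 - ex V \<psi>' f0\<bar> \<le> Sup S"
      by (rule cSup_upper[OF _ bdd]) (use f0 in \<open>auto simp: S_def\<close>)
    ultimately show "\<bar>ex V \<psi> f0 - ex V \<psi>' f0\<bar> \<le> (\<Sum>i\<in>I. p i * \<phi> i u) / \<delta>" by (simp add: \<beta>_def)
  qed
qed

end

subsection \<open>From cubes to boxes\<close>

lemma bij_betw_vec_PiE: "bij_betw (\<lambda>x. vec_nth x) {x::'a^'d. \<forall>i. x$i \<in> S i} (PiE UNIV S)"
  by (rule bij_betwI[where g = vec_lambda]) (auto simp: PiE_def extensional_def Pi_iff)

lemma card_vec_PiE: "card {x::'a^'d. \<forall>i. x$i \<in> S i} = (\<Prod>i\<in>UNIV. card (S i))"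
  using bij_betw_same_card[OF bij_betw_vec_PiE[of S]] by (simp add: card_PiE)

lemma finite_vec_PiE: "(\<And>i. finite (S i)) \<Longrightarrow> finite {x::'a^'d. \<forall>i. x$i \<in> S i}"
  using bij_betw_finite[OF bij_betw_vec_PiE[of S]] by (simp add: finite_PiE)

definition ibox :: "int^'d \<Rightarrow> int^'d \<Rightarrow> (int^'d) set" where
  "ibox lo hi = {y. \<forall>i. lo$i \<le> y$i \<and> y$i < hi$i}"

lemma ibox_alt: "ibox lo hi = {y. \<forall>i. y$i \<in> {lo$i..<hi$i}}"
  by (auto simp: ibox_def)

lemma finite_ibox: "finite (ibox lo hi)"
  unfolding ibox_alt by (rule finite_vec_PiE) simp

lemma card_ibox: "card (ibox lo hi) = (\<Prod>i\<in>UNIV. nat (hi$i - lo$i))"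
  unfolding ibox_alt card_vec_PiE by simp

lemma abs_component_le_l1dist: "\<bar>u$i - v$i\<bar> \<le> l1dist u v"
  unfolding l1dist_def by (rule member_le_sum) auto

lemma card_l1_ball: "card (A \<inter> {v::int^'d. l1dist u v \<le> int r}) \<le> (2 * r + 1) ^ CARD('d)"
proof -
  have "A \<inter> {v. l1dist u v \<le> int r} \<subseteq> ibox (\<chi> i. u$i - int r) (\<chi> i. u$i + int r + 1)"
  proof
    fix v assume "v \<in> A \<inter> {v. l1dist u v \<le> int r}"
    hence "\<bar>u$i - v$i\<bar> \<le> int r" for i
      using abs_component_le_l1dist[of u i v] by simp
    hence "u$i - v$i \<le> int r \<and> v$i - u$i \<le> int r" for i by (simp add: abs_le_iff)
    thus "v \<in> ibox (\<chi> i. u$i - int r) (\<chi> i. u$i + int r + 1)"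
      by (simp add: ibox_def) (smt (verit))
  qed
  hence "card (A \<inter> {v. l1dist u v \<le> int r}) \<le> card (ibox (\<chi> i. u$i - int r) (\<chi> i. u$i + int r + 1))"
    by (rule card_mono[OF finite_ibox])
  also have "\<dots> = (\<Prod>i::'d\<in>UNIV. 2 * r + 1)"
    unfolding card_ibox by (rule prod.cong) auto
  finally show ?thesis by simp
qed

section \<open>Influence on a cube and on a box widened in one direction\<close>

context permissive_spin_system
begin

text \<open>Freezing the sites within distance \<open>r\<close> of \<open>u\<close> changes each of
  the two expectations by at most their number, hence the 2 in the first term. What is left is a
  function of the far sites, whose marginals are close by mixing and whose oscillation is at most
  the volume.\<close>

lemma influence_le_ssm:
  assumes ssm: "ssm_cond q U W \<Lambda> a b" and fin: "finite \<Lambda>" and a: "a > 0" and b: "b > 0"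
  shows "influence_le \<Lambda> u (2 * real ((2 * r + 1) ^ CARD('d)) + 2 * b * real (card \<Lambda>) * exp (- a * real r))"
    (is "influence_le \<Lambda> u ?\<phi>")
proof (cases "u \<in> bdry \<Lambda>")
  case False
  thus ?thesis using b by (intro influence_le_nonbdry) auto
next
  case True
  show ?thesis
  proof (rule influence_le_unit[OF fin])
    fix \<psi> \<psi>' f
    assume bc: "is_bc q \<Lambda> \<psi>" "is_bc q \<Lambda> \<psi>'" and d: "\<And>v. v \<noteq> u \<Longrightarrow> \<psi> v = \<psi>' v"
      and f: "lip q \<Lambda> 1 f"
    define B where "B = {v \<in> \<Lambda>. l1dist u v > int r}"
    have near: "real (card (\<Lambda> - B)) \<le> real ((2 * r + 1) ^ CARD('d))"
    proof -
      have "\<Lambda> - B = \<Lambda> \<inter> {v. l1dist u v \<le> int r}" by (auto simp: B_def)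
      thus ?thesis using card_l1_ball[of \<Lambda> u r] by (simp only: of_nat_le_iff)
    qed
    have fB: "finite B" using fin by (simp add: B_def)
    show "\<bar>ex \<Lambda> \<psi> f - ex \<Lambda> \<psi>' f\<bar> \<le> ?\<phi>"
    \<comment> \<open>\<open>dist_set\<close> is a minimum over \<open>B\<close>, so an empty
      \<open>B\<close> is treated apart.\<close>
    proof (cases "B = {}")
      case True
      have "\<bar>ex \<Lambda> \<psi> f - ex \<Lambda> \<psi>' f\<bar> \<le> real (card (\<Lambda> - B))"
        using abs_ex_diff_le_card[OF fin bc f] True by simp
      moreover have "2 * b * real (card \<Lambda>) * exp (- a * real r) \<ge> 0" using b by simp
      ultimately show ?thesis using near by linarith
    next
      case False
      have "configs q \<Lambda> \<noteq> {}" using sum_gibbs[OF fin bc(1)] by auto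
      then obtain \<eta>0 where \<eta>0: "\<eta>0 \<in> configs q \<Lambda>" by auto
      have BL: "B \<subseteq> \<Lambda>" by (auto simp: B_def)
      define g where "g \<zeta> = f (override_on \<eta>0 \<zeta> B)" for \<zeta>
      have rB: "restrict \<eta> B \<in> configs q B" if "\<eta> \<in> configs q \<Lambda>" for \<eta>
        using that BL by (auto simp: configs_def PiE_def Pi_iff)
      have fg: "\<bar>f \<eta> - g (restrict \<eta> B)\<bar> \<le> real (card (\<Lambda> - B))" if \<eta>: "\<eta> \<in> configs q \<Lambda>" for \<eta>
      proof -
        let ?\<rho> = "override_on \<eta>0 (restrict \<eta> B) B"
        have "?\<rho> \<in> configs q \<Lambda>" by (rule configs_override[OF \<eta>0 rB[OF \<eta>] BL])
        hence "\<bar>f \<eta> - f ?\<rho>\<bar> \<le> 1 * real (hdist \<Lambda> \<eta> ?\<rho>)" using f \<eta> unfolding lip_def by blast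
        also have "hdist \<Lambda> \<eta> ?\<rho> \<le> card (\<Lambda> - B)"
          unfolding hdist_def by (rule card_mono) (use fin in \<open>auto simp: override_on_def split: if_splits\<close>)
        finally show ?thesis by (simp add: g_def)
      qed
      let ?m = "\<lambda>\<theta>. marginal q U W \<Lambda> \<theta> B"
      have m: "ex \<Lambda> \<theta> (\<lambda>\<eta>. h (restrict \<eta> B)) = (\<Sum>\<zeta>\<in>configs q B. ?m \<theta> \<zeta> * h \<zeta>)" for \<theta> h
      proof -
        have "ex \<Lambda> \<theta> (\<lambda>\<eta>. h (restrict \<eta> B))
          = (\<Sum>\<zeta>\<in>configs q B. \<Sum>\<sigma>\<in>{\<sigma> \<in> configs q \<Lambda>. restrict \<sigma> B = \<zeta>}. gibbs q U W \<Lambda> \<theta> \<sigma> * h (restrict \<sigma> B))"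
          unfolding ex_def
          by (rule sum.group[symmetric]) (auto simp: finite_configs fin fB rB)
        also have "\<dots> = (\<Sum>\<zeta>\<in>configs q B. ?m \<theta> \<zeta> * h \<zeta>)"
          unfolding marginal_def sum_distrib_right by (intro sum.cong) auto
        finally show ?thesis .
      qed
      have m1: "(\<Sum>\<zeta>\<in>configs q B. ?m \<theta> \<zeta>) = 1" if "is_bc q \<Lambda> \<theta>" for \<theta>
        using m[of \<theta> "\<lambda>_. 1"] ex_const[OF fin that, of 1] by simp
      define \<zeta>0 where "\<zeta>0 = restrict \<eta>0 B"
      have \<zeta>0: "\<zeta>0 \<in> configs q B" unfolding \<zeta>0_def by (rule rB[OF \<eta>0])
      have gb: "\<bar>g \<zeta> - g \<zeta>0\<bar> \<le> real (card \<Lambda>)" if "\<zeta> \<in> configs q B" for \<zeta>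
        unfolding g_def
        using lip_abs_diff_le_card[OF f _ fin configs_override[OF \<eta>0 that BL] configs_override[OF \<eta>0 \<zeta>0 BL]]
        by simp
      let ?D = "\<lambda>\<zeta>. ?m \<psi> \<zeta> - ?m \<psi>' \<zeta>"
      \<comment> \<open>Both marginals have mass 1, so the constant \<open>g \<zeta>0\<close> may be
        subtracted and only the oscillation of \<open>g\<close> counts.\<close>
      have eq: "ex \<Lambda> \<psi> (\<lambda>\<eta>. g (restrict \<eta> B)) - ex \<Lambda> \<psi>' (\<lambda>\<eta>. g (restrict \<eta> B))
        = (\<Sum>\<zeta>\<in>configs q B. ?D \<zeta> * (g \<zeta> - g \<zeta>0))"
      proof -
        have "(\<Sum>\<zeta>\<in>configs q B. ?D \<zeta> * (g \<zeta> - g \<zeta>0))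
          = (\<Sum>\<zeta>\<in>configs q B. ?m \<psi> \<zeta> * g \<zeta>) - (\<Sum>\<zeta>\<in>configs q B. ?m \<psi>' \<zeta> * g \<zeta>)
            - ((\<Sum>\<zeta>\<in>configs q B. ?m \<psi> \<zeta>) - (\<Sum>\<zeta>\<in>configs q B. ?m \<psi>' \<zeta>)) * g \<zeta>0"
          by (simp add: algebra_simps sum.distrib sum_subtractf sum_distrib_left)
        thus ?thesis using m1[OF bc(1)] m1[OF bc(2)] by (simp add: m)
      qed
      have "\<bar>\<Sum>\<zeta>\<in>configs q B. ?D \<zeta> * (g \<zeta> - g \<zeta>0)\<bar>
        \<le> (\<Sum>\<zeta>\<in>configs q B. \<bar>?D \<zeta>\<bar> * real (card \<Lambda>))"
      proof (rule order_trans[OF sum_abs sum_mono])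
        fix \<zeta> assume "\<zeta> \<in> configs q B"
        thus "\<bar>?D \<zeta> * (g \<zeta> - g \<zeta>0)\<bar> \<le> \<bar>?D \<zeta>\<bar> * real (card \<Lambda>)"
          unfolding abs_mult by (intro mult_left_mono gb) auto
      qed
      moreover have "(\<Sum>\<zeta>\<in>configs q B. \<bar>?D \<zeta>\<bar> * real (card \<Lambda>))
          \<le> 2 * (b * exp (- a * real r)) * real (card \<Lambda>)"
      proof -
        have "1/2 * (\<Sum>\<zeta>\<in>configs q B. \<bar>?D \<zeta>\<bar>) \<le> b * exp (- a * real_of_int (dist_set u B))"
          by (rule ssm[unfolded ssm_cond_def, rule_format, OF BL True]) (use bc d in auto)
        also have "\<dots> \<le> b * exp (- a * real r)"
        proof -
          have "dist_set u B \<in> (\<lambda>v. l1dist u v) ` B"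
            unfolding dist_set_def by (rule Min_in) (use fB False in auto)
          hence "dist_set u B \<ge> int r" by (auto simp: B_def)
          hence "real r \<le> real_of_int (dist_set u B)" by linarith
          thus ?thesis using a b by (intro mult_left_mono) auto
        qed
        finally have "(\<Sum>\<zeta>\<in>configs q B. \<bar>?D \<zeta>\<bar>) \<le> 2 * (b * exp (- a * real r))" by simp
        thus ?thesis unfolding sum_distrib_right[symmetric] by (rule mult_right_mono) simp
      qed
      ultimately have 1: "\<bar>ex \<Lambda> \<psi> (\<lambda>\<eta>. g (restrict \<eta> B)) - ex \<Lambda> \<psi>' (\<lambda>\<eta>. g (restrict \<eta> B))\<bar>
        \<le> 2 * b * real (card \<Lambda>) * exp (- a * real r)" unfolding eq by (simp add: mult_ac)
      have 2: "\<bar>ex \<Lambda> \<theta> f - ex \<Lambda> \<theta> (\<lambda>\<eta>. g (restrict \<eta> B))\<bar> \<le> real (card (\<Lambda> - B))" if "is_bc q \<Lambda> \<theta>" for \<theta>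
        by (rule abs_ex_diff_le[OF fin that fg])
      show ?thesis using 1 2[OF bc(1)] 2[OF bc(2)] near by linarith
    qed
  qed
qed

text \<open>
  Influence bounds pass from slices of fixed width \<open>s\<close> to wider boxes. The two extreme slices get weight
  1 and the others the small weight \<open>\<theta>\<close>: a site next to the end of an extreme slice is
  covered by \<open>s\<close> slices of total weight at least \<open>s \<theta> = 3 \<phi>\<close>, and all other sites see boundaries of
  total weight at most \<open>2 \<theta>\<close>.
\<close>

lemma influence_le_widen:
  fixes lo hi :: "int^'d"
  defines "slice \<equiv> \<lambda>k s c. ibox (\<chi> i. if i = k then c else lo$i) (\<chi> i. if i = k then c + int s else hi$i)"
  assumes \<phi>: "\<phi> \<ge> 1" and s: "real s \<ge> 12 * \<phi>\<^sup>2" and len: "hi$k - lo$k \<ge> 2 * int s"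
    and slices: "\<And>c w. influence_le (slice k s c) w \<phi>"
  shows "influence_le (ibox lo hi) u (22 * \<phi>\<^sup>2)"
proof (cases "u \<in> ibox lo hi")
  case True
  thus ?thesis by (intro influence_le_nonbdry) (auto simp: bdry_def)
next
  case False
  define K where "K = slice k s"
  have Kiff: "v \<in> K c \<longleftrightarrow> c \<le> v$k \<and> v$k < c + int s \<and> (\<forall>i. i \<noteq> k \<longrightarrow> lo$i \<le> v$i \<and> v$i < hi$i)" for v c
    unfolding K_def slice_def ibox_def by (auto split: if_splits)
  \<comment> \<open>Gives \<open>s * \<theta> = 3 * \<phi>\<close>, which beats the cost
    \<open>2 * \<phi>\<close> of two adjacent slices of weight 1; with
    \<open>s \<ge> 12 * \<phi>\<^sup>2\<close> also
    \<open>2 * \<theta> * \<phi> \<le> 1/2\<close>.\<close>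
  define \<theta> where "\<theta> = 3 * \<phi> / real s"
  define I where "I = {lo$k .. hi$k - int s}"
  define p where "p c = (if c = lo$k \<or> c = hi$k - int s then 1 else \<theta>)" for c
  have \<phi>2: "\<phi> \<le> \<phi>\<^sup>2" using \<phi> by (simp add: power2_eq_square)
  have s12: "real s \<ge> 12" "real s \<ge> 12 * \<phi>" using s \<phi> \<phi>2 by linarith+
  hence spos: "s \<ge> 1" by simp
  have s\<theta>: "real s * \<theta> = 3 * \<phi>" using s12 by (simp add: \<theta>_def)
  have \<theta>0: "\<theta> > 0" using s12 \<phi> by (simp add: \<theta>_def)
  have \<theta>1: "\<theta> \<le> 1" using s12 \<phi> by (simp add: \<theta>_def divide_le_eq)
  have \<theta>\<phi>: "2 * \<theta> * \<phi> \<le> 1/2"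
  proof -
    have "2 * \<theta> * \<phi> = 6 * \<phi>\<^sup>2 / real s" by (simp add: \<theta>_def power2_eq_square)
    also have "\<dots> \<le> 1/2" using s s12 by (simp add: divide_le_eq)
    finally show ?thesis .
  qed
  have p0: "p c \<ge> 0" "p c \<ge> \<theta>" "p c \<le> 1" for c using \<theta>0 \<theta>1 by (auto simp: p_def)
  have adjk: "c - 1 \<le> w$k \<and> w$k \<le> c + int s" if w: "w \<in> bdry (K c)" for w c
  proof -
    obtain v where v: "v \<in> K c" "adj w v" using w by (auto simp: bdry_def)
    have "\<bar>w$k - v$k\<bar> \<le> 1" using abs_component_le_l1dist[of w k v] v by (simp add: adj_def)
    thus ?thesis using v(1) by (auto simp: Kiff)
  qed
  define \<Phi> where "\<Phi> c w = (if w \<in> bdry (K c) then \<phi> else 0)" for c w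
  have "influence_le (ibox lo hi) u ((\<Sum>c\<in>I. p c * \<Phi> c u) / (1/2))"
  proof (rule influence_le_blocks[OF finite_ibox, where K = K])
    show "finite I" by (simp add: I_def)
    show "K c \<subseteq> ibox lo hi" if "c \<in> I" for c
    proof
      fix v assume v: "v \<in> K c"
      have "lo$i \<le> v$i \<and> v$i < hi$i" for i
        using v that by (cases "i = k") (auto simp: Kiff I_def)
      thus "v \<in> ibox lo hi" by (simp add: ibox_def)
    qed
    show "p c \<ge> 0" for c using p0[of c] by simp
    show "\<Phi> c w \<ge> 0" for c w using \<phi> by (simp add: \<Phi>_def)
    show "influence_le (K c) w (\<Phi> c w)" for c w
      using slices[of c w] influence_le_nonbdry[of w "K c" 0] by (simp add: \<Phi>_def K_def)
    show "u \<notin> ibox lo hi" by fact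
    fix v assume v: "v \<in> ibox lo hi"
    define x where "x = v$k"
    have x: "lo$k \<le> x" "x < hi$k" using v by (auto simp: ibox_def x_def)
    have vK: "v \<in> K c \<longleftrightarrow> c \<le> x \<and> x < c + int s" for c
      using v by (auto simp: Kiff x_def ibox_def)
    \<comment> \<open>A slice that misses \<open>v\<close> has it on its boundary only if it begins
      just after \<open>v\<close> or ends just before it, that is, at \<open>x + 1\<close> or
      \<open>x - int s\<close>.\<close>
    have out: "(\<Sum>c | c \<in> I \<and> v \<notin> K c. p c * \<Phi> c v) \<le> (\<Sum>c \<in> I \<inter> {x + 1, x - int s}. p c * \<phi>)"
    proof -
      have "(\<Sum>c | c \<in> I \<and> v \<notin> K c. p c * \<Phi> c v) = (\<Sum>c \<in> I \<inter> {x + 1, x - int s}. p c * \<Phi> c v)"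
      proof (rule sum.mono_neutral_right)
        show "\<forall>c\<in>{c \<in> I. v \<notin> K c} - I \<inter> {x + 1, x - int s}. p c * \<Phi> c v = 0"
        proof
          fix c assume c: "c \<in> {c \<in> I. v \<notin> K c} - I \<inter> {x + 1, x - int s}"
          have "v \<notin> bdry (K c)"
          proof
            assume "v \<in> bdry (K c)"
            from adjk[OF this] show False using c by (auto simp: vK x_def)
          qed
          thus "p c * \<Phi> c v = 0" by (simp add: \<Phi>_def)
        qed
      next
        show "finite {c \<in> I. v \<notin> K c}" by (rule finite_subset[of _ I]) (auto simp: I_def)
      qed (use spos in \<open>auto simp: vK\<close>)
      also have "\<dots> \<le> (\<Sum>c \<in> I \<inter> {x + 1, x - int s}. p c * \<phi>)"
        by (intro sum_mono mult_left_mono) (use p0 \<phi> in \<open>auto simp: \<Phi>_def\<close>)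
      finally show ?thesis .
    qed
    have fin: "finite {c. c \<in> I \<and> v \<in> K c}" by (rule finite_subset[of _ I]) (auto simp: I_def)
    have full: "real s * \<theta> \<le> (\<Sum>c | c \<in> I \<and> v \<in> K c. p c)" if "x - int s + 1 \<ge> lo$k" "x \<le> hi$k - int s"
    proof -
      have "real s * \<theta> = (\<Sum>c \<in> {x - int s + 1..x}. \<theta>)" by simp
      also have "\<dots> \<le> (\<Sum>c \<in> {x - int s + 1..x}. p c)" by (intro sum_mono p0)
      also have "\<dots> \<le> (\<Sum>c | c \<in> I \<and> v \<in> K c. p c)"
        by (rule sum_mono2[OF fin]) (use that p0 in \<open>auto simp: I_def vK\<close>)
      finally show ?thesis .
    qed
    have single: "p c \<le> (\<Sum>c | c \<in> I \<and> v \<in> K c. p c)" if "c \<in> I" "v \<in> K c" for c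
      by (rule member_le_sum) (use that fin p0 in \<open>auto\<close>)
    have two: "(\<Sum>c \<in> I \<inter> {x + 1, x - int s}. p c * \<phi>) \<le> 2 * (t * \<phi>)"
      if t: "\<And>c. c \<in> I \<inter> {x + 1, x - int s} \<Longrightarrow> p c \<le> t" and t0: "t \<ge> 0" for t
    proof -
      have "(\<Sum>c \<in> I \<inter> {x + 1, x - int s}. p c * \<phi>) \<le> real (card (I \<inter> {x + 1, x - int s})) * (t * \<phi>)"
        by (intro sum_bounded_above mult_right_mono t) (use \<phi> in auto)
      also have "\<dots> \<le> 2 * (t * \<phi>)"
      proof (rule mult_right_mono)
        have "card (I \<inter> {x + 1, x - int s}) \<le> card {x + 1, x - int s}" by (rule card_mono) auto
        also have "\<dots> \<le> 2" by (simp add: card_insert_if)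
        finally show "real (card (I \<inter> {x + 1, x - int s})) \<le> 2" by simp
      qed (use \<phi> t0 in auto)
      finally show ?thesis .
    qed
    show "(\<Sum>c | c \<in> I \<and> v \<notin> K c. p c * \<Phi> c v) + 1/2 \<le> (\<Sum>c | c \<in> I \<and> v \<in> K c. p c)"
    \<comment> \<open>The first case is a site next to the inner end of an extreme slice. By
      \<open>len\<close>, all \<open>s\<close> slices through such a site lie in the box. In the
      second case the adjacent slices have weight \<open>\<theta>\<close>, and an extreme slice
      alone supplies weight 1 unless again all \<open>s\<close> slices fit.\<close>
    proof (cases "x + 1 = hi$k - int s \<or> x - int s = lo$k")
      case True
      hence "3 * \<phi> \<le> (\<Sum>c | c \<in> I \<and> v \<in> K c. p c)"
        using full s\<theta> len spos by auto
      moreover have "(\<Sum>c \<in> I \<inter> {x + 1, x - int s}. p c * \<phi>) \<le> 2 * (1 * \<phi>)"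
        by (rule two) (use p0 in auto)
      ultimately show ?thesis using out \<phi> by linarith
    next
      case False
      have "p c \<le> \<theta>" if "c \<in> I \<inter> {x + 1, x - int s}" for c
        using False that x by (auto simp: p_def)
      hence "(\<Sum>c \<in> I \<inter> {x + 1, x - int s}. p c * \<phi>) \<le> 2 * (\<theta> * \<phi>)"
        using two[of \<theta>] \<theta>0 by simp
      moreover have "1 \<le> (\<Sum>c | c \<in> I \<and> v \<in> K c. p c)"
      proof -
        consider "x < lo$k + int s" | "x \<ge> hi$k - int s" | "x - int s + 1 \<ge> lo$k" "x \<le> hi$k - int s"
          by linarith
        thus ?thesis
        proof cases
          case 1
          thus ?thesis using single[of "lo$k"] x len by (simp add: I_def vK p_def)
        next
          case 2
          thus ?thesis using single[of "hi$k - int s"] x len by (simp add: I_def vK p_def)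
        next
          case 3
          thus ?thesis using full s\<theta> \<phi> by linarith
        qed
      qed
      ultimately show ?thesis using out \<theta>\<phi> by linarith
    qed
  qed simp
  \<comment> \<open>The slices touching \<open>u\<close> have total weight at most
    \<open>(s + 2) * \<theta> + 2 \<le> 9 * \<phi> + 2\<close>. This is multiplied by the influence
    \<open>\<phi>\<close> and divided by the rate 1/2, and
    \<open>2 * \<phi> * (9 * \<phi> + 2) \<le> 22 * \<phi>\<^sup>2\<close>.\<close>
  moreover have "(\<Sum>c\<in>I. p c * \<Phi> c u) / (1/2) \<le> 22 * \<phi>\<^sup>2"
  proof -
    let ?J = "{u$k - int s .. u$k + 1}"
    have "(\<Sum>c\<in>I. p c * \<Phi> c u) \<le> (\<Sum>c\<in>I \<inter> ?J. p c * \<phi>)"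
    proof -
      have "(\<Sum>c\<in>I. p c * \<Phi> c u) = (\<Sum>c\<in>I \<inter> ?J. p c * \<Phi> c u)"
      proof (rule sum.mono_neutral_right)
        show "\<forall>c\<in>I - I \<inter> ?J. p c * \<Phi> c u = 0"
        proof
          fix c assume c: "c \<in> I - I \<inter> ?J"
          have "u \<notin> bdry (K c)"
          proof
            assume "u \<in> bdry (K c)"
            from adjk[OF this] show False using c by auto
          qed
          thus "p c * \<Phi> c u = 0" by (simp add: \<Phi>_def)
        qed
      qed (auto simp: I_def)
      also have "\<dots> \<le> (\<Sum>c\<in>I \<inter> ?J. p c * \<phi>)"
        by (intro sum_mono mult_left_mono) (use p0 \<phi> in \<open>auto simp: \<Phi>_def\<close>)
      finally show ?thesis .
    qed
    also have "\<dots> = \<phi> * (\<Sum>c\<in>I \<inter> ?J. p c)" by (simp add: sum_distrib_left mult.commute)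
    also have "(\<Sum>c\<in>I \<inter> ?J. p c) \<le> 9 * \<phi> + 2"
    proof -
      have "(\<Sum>c\<in>I \<inter> ?J. p c) \<le> (\<Sum>c\<in>?J. \<theta> + (if c = lo$k then 1 else 0) + (if c = hi$k - int s then 1 else 0))"
        by (rule sum_mono2[THEN order_trans, OF _ _ _ sum_mono])
          (use \<theta>0 p0 in \<open>auto simp: p_def\<close>)
      also have "\<dots> \<le> real (s + 2) * \<theta> + 1 + 1"
      proof -
        have "(\<Sum>c\<in>?J. \<theta>) = real (s + 2) * \<theta>" by simp
        thus ?thesis unfolding sum.distrib by (simp add: sum.delta)
      qed
      also have "real (s + 2) * \<theta> \<le> 3 * (real s * \<theta>)"
        using \<theta>0 spos by simp
      finally show ?thesis using s\<theta> by linarith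
    qed
    hence "\<phi> * (\<Sum>c\<in>I \<inter> ?J. p c) \<le> \<phi> * (9 * \<phi> + 2)" using \<phi> by (intro mult_left_mono) auto
    finally have "(\<Sum>c\<in>I. p c * \<Phi> c u) \<le> 9 * \<phi>\<^sup>2 + 2 * \<phi>" by (simp add: power2_eq_square algebra_simps)
    thus ?thesis using \<phi>2 by simp
  qed
  ultimately show ?thesis by (rule influence_le_mono)
qed

end

text \<open>Closed form of the \<open>n\<close>-fold iterate of
  \<open>x \<mapsto> 22 * x\<^sup>2\<close>, the loss incurred by widening one more coordinate
  direction.\<close>

definition widened :: "real \<Rightarrow> nat \<Rightarrow> real" where
  "widened \<phi> n = (22 * \<phi>) ^ (2 ^ n) / 22"

lemma widened_Suc: "widened \<phi> (Suc n) = 22 * (widened \<phi> n)\<^sup>2"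
  by (simp add: widened_def power2_eq_square power_mult_distrib mult_2 flip: power_add)

lemma widened_mono: "\<phi> \<ge> 1 \<Longrightarrow> n \<le> m \<Longrightarrow> widened \<phi> n \<le> widened \<phi> m"
  unfolding widened_def by (intro divide_right_mono power_increasing) auto

lemma widened_ge_1:
  assumes "\<phi> \<ge> 1"
  shows "widened \<phi> n \<ge> 1"
  using widened_mono[OF assms, of 0 n] assms by (simp add: widened_def)

text \<open>A natural number above \<open>12 * (widened (near_bound d r) d)\<^sup>2\<close>: 66 is
  22 times the 3 of \<open>near_bound\<close>, and the division by 22 is dropped. For fixed
  \<open>d\<close> it is polynomial in \<open>r\<close>.\<close>

definition slice_width :: "nat \<Rightarrow> nat \<Rightarrow> nat" where
  "slice_width d r = 12 * (66 * (2 * r + 1) ^ d) ^ (2 ^ Suc d)"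

text \<open>Twice the near sites from \<open>influence_le_ssm\<close>, and room for a far part of at
  most 1. It does not depend on the side of the cube.\<close>

definition near_bound :: "nat \<Rightarrow> nat \<Rightarrow> real" where
  "near_bound d r = 3 * real ((2 * r + 1) ^ d)"

lemma near_bound_ge_1: "near_bound d r \<ge> 1"
proof -
  have "real ((2 * r + 1) ^ d) \<ge> 1" by (metis of_nat_1 of_nat_le_iff one_le_power le_add2)
  thus ?thesis unfolding near_bound_def by linarith
qed

lemma slice_width_ge: "real (slice_width d r) \<ge> 12 * (widened (near_bound d r) d)\<^sup>2"
proof -
  define t where "t = (66 * real ((2 * r + 1) ^ d)) ^ (2 ^ Suc d)"
  have t0: "t \<ge> 0" by (simp add: t_def)
  have w: "(widened (near_bound d r) d)\<^sup>2 = t / 484"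
  proof -
    have "22 * near_bound d r = 66 * real ((2 * r + 1) ^ d)" unfolding near_bound_def by linarith
    moreover have "(x ^ (2 ^ d) / 22)\<^sup>2 = x ^ (2 ^ Suc d) / 484" for x :: real
      by (simp add: power_divide mult.commute flip: power_mult)
    ultimately show ?thesis unfolding widened_def t_def by metis
  qed
  have "real (slice_width d r) = 12 * t" by (simp add: slice_width_def t_def)
  thus ?thesis using w t0 by simp
qed

lemma slice_width_pos: "slice_width d r \<ge> 1"
  by (simp add: slice_width_def Suc_le_eq)

text \<open>Fixes the scale \<open>r\<close>: the volume of a cube of side
  \<open>slice_width d r\<close> is polynomial in \<open>r\<close>, so the exponential decay
  wins.\<close>

lemma exp_beats_slice_width:
  fixes a b :: real
  assumes a: "a > 0"
  shows "\<exists>r. 2 * b * real (slice_width d r ^ d) * exp (- a * real r) \<le> 1"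
proof -
  define k where "k = d * 2 ^ Suc d * d"
  define A where "A = 2 * b * (12 * 66 ^ (2 ^ Suc d)) ^ d"
  have eq: "2 * b * real (slice_width d r ^ d) = A * (2 * real r + 1) ^ k" for r
    by (simp add: slice_width_def A_def k_def power_mult_distrib flip: power_mult) (simp add: add.commute mult_ac)
  have "(\<lambda>r. A * ((2 / a * (a * real r) + 1) ^ k / exp (a * real r))) \<longlonglongrightarrow> A * 0"
  proof (intro tendsto_mult tendsto_const)
    have 1: "((\<lambda>x::real. (2 / a * x + 1) ^ k / exp x) \<longlongrightarrow> 0) at_top"
      using a by real_asymp
    have "filterlim (\<lambda>r. a * real r) at_top sequentially" using a by real_asymp
    from filterlim_compose[OF 1 this]
    show "(\<lambda>r. (2 / a * (a * real r) + 1) ^ k / exp (a * real r)) \<longlonglongrightarrow> 0" .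
  qed
  hence "\<forall>\<^sub>F r in sequentially. A * ((2 / a * (a * real r) + 1) ^ k / exp (a * real r)) < 1"
    by (intro order_tendstoD) auto
  then obtain r where "A * ((2 / a * (a * real r) + 1) ^ k / exp (a * real r)) < 1"
    by (auto simp: eventually_sequentially)
  hence "2 * b * real (slice_width d r ^ d) * exp (- a * real r) \<le> 1"
    unfolding eq using a by (simp add: exp_minus field_simps)
  thus ?thesis ..
qed

section \<open>Boxes wide in all directions, and unions of separated boxes\<close>

context permissive_spin_system
begin

text \<open>Induction on the set of directions in which the box is wide, starting from a cube of
  side \<open>s\<close>. The condition on \<open>s\<close> is stated with the final bound, which
  dominates the bounds of all stages.\<close>

lemma influence_le_ibox:
  fixes lo hi :: "int^'d"
  assumes \<phi>: "\<phi> \<ge> 1" and s: "real s \<ge> 12 * (widened \<phi> CARD('d))\<^sup>2"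
    and cube: "\<And>(c::int^'d) u. influence_le (ibox c (\<chi> i. c$i + int s)) u \<phi>"
    and len: "\<And>i. hi$i - lo$i \<ge> 2 * int s"
  shows "influence_le (ibox lo hi) u (widened \<phi> CARD('d))"
proof -
  have "influence_le (ibox lo hi) u (widened \<phi> (card A))"
    if "finite A" "\<forall>i\<in>A. hi$i - lo$i \<ge> 2 * int s" "\<forall>i. i \<notin> A \<longrightarrow> hi$i = lo$i + int s"
    for A and lo hi u :: "int^'d"
    using that
  proof (induction A arbitrary: lo hi u rule: finite_induct)
    case empty
    have "hi = (\<chi> i. lo$i + int s)" using empty by (simp add: Finite_Cartesian_Product.vec_eq_iff)
    thus ?case using cube[of lo u] by (simp add: widened_def)
  next
    case (insert k A)
    have "influence_le (ibox lo hi) u (22 * (widened \<phi> (card A))\<^sup>2)"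
    proof (rule influence_le_widen[where k = k and s = s])
      show "widened \<phi> (card A) \<ge> 1" by (rule widened_ge_1[OF \<phi>])
      have "widened \<phi> (card A) \<le> widened \<phi> CARD('d)"
        by (intro widened_mono[OF \<phi>] card_mono) auto
      hence "(widened \<phi> (card A))\<^sup>2 \<le> (widened \<phi> CARD('d))\<^sup>2"
        using widened_ge_1[OF \<phi>, of "card A"] by (intro power_mono) auto
      thus "real s \<ge> 12 * (widened \<phi> (card A))\<^sup>2" using s by linarith
      show "hi$k - lo$k \<ge> 2 * int s" using insert.prems by simp
      show "influence_le (ibox (\<chi> i. if i = k then c else lo$i) (\<chi> i. if i = k then c + int s else hi$i)) w
          (widened \<phi> (card A))" for c w
        by (rule insert.IH) (use insert.prems insert.hyps in auto)
    qed
    thus ?case using insert.hyps by (simp add: widened_Suc)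
  qed
  from this[of UNIV] len show ?thesis by simp
qed

text \<open>Strong spatial mixing is applied to cubes of one fixed side only; the resulting bound is
  the same for all boxes, however large.\<close>

lemma influence_le_fat_ibox:
  fixes lo hi :: "int^'d"
  assumes ssm: "has_SSM q U W a b (TYPE('d))"
    and r: "2 * b * real (slice_width CARD('d) r ^ CARD('d)) * exp (- a * real r) \<le> 1"
    and len: "\<And>i. hi$i - lo$i \<ge> 2 * int (slice_width CARD('d) r)"
  shows "influence_le (ibox lo hi) u (widened (near_bound CARD('d) r) CARD('d))"
proof (rule influence_le_ibox[OF near_bound_ge_1 slice_width_ge _ len])
  fix c u :: "int^'d"
  let ?s = "slice_width CARD('d) r"
  let ?Q = "ibox c (\<chi> i. c$i + int ?s)"
  have "is_cube ?Q" unfolding is_cube_def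
    by (rule exI[of _ c], rule exI[of _ ?s]) (use slice_width_pos[of "CARD('d)" r] in \<open>auto simp: ibox_def\<close>)
  hence Q: "ssm_cond q U W ?Q a b" "a > 0" "b > 0" using ssm by (auto simp: has_SSM_def)
  have card: "card ?Q = ?s ^ CARD('d)" by (simp add: card_ibox)
  have "real ((2 * r + 1) ^ CARD('d)) \<ge> 1" by (metis of_nat_1 of_nat_le_iff one_le_power le_add2)
  hence "2 * real ((2 * r + 1) ^ CARD('d)) + 2 * b * real (card ?Q) * exp (- a * real r) \<le> near_bound CARD('d) r"
    unfolding card near_bound_def using r by linarith
  thus "influence_le ?Q u (near_bound CARD('d) r)"
    by (rule influence_le_mono[OF influence_le_ssm[OF Q(1) finite_ibox Q(2,3)]])
qed

text \<open>The pieces do not touch, so resampling all of them with weight 1 leaves no influence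
  between sites of the union, and \<open>influence_le_blocks\<close> applies with rate 1. The site
  \<open>u\<close> touches at most one piece.\<close>

lemma influence_le_Union:
  fixes \<R> :: "(int^'d) set set"
  assumes fin: "finite (\<Union>\<R>)" and \<phi>: "\<phi> \<ge> 0"
    and infl: "\<And>R w. R \<in> \<R> \<Longrightarrow> influence_le R w \<phi>"
    and sep: "\<And>R v. R \<in> \<R> \<Longrightarrow> v \<in> \<Union>\<R> \<Longrightarrow> v \<notin> bdry R"
    and uniq: "\<And>R R'. R \<in> \<R> \<Longrightarrow> R' \<in> \<R> \<Longrightarrow> u \<in> bdry R \<Longrightarrow> u \<in> bdry R' \<Longrightarrow> R = R'"
  shows "influence_le (\<Union>\<R>) u \<phi>"
proof (cases "u \<in> \<Union>\<R>")
  case True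
  thus ?thesis using \<phi> by (intro influence_le_nonbdry) (auto simp: bdry_def)
next
  case False
  have f\<R>: "finite \<R>" using fin by (rule finite_UnionD)
  define \<Phi> where "\<Phi> R w = (if w \<in> bdry R then \<phi> else 0)" for R and w :: "int^'d"
  have "influence_le (\<Union>\<R>) u ((\<Sum>R\<in>\<R>. 1 * \<Phi> R u) / 1)"
  proof (rule influence_le_blocks[OF fin f\<R>, where K = "\<lambda>R. R"])
    show "\<Phi> R w \<ge> 0" for R w using \<phi> by (simp add: \<Phi>_def)
    show "influence_le R w (\<Phi> R w)" if "R \<in> \<R>" for R w
      using infl[OF that] influence_le_nonbdry[of w R 0] by (simp add: \<Phi>_def)
    fix v assume v: "v \<in> \<Union>\<R>"
    then obtain R where R: "R \<in> \<R>" "v \<in> R" by auto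
    have "(\<Sum>R | R \<in> \<R> \<and> v \<notin> R. 1 * \<Phi> R v) = 0"
      by (rule sum.neutral) (use sep v in \<open>auto simp: \<Phi>_def\<close>)
    moreover have "(1::real) \<le> (\<Sum>R | R \<in> \<R> \<and> v \<in> R. 1)"
      using member_le_sum[of R "{R. R \<in> \<R> \<and> v \<in> R}" "\<lambda>_. 1::real"] R f\<R> by simp
    ultimately show "(\<Sum>R | R \<in> \<R> \<and> v \<notin> R. 1 * \<Phi> R v) + 1 \<le> (\<Sum>R | R \<in> \<R> \<and> v \<in> R. 1)" by simp
  qed (use False in auto)
  moreover have "(\<Sum>R\<in>\<R>. 1 * \<Phi> R u) / 1 \<le> \<phi>"
  proof (cases "\<exists>R\<in>\<R>. u \<in> bdry R")
    case True
    then obtain R where R: "R \<in> \<R>" "u \<in> bdry R" by auto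
    have "(\<Sum>R\<in>\<R>. \<Phi> R u) = (\<Sum>R'\<in>\<R>. if R' = R then \<phi> else 0)"
      by (rule sum.cong) (use uniq R in \<open>auto simp: \<Phi>_def\<close>)
    thus ?thesis using f\<R> R by simp
  next
    case False
    hence "(\<Sum>R\<in>\<R>. \<Phi> R u) = 0" by (intro sum.neutral) (auto simp: \<Phi>_def)
    thus ?thesis using \<phi> by simp
  qed
  ultimately show ?thesis by (rule influence_le_mono)
qed

end

subsection \<open>Tilings\<close>

text \<open>The part of the tile at lattice position \<open>h\<close> inside the cube with corner
  \<open>c\<close> and side \<open>l\<close>; it may be empty.\<close>

definition tile_box :: "nat \<Rightarrow> int^'d \<Rightarrow> int^'d \<Rightarrow> nat \<Rightarrow> int^'d \<Rightarrow> (int^'d) set" where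
  "tile_box L x c l h = ibox
     (\<chi> i. max (x$i + (int L + 3) * h$i - (int L - 1) div 2) (c$i))
     (\<chi> i. min (x$i + (int L + 3) * h$i + (int L - 1) div 2 + 1) (c$i + int l))"

lemma linf_le_iff: "linf y \<le> t \<longleftrightarrow> (\<forall>i. \<bar>y$i\<bar> \<le> t)"
  unfolding linf_def by (subst Max_le_iff) auto

lemma mem_tileC_iff:
  "y \<in> tileC L x \<longleftrightarrow> (\<exists>h. \<forall>i. \<bar>y$i - x$i - (int L + 3) * h$i\<bar> \<le> (int L - 1) div 2)"
  unfolding tileC_def linf_le_iff by (simp add: algebra_simps)

text \<open>The lattice shift can be chosen separately in each coordinate; this reduces the counting
  of tilings to one dimension.\<close>

lemma mem_tileC_iff_coord:
  "y \<in> tileC L x \<longleftrightarrow> (\<forall>i. \<exists>k. \<bar>y$i - x$i - (int L + 3) * k\<bar> \<le> (int L - 1) div 2)"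
proof
  assume "\<forall>i. \<exists>k. \<bar>y$i - x$i - (int L + 3) * k\<bar> \<le> (int L - 1) div 2"
  then obtain k where "\<bar>y$i - x$i - (int L + 3) * k i\<bar> \<le> (int L - 1) div 2" for i by metis
  thus "y \<in> tileC L x" unfolding mem_tileC_iff by (intro exI[of _ "\<chi> i. k i"]) simp
qed (auto simp: mem_tileC_iff)

lemma tileC_Int_ibox:
  "tileC L x \<inter> ibox c (\<chi> i. c$i + int l) = \<Union> (range (tile_box L x c l))"
proof (rule Set.set_eqI)
  fix y
  have "y \<in> tile_box L x c l h \<longleftrightarrow> y \<in> ibox c (\<chi> i. c$i + int l)
      \<and> (\<forall>i. \<bar>y$i - x$i - (int L + 3) * h$i\<bar> \<le> (int L - 1) div 2)" for h
    unfolding tile_box_def ibox_def mem_Collect_eq vec_lambda_beta all_conj_distrib[symmetric]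
    by (intro all_cong1) (auto simp: abs_le_iff)
  thus "y \<in> tileC L x \<inter> ibox c (\<chi> i. c$i + int l) \<longleftrightarrow> y \<in> \<Union> (range (tile_box L x c l))"
    by (auto simp: mem_tileC_iff)
qed

text \<open>Tiles have width \<open>L\<close> and period \<open>L + 3\<close>, so points of
  different tiles differ by at least 4 in some coordinate. The threshold 2 serves two purposes:
  pieces are not adjacent, and they share no boundary site.\<close>

lemma tile_box_separated:
  assumes L: "odd L" and v: "v \<in> tile_box L x c l h" and w: "w \<in> tile_box L x c l h'"
    and near: "\<And>i. \<bar>v$i - w$i\<bar> \<le> 2"
  shows "h = h'"
proof -
  have "h$i = h'$i" for i
  proof -
    define m where "m = (int L - 1) div 2"
    have m: "2 * m = int L - 1" using L by (simp add: m_def)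
    define y where "y = (int L + 3) * h$i"
    define y' where "y' = (int L + 3) * h'$i"
    have 1: "v$i \<ge> x$i + y - m" "v$i \<le> x$i + y + m"
      using v by (auto simp: tile_box_def ibox_def m_def y_def)
    have 2: "w$i \<ge> x$i + y' - m" "w$i \<le> x$i + y' + m"
      using w by (auto simp: tile_box_def ibox_def m_def y'_def)
    have "(int L + 3) * \<bar>h$i - h'$i\<bar> = \<bar>y - y'\<bar>"
      by (simp add: abs_mult y_def y'_def flip: right_diff_distrib)
    also have "\<dots> < (int L + 3) * 1"
    proof -
      have "v$i - w$i \<le> 2" "w$i - v$i \<le> 2" using near[of i] by linarith+
      hence "y - y' < int L + 3" "y' - y < int L + 3" using 1 2 m by linarith+
      thus ?thesis by simp
    qed
    finally have "\<bar>h$i - h'$i\<bar> < 1" by (subst (asm) mult_less_cancel_left_pos) auto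
    thus ?thesis by simp
  qed
  thus ?thesis by (simp add: Finite_Cartesian_Product.vec_eq_iff)
qed

lemma card_tile_box: "odd L \<Longrightarrow> card (tile_box L x c l h :: (int^'d) set) \<le> L ^ CARD('d)"
proof -
  assume L: "odd L"
  have "card (tile_box L x c l h) \<le> (\<Prod>i::'d\<in>UNIV. L)"
    unfolding tile_box_def card_ibox by (rule prod_mono) (use L in auto)
  thus ?thesis by simp
qed

text \<open>The minimum with \<open>l\<close> counts a piece that spans a short cube as fat. The
  condition runs over all intervals in each coordinate, even if the box they would bound is empty in
  another, so that it can be counted coordinate by coordinate.\<close>

definition fat_tiling :: "nat \<Rightarrow> int^'d \<Rightarrow> int^'d \<Rightarrow> nat \<Rightarrow> nat \<Rightarrow> bool" where
  "fat_tiling L x c l t \<longleftrightarrow> (\<forall>i k.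
     let len = min (x$i + (int L + 3) * k + (int L - 1) div 2 + 1) (c$i + int l)
             - max (x$i + (int L + 3) * k - (int L - 1) div 2) (c$i)
     in len \<le> 0 \<or> len \<ge> int (min t l))"

lemma fat_tiling_sides:
  assumes "fat_tiling L x c l t" "tile_box L x c l h \<noteq> {}"
  shows "min (x$i + (int L + 3) * h$i + (int L - 1) div 2 + 1) (c$i + int l)
             - max (x$i + (int L + 3) * h$i - (int L - 1) div 2) (c$i) \<ge> int (min t l)"
proof -
  obtain y where "y \<in> tile_box L x c l h" using assms by auto
  hence "max (x$i + (int L + 3) * h$i - (int L - 1) div 2) (c$i) \<le> y$i"
    "y$i < min (x$i + (int L + 3) * h$i + (int L - 1) div 2 + 1) (c$i + int l)"
    unfolding tile_box_def ibox_def mem_Collect_eq vec_lambda_beta by blast+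
  thus ?thesis using assms(1)[unfolded fat_tiling_def Let_def, rule_format, of i "h$i"] by linarith
qed

section \<open>Counting the tilings that miss a site or have a thin piece\<close>

lemma card_tile_index: "card (tile_index L :: (int^'d) set) = (L + 3) ^ CARD('d)"
proof -
  have "tile_index L = {x::int^'d. \<forall>i. x$i \<in> {0..int L + 2}}" by (auto simp: tile_index_def)
  thus ?thesis by (simp only: card_vec_PiE) (simp add: nat_add_distrib add.commute)
qed

lemma finite_tile_index: "finite (tile_index L :: (int^'d) set)"
proof (rule card_ge_0_finite)
  show "card (tile_index L :: (int^'d) set) > 0" by (simp add: card_tile_index)
qed

text \<open>Union bound over the coordinate responsible, which is confined to at most
  \<open>k\<close> of its \<open>L + 3\<close> values.\<close>

lemma card_tile_index_le:
  fixes S :: "'d::finite \<Rightarrow> int set"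
  assumes S: "\<And>i. S i \<subseteq> {0..int L + 2}" and k: "\<And>i. card (S i) \<le> k"
  shows "real (card {x \<in> tile_index L. \<exists>i. x$i \<in> S i}) \<le> real (CARD('d) * k) / real (L + 3) * real ((L + 3) ^ CARD('d))"
proof -
  let ?N = "CARD('d)"
  have "{x \<in> tile_index L. \<exists>i. x$i \<in> S i} \<subseteq> (\<Union>i. {x. \<forall>j. x$j \<in> (if j = i then S i else {0..int L + 2})})"
    by (auto simp: tile_index_def)
  moreover have fin: "finite (\<Union>i. {x. \<forall>j. x$j \<in> (if j = i then S i else {0..int L + 2})})"
    by (intro finite_UN_I finite_vec_PiE) (auto intro: finite_subset[OF S])
  ultimately have "card {x \<in> tile_index L. \<exists>i. x$i \<in> S i}
    \<le> card (\<Union>i. {x. \<forall>j. x$j \<in> (if j = i then S i else {0..int L + 2})})" by (meson card_mono)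
  also have "\<dots> \<le> (\<Sum>i\<in>UNIV. card {x::int^'d. \<forall>j. x$j \<in> (if j = i then S i else {0..int L + 2})})"
    by (rule card_UN_le) simp
  also have "\<dots> \<le> (\<Sum>i::'d\<in>UNIV. k * (L + 3) ^ (?N - 1))"
  proof (rule sum_mono)
    fix i :: 'd
    have "card {x::int^'d. \<forall>j. x$j \<in> (if j = i then S i else {0..int L + 2})}
      = (\<Prod>j\<in>UNIV. card (if j = i then S i else {0..int L + 2}))" by (rule card_vec_PiE)
    also have "\<dots> = card (S i) * (\<Prod>j\<in>UNIV - {i}. L + 3)"
      by (subst prod.remove[of _ i]) (auto simp: nat_add_distrib add.commute intro!: prod.cong)
    also have "\<dots> \<le> k * (L + 3) ^ (?N - 1)" using k[of i] by simp
    finally show "card {x::int^'d. \<forall>j. x$j \<in> (if j = i then S i else {0..int L + 2})} \<le> k * (L + 3) ^ (?N - 1)" .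
  qed
  also have "\<dots> = ?N * k * (L + 3) ^ (?N - 1)" by simp
  finally have "real (card {x \<in> tile_index L. \<exists>i. x$i \<in> S i}) \<le> real (?N * k * (L + 3) ^ (?N - 1))"
    by (rule of_nat_mono)
  also have "\<dots> = real (?N * k) / real (L + 3) * real ((L + 3) ^ ?N)"
  proof -
    have "(L + 3) ^ ?N = (L + 3) * (L + 3) ^ (?N - 1)"
      by (metis One_nat_def Suc_pred power_Suc zero_less_card_finite)
    thus ?thesis by simp
  qed
  finally show ?thesis .
qed

lemma card_uncovered:
  fixes v :: "int^'d"
  assumes L: "odd L"
  shows "real (card {x \<in> tile_index L. v \<notin> tileC L x})
    \<le> real (CARD('d) * 3) / real (L + 3) * real ((L + 3) ^ CARD('d))"
proof -
  define m where "m = (int L - 1) div 2"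
  have m: "2 * m = int L - 1" using L by (simp add: m_def)
  let ?M = "int L + 3"
  define S where "S i = {t \<in> {0..int L + 2}. \<forall>k. \<not> \<bar>v$i - t - ?M * k\<bar> \<le> m}" for i
  have c: "card (S i) \<le> 3" for i
  proof -
    \<comment> \<open>Shifted by \<open>m\<close>, the tile occupies the residues 0 to L - 1 modulo
      \<open>L + 3\<close>, and the gap the three residues L to L + 2.\<close>
    let ?f = "\<lambda>t. (v$i - t + m) mod ?M"
    have "inj_on ?f (S i)"
    proof (rule inj_onI)
      fix t t' assume t: "t \<in> S i" "t' \<in> S i" and "?f t = ?f t'"
      hence "?M dvd (v$i - t + m) - (v$i - t' + m)" by (simp add: mod_eq_dvd_iff)
      hence "?M dvd t' - t" by simp
      moreover have "\<bar>t' - t\<bar> < ?M" using t by (auto simp: S_def)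
      ultimately show "t = t'" using dvd_imp_le_int[of "t' - t" ?M] by fastforce
    qed
    moreover have "?f ` S i \<subseteq> {int L..int L + 2}"
    proof
      fix y assume "y \<in> ?f ` S i"
      then obtain t where t: "t \<in> S i" "y = ?f t" by auto
      have y: "0 \<le> y" "y < ?M" using t by auto
      have "v$i - t + m = ?M * ((v$i - t + m) div ?M) + y" using t by simp
      moreover have "\<not> \<bar>v$i - t - ?M * ((v$i - t + m) div ?M)\<bar> \<le> m" using t by (simp add: S_def)
      ultimately have "\<not> \<bar>y - m\<bar> \<le> m" by (simp add: algebra_simps)
      thus "y \<in> {int L..int L + 2}" using y m by auto
    qed
    ultimately have "card (S i) \<le> card {int L..int L + 2}" by (intro card_inj_on_le) auto
    thus ?thesis by simp
  qed
  have "{x \<in> tile_index L. v \<notin> tileC L x} = {x \<in> tile_index L. \<exists>i. x$i \<in> S i}"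
    by (auto simp: mem_tileC_iff_coord S_def m_def tile_index_def)
  moreover have "S i \<subseteq> {0..int L + 2}" for i by (auto simp: S_def)
  ultimately show ?thesis using card_tile_index_le[of S L 3] c by simp
qed

text \<open>A nonempty side shorter than \<open>min t l\<close> is cut at exactly one end of the
  cube: an uncut side has length \<open>L \<ge> t\<close>, and one cut at both ends has length
  \<open>l\<close>. For each end there are at most \<open>t\<close> starting points of the
  tile.\<close>

lemma card_thin:
  fixes c :: "int^'d"
  assumes L: "odd L" and t: "t \<le> L"
  shows "real (card {x \<in> tile_index L. \<not> fat_tiling L x c l t})
    \<le> real (CARD('d) * (2 * t)) / real (L + 3) * real ((L + 3) ^ CARD('d))"
proof -
  define m where "m = (int L - 1) div 2"
  have m: "2 * m = int L - 1" using L by (simp add: m_def)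
  let ?M = "int L + 3"
  define len where "len i x k = min (x + ?M * k + m + 1) (c$i + int l) - max (x + ?M * k - m) (c$i)" for i x k
  define S where "S i = {x \<in> {0..int L + 2}. \<exists>k. \<not> (len i x k \<le> 0 \<or> len i x k \<ge> int (min t l))}" for i
  have "card (S i) \<le> 2 * t" for i
  proof -
    \<comment> \<open>Starting points of an interval cut at the upper end of the cube, and of one
      cut at the lower end.\<close>
    let ?J = "{c$i + int l - int t..<c$i + int l} \<union> {c$i - int L..<c$i - int L + int t}"
    have "S i \<subseteq> (\<lambda>z. (z + m) mod ?M) ` ?J"
    proof
      fix x assume x: "x \<in> S i"
      then obtain k where "\<not> (len i x k \<le> 0 \<or> len i x k \<ge> int (min t l))" unfolding S_def by blast
      hence k: "len i x k > 0" "len i x k < int t" "len i x k < int l" by linarith+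
      have "x + ?M * k - m \<in> ?J" using k m t by (auto simp: len_def min_def max_def split: if_splits)
      moreover have "x = ((x + ?M * k - m) + m) mod ?M" using x by (simp add: S_def)
      ultimately show "x \<in> (\<lambda>z. (z + m) mod ?M) ` ?J" by blast
    qed
    hence "card (S i) \<le> card ?J" by (meson card_image_le card_mono finite_UnI finite_atLeastLessThan_int finite_imageI le_trans)
    also have "\<dots> \<le> t + t" by (rule order_trans[OF card_Un_le]) simp
    finally show ?thesis by simp
  qed
  moreover have "{x \<in> tile_index L. \<not> fat_tiling L x c l t} = {x \<in> tile_index L. \<exists>i. x$i \<in> S i}"
    unfolding fat_tiling_def Let_def S_def len_def m_def by (auto simp: tile_index_def)
  moreover have "S i \<subseteq> {0..int L + 2}" for i by (auto simp: S_def)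
  ultimately show ?thesis using card_tile_index_le[of S L "2 * t"] by simp
qed

section \<open>Influence on a tiling\<close>

context permissive_spin_system
begin

lemma influence_le_tiling:
  fixes x c u :: "int^'d"
  assumes L: "odd L" and \<phi>: "\<phi> \<ge> 0"
    and box: "\<And>h w. tile_box L x c l h \<noteq> {} \<Longrightarrow> influence_le (tile_box L x c l h) w \<phi>"
  shows "influence_le (tileC L x \<inter> ibox c (\<chi> i. c$i + int l)) u \<phi>"
  unfolding tileC_Int_ibox
proof (rule influence_le_Union[OF _ \<phi>])
  show "finite (\<Union> (range (tile_box L x c l)))"
    unfolding tileC_Int_ibox[symmetric] using finite_ibox by blast
  show "influence_le R w \<phi>" if "R \<in> range (tile_box L x c l)" for R w
    using that box influence_le_nonbdry[of w "{}", OF _ \<phi>] by (cases "R = {}") (auto simp: bdry_def)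
  show "v \<notin> bdry R" if R: "R \<in> range (tile_box L x c l)" and v: "v \<in> \<Union> (range (tile_box L x c l))" for R v
  proof
    assume b: "v \<in> bdry R"
    obtain h h' where h: "R = tile_box L x c l h" "v \<in> tile_box L x c l h'" using R v by auto
    obtain w where w: "w \<in> tile_box L x c l h" "adj v w" using b h by (auto simp: bdry_def)
    have "\<bar>v$i - w$i\<bar> \<le> 2" for i
      using abs_component_le_l1dist[of v i w] w by (simp add: adj_def)
    hence "h' = h" using tile_box_separated[OF L h(2) w(1)] by blast
    thus False using b h by (simp add: bdry_def)
  qed
  show "R = R'" if R: "R \<in> range (tile_box L x c l)" "R' \<in> range (tile_box L x c l)"
    and u: "u \<in> bdry R" "u \<in> bdry R'" for R R'
  proof -
    obtain h h' where h: "R = tile_box L x c l h" "R' = tile_box L x c l h'" using R by auto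
    obtain w w' where w: "w \<in> tile_box L x c l h" "adj u w" "w' \<in> tile_box L x c l h'" "adj u w'"
      using u h by (auto simp: bdry_def)
    have "\<bar>w$i - w'$i\<bar> \<le> 2" for i
      using abs_component_le_l1dist[of u i w] abs_component_le_l1dist[of u i w'] w
      by (simp add: adj_def)
    hence "h = h'" using tile_box_separated[OF L w(1,3)] by blast
    thus ?thesis using h by simp
  qed
qed

text \<open>Covers thin pieces too: at most one piece lies next to \<open>u\<close> and reacts, and
  it has at most \<open>L ^ CARD('d)\<close> sites.\<close>

lemma influence_le_tiling_trivial:
  fixes x c u :: "int^'d"
  assumes L: "odd L"
  shows "influence_le (tileC L x \<inter> ibox c (\<chi> i. c$i + int l)) u (real (L ^ CARD('d)))"
proof (rule influence_le_tiling[OF L])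
  fix h w
  show "influence_le (tile_box L x c l h) w (real (L ^ CARD('d)))"
    by (rule influence_le_mono[OF influence_le_card])
      (use card_tile_box[OF L] in \<open>auto simp only: tile_box_def finite_ibox of_nat_le_iff\<close>)
qed simp

text \<open>If the cube is shorter than \<open>t\<close>, fatness forces each nonempty piece to be
  the whole cube. The update then resamples everything or nothing, and a site \<open>u\<close> of
  the cube has no influence.\<close>

lemma influence_le_fat_tiling:
  fixes x c u :: "int^'d"
  assumes L: "odd L" and \<phi>: "\<phi> \<ge> 0" and fat: "fat_tiling L x c l t" and u: "u \<in> ibox c (\<chi> i. c$i + int l)"
    and box: "\<And>(lo::int^'d) hi w. (\<And>i. hi$i - lo$i \<ge> int t) \<Longrightarrow> influence_le (ibox lo hi) w \<phi>"
  shows "influence_le (tileC L x \<inter> ibox c (\<chi> i. c$i + int l)) u \<phi>"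
proof (cases "t \<le> l")
  case True
  show ?thesis
  proof (rule influence_le_tiling[OF L \<phi>])
    fix h w assume ne: "tile_box L x c l h \<noteq> {}"
    show "influence_le (tile_box L x c l h) w \<phi>"
      unfolding tile_box_def by (rule box) (use fat_tiling_sides[OF fat ne] True in auto)
  qed
next
  case False
  have "tile_box L x c l h = ibox c (\<chi> i. c$i + int l)" if ne: "tile_box L x c l h \<noteq> {}" for h
  proof -
    have "max (x$i + (int L + 3) * h$i - (int L - 1) div 2) (c$i) = c$i \<and>
      min (x$i + (int L + 3) * h$i + (int L - 1) div 2 + 1) (c$i + int l) = c$i + int l" for i
      using fat_tiling_sides[OF fat ne, of i] False by (auto simp: min_def max_def split: if_splits)
    thus ?thesis by (simp add: tile_box_def)
  qed
  hence "tileC L x \<inter> ibox c (\<chi> i. c$i + int l) \<in> {{}, ibox c (\<chi> i. c$i + int l)}"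
    unfolding tileC_Int_ibox by blast
  thus ?thesis using u by (intro influence_le_nonbdry[OF _ \<phi>]) (auto simp: bdry_def)
qed

end

subsection \<open>Contraction of the Hoelder seminorm\<close>

lemma hdist_sym: "hdist V \<sigma> \<tau> = hdist V \<tau> \<sigma>"
  by (simp add: hdist_def eq_commute)

lemma hdist_triangle: "finite V \<Longrightarrow> hdist V \<sigma> \<tau> \<le> hdist V \<sigma> \<rho> + hdist V \<rho> \<tau>"
proof -
  assume fin: "finite V"
  have "hdist V \<sigma> \<tau> \<le> card ({v \<in> V. \<sigma> v \<noteq> \<rho> v} \<union> {v \<in> V. \<rho> v \<noteq> \<tau> v})"
    unfolding hdist_def by (rule card_mono) (use fin in auto)
  also have "\<dots> \<le> hdist V \<sigma> \<rho> + hdist V \<rho> \<tau>" unfolding hdist_def by (rule card_Un_le)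
  finally show ?thesis .
qed

text \<open>The Lipschitz seminorm for the metric \<open>hdist powr \<alpha>\<close>; at distance 0
  the bound is 0, as \<open>0 powr \<alpha> = 0\<close>.\<close>

definition hoelder :: "nat \<Rightarrow> (int^'d) set \<Rightarrow> real \<Rightarrow> real \<Rightarrow> ((int^'d \<Rightarrow> nat) \<Rightarrow> real) \<Rightarrow> bool" where
  "hoelder q V \<alpha> c f \<longleftrightarrow>
     (\<forall>\<sigma>\<in>configs q V. \<forall>\<tau>\<in>configs q V. \<bar>f \<sigma> - f \<tau>\<bar> \<le> c * real (hdist V \<sigma> \<tau>) powr \<alpha>)"

text \<open>\<open>g\<close> is the inf-convolution of \<open>f\<close> with a cone of slope
  \<open>c * t powr (\<alpha> - 1)\<close>. The error is at most \<open>c * d powr \<alpha>\<close>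
  minus slope times \<open>d\<close> for some distance \<open>d\<close>; up to \<open>d = t\<close>
  the first term is at most \<open>c * t powr \<alpha>\<close>, and beyond that the cone
  wins.\<close>

lemma hoelder_lip_approx:
  assumes fin: "finite V" and \<alpha>: "0 < \<alpha>" "\<alpha> \<le> 1" and c: "c \<ge> 0" and t: "t > 0" and f: "hoelder q V \<alpha> c f"
  shows "\<exists>g. lip q V (c * t powr (\<alpha> - 1)) g \<and> (\<forall>\<sigma>\<in>configs q V. \<bar>f \<sigma> - g \<sigma>\<bar> \<le> c * t powr \<alpha>)"
proof -
  let ?k = "c * t powr (\<alpha> - 1)"
  let ?A = "\<lambda>\<sigma>. (\<lambda>\<tau>. f \<tau> + ?k * real (hdist V \<sigma> \<tau>)) ` configs q V"
  define g where "g \<sigma> = Min (?A \<sigma>)" for \<sigma>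
  have k: "?k \<ge> 0" using c by simp
  have fA: "finite (?A \<sigma>)" for \<sigma> using finite_configs[OF fin] by simp
  have le: "g \<sigma> \<le> f \<tau> + ?k * real (hdist V \<sigma> \<tau>)" if "\<tau> \<in> configs q V" for \<sigma> \<tau>
    unfolding g_def by (rule Min_le[OF fA]) (use that in blast)
  have att: "\<exists>\<tau>\<in>configs q V. g \<sigma> = f \<tau> + ?k * real (hdist V \<sigma> \<tau>)" if "\<sigma> \<in> configs q V" for \<sigma>
  proof -
    have "g \<sigma> \<in> ?A \<sigma>" unfolding g_def by (rule Min_in[OF fA]) (use that in blast)
    thus ?thesis by blast
  qed
  have one: "g \<sigma> - g \<sigma>' \<le> ?k * real (hdist V \<sigma> \<sigma>')" if \<sigma>': "\<sigma>' \<in> configs q V" for \<sigma> \<sigma>'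
  proof -
    obtain \<tau> where \<tau>: "\<tau> \<in> configs q V" "g \<sigma>' = f \<tau> + ?k * real (hdist V \<sigma>' \<tau>)" using att[OF \<sigma>'] by blast
    have "?k * real (hdist V \<sigma> \<tau>) \<le> ?k * (real (hdist V \<sigma> \<sigma>') + real (hdist V \<sigma>' \<tau>))"
      using hdist_triangle[OF fin, of \<sigma> \<tau> \<sigma>'] by (intro mult_left_mono k) linarith
    thus ?thesis using le[OF \<tau>(1), of \<sigma>] \<tau>(2) unfolding distrib_left by linarith
  qed
  have "lip q V ?k g"
    unfolding lip_def abs_le_iff
  proof (intro ballI conjI)
    fix \<sigma> \<tau> assume "\<sigma> \<in> configs q V" "\<tau> \<in> configs q V"
    thus "g \<sigma> - g \<tau> \<le> ?k * real (hdist V \<sigma> \<tau>)" "- (g \<sigma> - g \<tau>) \<le> ?k * real (hdist V \<sigma> \<tau>)"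
      using one[of \<tau> \<sigma>] one[of \<sigma> \<tau>] by (simp_all add: hdist_sym[of V \<tau>])
  qed
  moreover have "\<bar>f \<sigma> - g \<sigma>\<bar> \<le> c * t powr \<alpha>" if \<sigma>: "\<sigma> \<in> configs q V" for \<sigma>
  proof -
    have "g \<sigma> \<le> f \<sigma>" using le[OF \<sigma>, of \<sigma>] by (simp add: hdist_def)
    obtain \<tau> where \<tau>: "\<tau> \<in> configs q V" "g \<sigma> = f \<tau> + ?k * real (hdist V \<sigma> \<tau>)" using att[OF \<sigma>] by blast
    define d where "d = real (hdist V \<sigma> \<tau>)"
    have d0: "d \<ge> 0" by (simp add: d_def)
    have "\<bar>f \<sigma> - f \<tau>\<bar> \<le> c * d powr \<alpha>" using f \<sigma> \<tau>(1) unfolding hoelder_def d_def by blast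
    hence *: "f \<sigma> - g \<sigma> \<le> c * (d powr \<alpha> - t powr (\<alpha> - 1) * d)"
      unfolding \<tau>(2) by (simp add: d_def algebra_simps)
    have "d powr \<alpha> - t powr (\<alpha> - 1) * d \<le> t powr \<alpha>"
    proof (cases "d \<le> t")
      case True
      hence "d powr \<alpha> \<le> t powr \<alpha>" using d0 \<alpha> by (intro powr_mono2) auto
      moreover have "t powr (\<alpha> - 1) * d \<ge> 0" using d0 by simp
      ultimately show ?thesis by linarith
    next
      case False
      hence d: "d > 0" using t by simp
      have "d powr \<alpha> = d powr (\<alpha> - 1) * d" using d powr_add[of d "\<alpha> - 1" 1] by simp
      also have "\<dots> \<le> t powr (\<alpha> - 1) * d"
        using False t \<alpha> d by (intro mult_right_mono powr_mono2') auto
      finally have "d powr \<alpha> - t powr (\<alpha> - 1) * d \<le> 0" by simp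
      thus ?thesis using powr_ge_zero[of t \<alpha>] by linarith
    qed
    hence "c * (d powr \<alpha> - t powr (\<alpha> - 1) * d) \<le> c * t powr \<alpha>" using c by (rule mult_left_mono)
    thus ?thesis using * \<open>g \<sigma> \<le> f \<sigma>\<close> by linarith
  qed
  ultimately show ?thesis by blast
qed

text \<open>
  Interpolation between the supremum norm and the Lipschitz seminorm. It plays the role of Jensen's
  inequality for the concave metric \<open>hdist powr \<alpha>\<close>, which dampens the rare steps with a large
  Lipschitz constant.
\<close>

lemma hoelder_interpolate:
  assumes fin: "finite V" and \<alpha>: "0 < \<alpha>" "\<alpha> \<le> 1" and c: "c \<ge> 0" and \<Gamma>: "\<Gamma> > 0" and f: "hoelder q V \<alpha> c f"
    and sup: "\<And>f g e. e \<ge> 0 \<Longrightarrow> (\<And>\<sigma>. \<sigma> \<in> configs q V \<Longrightarrow> \<bar>f \<sigma> - g \<sigma>\<bar> \<le> e) \<Longrightarrow>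
      (\<And>\<sigma>. \<sigma> \<in> configs q V \<Longrightarrow> \<bar>T f \<sigma> - T g \<sigma>\<bar> \<le> e)"
    and lip: "\<And>f k. k \<ge> 0 \<Longrightarrow> lip q V k f \<Longrightarrow> lip q V (k * \<Gamma>) (T f)"
  shows "hoelder q V \<alpha> (3 * c * \<Gamma> powr \<alpha>) (T f)"
  unfolding hoelder_def
proof (intro ballI)
  fix \<sigma> \<tau> assume \<sigma>: "\<sigma> \<in> configs q V" and \<tau>: "\<tau> \<in> configs q V"
  show "\<bar>T f \<sigma> - T f \<tau>\<bar> \<le> 3 * c * \<Gamma> powr \<alpha> * real (hdist V \<sigma> \<tau>) powr \<alpha>"
  proof (cases "hdist V \<sigma> \<tau> = 0")
    case True
    thus ?thesis using hdist_eq_0_configs[OF fin \<sigma> \<tau>] c by simp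
  next
    case False
    define d where "d = real (hdist V \<sigma> \<tau>)"
    \<comment> \<open>This scale balances the errors: the approximation costs
      \<open>c * t powr \<alpha>\<close> twice and the Lipschitz part costs the same once, hence the
      factor 3.\<close>
    define t where "t = \<Gamma> * d"
    have d: "d > 0" using False by (simp add: d_def)
    have t: "t > 0" using d \<Gamma> by (simp add: t_def)
    obtain g where g: "lip q V (c * t powr (\<alpha> - 1)) g" "\<And>\<sigma>. \<sigma> \<in> configs q V \<Longrightarrow> \<bar>f \<sigma> - g \<sigma>\<bar> \<le> c * t powr \<alpha>"
      using hoelder_lip_approx[OF fin \<alpha> c t f] by blast
    have e: "c * t powr \<alpha> \<ge> 0" and k: "c * t powr (\<alpha> - 1) \<ge> 0" using c by auto
    have 1: "\<bar>T f \<rho> - T g \<rho>\<bar> \<le> c * t powr \<alpha>" if "\<rho> \<in> configs q V" for \<rho>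
      by (rule sup[OF e g(2) that])
    have "\<bar>T g \<sigma> - T g \<tau>\<bar> \<le> c * t powr (\<alpha> - 1) * \<Gamma> * d"
      using lip[OF k g(1)] \<sigma> \<tau> unfolding lip_def d_def by blast
    also have "\<dots> = c * (t powr (\<alpha> - 1) * t)" by (simp add: t_def)
    also have "t powr (\<alpha> - 1) * t = t powr \<alpha>" using t powr_add[of t "\<alpha> - 1" 1] by simp
    finally have "\<bar>T f \<sigma> - T f \<tau>\<bar> \<le> 3 * (c * t powr \<alpha>)"
      using 1[OF \<sigma>] 1[OF \<tau>] by linarith
    also have "t powr \<alpha> = \<Gamma> powr \<alpha> * d powr \<alpha>" using \<Gamma> d by (simp add: t_def powr_mult)
    finally show ?thesis by (simp add: d_def mult_ac)
  qed
qed

section \<open>The block dynamics as an operator on functions\<close>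

context permissive_spin_system
begin

lemma abs_cond_ex_diff_le:
  assumes fin: "finite V" and K: "K \<subseteq> V" and bc: "is_bc q V \<psi>" and \<sigma>: "\<sigma> \<in> configs q V"
    and fg: "\<And>\<sigma>. \<sigma> \<in> configs q V \<Longrightarrow> \<bar>f \<sigma> - g \<sigma>\<bar> \<le> e"
  shows "\<bar>cond_ex V K \<psi> f \<sigma> - cond_ex V K \<psi> g \<sigma>\<bar> \<le> e"
  unfolding cond_ex_def
  by (rule abs_ex_diff_le[OF finite_subset[OF K fin] is_bc_inner[OF bc \<sigma> K]])
    (rule fg[OF configs_override[OF \<sigma> _ K]])

lemma lip_cond_ex:
  assumes fin: "finite V" and K: "K \<subseteq> V" and bc: "is_bc q V \<psi>" and \<phi>: "\<phi> \<ge> 0"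
    and infl: "\<And>v. influence_le K v \<phi>" and f: "lip q V c f" and c: "c \<ge> 0"
  shows "lip q V (c * (1 + \<phi>)) (cond_ex V K \<psi> f)"
proof (rule lip_single_flip[OF fin])
  fix \<sigma> v s assume "\<sigma> \<in> configs q V" "v \<in> V" "s \<in> {1..q}"
  hence "\<bar>cond_ex V K \<psi> f (\<sigma>(v := s)) - cond_ex V K \<psi> f \<sigma>\<bar> \<le> c * (if v \<in> K then 0 else 1 + \<phi>)"
    by (intro cond_ex_flip[OF fin K bc f c] infl) auto
  also have "\<dots> \<le> c * (1 + \<phi>)" using c \<phi> by auto
  finally show "\<bar>cond_ex V K \<psi> f (\<sigma>(v := s)) - cond_ex V K \<psi> f \<sigma>\<bar> \<le> c * (1 + \<phi>)" .
qed

definition block_op :: "nat \<Rightarrow> (int^'d) set \<Rightarrow> (int^'d \<Rightarrow> nat option)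
    \<Rightarrow> ((int^'d \<Rightarrow> nat) \<Rightarrow> real) \<Rightarrow> (int^'d \<Rightarrow> nat) \<Rightarrow> real" where
  "block_op L V \<psi> f \<sigma> =
     (1 / real ((L + 3) ^ CARD('d))) * (\<Sum>x\<in>tile_index L. cond_ex V (tileC L x \<inter> V) \<psi> f \<sigma>)"

text \<open>Only tilings that leave \<open>v\<close> uncovered react to a flip at \<open>v\<close>.
  Their share is at most 3 d / (L + 3), and each fat one costs at most
  \<open>1 + \<phi>\<close>.\<close>

lemma lip_fat_part:
  fixes c :: "int^'d" and l L :: nat
  defines "V \<equiv> ibox c (\<chi> i. c$i + int l)"
  assumes L: "odd L" and \<phi>: "\<phi> \<ge> 0"
    and box: "\<And>(lo::int^'d) hi w. (\<And>i. hi$i - lo$i \<ge> int t) \<Longrightarrow> influence_le (ibox lo hi) w \<phi>"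
    and bc: "is_bc q V \<psi>" and f: "lip q V k f" and k: "k \<ge> 0"
  shows "lip q V (k * ((1 + \<phi>) * (real (CARD('d) * 3) / real (L + 3))))
    (\<lambda>\<sigma>. (1 / real ((L + 3) ^ CARD('d))) *
       (\<Sum>x | x \<in> tile_index L \<and> fat_tiling L x c l t. cond_ex V (tileC L x \<inter> V) \<psi> f \<sigma>))"
proof (rule lip_single_flip)
  show fin: "finite V" by (simp add: V_def finite_ibox)
  let ?M = "real ((L + 3) ^ CARD('d))"
  have M: "?M > 0" by simp
  let ?G = "{x. x \<in> tile_index L \<and> fat_tiling L x c l t}"
  fix \<sigma> v s assume \<sigma>: "\<sigma> \<in> configs q V" and v: "v \<in> V" and s: "s \<in> {1..q}"
  let ?D = "\<lambda>x. cond_ex V (tileC L x \<inter> V) \<psi> f (\<sigma>(v := s)) - cond_ex V (tileC L x \<inter> V) \<psi> f \<sigma>"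
  have "\<bar>\<Sum>x\<in>?G. ?D x\<bar> \<le> (\<Sum>x\<in>?G. k * (1 + \<phi>) * (if v \<in> tileC L x then 0 else 1))"
  proof (rule order_trans[OF sum_abs sum_mono])
    fix x assume x: "x \<in> ?G"
    have "influence_le (tileC L x \<inter> V) v \<phi>"
      unfolding V_def by (rule influence_le_fat_tiling[OF L \<phi> _ _ box]) (use x v in \<open>auto simp: V_def\<close>)
    hence "\<bar>?D x\<bar> \<le> k * (if v \<in> tileC L x \<inter> V then 0 else 1 + \<phi>)"
      by (intro cond_ex_flip[OF fin _ bc f k \<sigma> v s]) auto
    also have "\<dots> = k * (1 + \<phi>) * (if v \<in> tileC L x then 0 else 1)" using v by simp
    finally show "\<bar>?D x\<bar> \<le> k * (1 + \<phi>) * (if v \<in> tileC L x then 0 else 1)" .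
  qed
  also have "\<dots> \<le> (\<Sum>x\<in>tile_index L. k * (1 + \<phi>) * (if v \<in> tileC L x then 0 else 1))"
    using k \<phi> by (intro sum_mono2[OF finite_tile_index]) auto
  also have "\<dots> = k * (1 + \<phi>) * real (card {x \<in> tile_index L. v \<notin> tileC L x})"
  proof -
    have "(\<Sum>x\<in>tile_index L. if v \<in> tileC L x then 0 else 1)
      = (\<Sum>x\<in>tile_index L. if v \<notin> tileC L x then 1 else (0::real))" by (rule sum.cong) auto
    also have "\<dots> = real (card {x \<in> tile_index L. v \<notin> tileC L x})"
      by (subst sum.inter_filter[OF finite_tile_index, symmetric]) simp
    finally show ?thesis by (simp flip: sum_distrib_left)
  qed
  also have "\<dots> \<le> k * (1 + \<phi>) * (real (CARD('d) * 3) / real (L + 3) * ?M)"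
    using k \<phi> by (intro mult_left_mono card_uncovered[OF L]) auto
  finally have le: "\<bar>\<Sum>x\<in>?G. ?D x\<bar> \<le> k * ((1 + \<phi>) * (real (CARD('d) * 3) / real (L + 3))) * ?M"
    by (simp only: mult.assoc)
  have "\<bar>1 / ?M * (\<Sum>x\<in>?G. cond_ex V (tileC L x \<inter> V) \<psi> f (\<sigma>(v := s)))
     - 1 / ?M * (\<Sum>x\<in>?G. cond_ex V (tileC L x \<inter> V) \<psi> f \<sigma>)\<bar> = \<bar>\<Sum>x\<in>?G. ?D x\<bar> / ?M"
    unfolding right_diff_distrib[symmetric] sum_subtractf[symmetric] abs_mult using M by simp
  also have "\<dots> \<le> k * ((1 + \<phi>) * (real (CARD('d) * 3) / real (L + 3)))"
    using le by (subst pos_divide_le_eq[OF M])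
  finally show "\<bar>1 / ?M * (\<Sum>x\<in>?G. cond_ex V (tileC L x \<inter> V) \<psi> f (\<sigma>(v := s)))
     - 1 / ?M * (\<Sum>x\<in>?G. cond_ex V (tileC L x \<inter> V) \<psi> f \<sigma>)\<bar>
     \<le> k * ((1 + \<phi>) * (real (CARD('d) * 3) / real (L + 3)))" .
qed

text \<open>Fat tilings are averaged before the interpolation, so that their small mean Lipschitz
  constant is raised to the power \<open>\<alpha>\<close>. Thin ones are interpolated one by one,
  which keeps their share O(t / L) outside the power.\<close>

lemma hoelder_block_op:
  fixes c :: "int^'d" and l L :: nat
  defines "V \<equiv> ibox c (\<chi> i. c$i + int l)"
  assumes L: "odd L" and t: "t \<le> L" and \<phi>: "\<phi> \<ge> 0" and \<alpha>: "0 < \<alpha>" "\<alpha> \<le> 1"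
    and box: "\<And>(lo::int^'d) hi w. (\<And>i. hi$i - lo$i \<ge> int t) \<Longrightarrow> influence_le (ibox lo hi) w \<phi>"
    and rate: "3 * ((1 + \<phi>) * (real (CARD('d) * 3) / real (L + 3))) powr \<alpha>
      + 3 * (real (CARD('d) * (2 * t)) / real (L + 3)) * (1 + real (L ^ CARD('d))) powr \<alpha> \<le> 1/2"
    and bc: "is_bc q V \<psi>" and f: "hoelder q V \<alpha> k f" and k: "k \<ge> 0"
  shows "hoelder q V \<alpha> (k / 2) (block_op L V \<psi> f)"
  unfolding hoelder_def
proof (intro ballI)
  fix \<sigma> \<tau> assume \<sigma>: "\<sigma> \<in> configs q V" and \<tau>: "\<tau> \<in> configs q V"
  have fin: "finite V" by (simp add: V_def finite_ibox)
  let ?M = "real ((L + 3) ^ CARD('d))"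
  have M: "?M > 0" by simp
  have cardM: "real (card (tile_index L :: (int^'d) set)) = ?M" by (simp add: card_tile_index)
  let ?G = "{x. x \<in> tile_index L \<and> fat_tiling L x c l t}"
  let ?B = "{x. x \<in> tile_index L \<and> \<not> fat_tiling L x c l t}"
  define E where "E x f = cond_ex V (tileC L x \<inter> V) \<psi> f" for x f
  define G where "G f \<sigma> = (1 / ?M) * (\<Sum>x\<in>?G. E x f \<sigma>)" for f \<sigma>
  let ?g = "(1 + \<phi>) * (real (CARD('d) * 3) / real (L + 3))"
  let ?K = "1 + real (L ^ CARD('d))"
  let ?d = "real (hdist V \<sigma> \<tau>) powr \<alpha>"
  have fG: "finite ?G" "finite ?B" using finite_tile_index[of L] by auto
  have "hoelder q V \<alpha> (3 * k * ?g powr \<alpha>) (G f)"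
  proof (rule hoelder_interpolate[OF fin \<alpha> k _ f])
    show "?g > 0" using \<phi> by (intro mult_pos_pos divide_pos_pos) auto
    show "lip q V (j * ?g) (G h)" if "j \<ge> 0" "lip q V j h" for h j
      unfolding G_def[abs_def] E_def[abs_def] V_def
      by (rule lip_fat_part[OF L \<phi> box]) (use bc that in \<open>auto simp: V_def\<close>)
    fix f g \<sigma> and e :: real
    assume e: "e \<ge> 0" and fg: "\<And>\<sigma>. \<sigma> \<in> configs q V \<Longrightarrow> \<bar>f \<sigma> - g \<sigma>\<bar> \<le> e" and \<sigma>: "\<sigma> \<in> configs q V"
    have "\<bar>\<Sum>x\<in>?G. E x f \<sigma> - E x g \<sigma>\<bar> \<le> (\<Sum>x\<in>?G. e)"
      unfolding E_def
      by (rule order_trans[OF sum_abs sum_mono], rule abs_cond_ex_diff_le[OF fin _ bc \<sigma> fg]) auto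
    also have "\<dots> \<le> (\<Sum>x\<in>(tile_index L :: (int^'d) set). e)"
      using e by (intro sum_mono2[OF finite_tile_index]) auto
    also have "\<dots> = e * ?M" by (simp add: card_tile_index)
    finally have "\<bar>\<Sum>x\<in>?G. E x f \<sigma> - E x g \<sigma>\<bar> / ?M \<le> e" by (subst pos_divide_le_eq[OF M])
    moreover have "\<bar>G f \<sigma> - G g \<sigma>\<bar> = \<bar>\<Sum>x\<in>?G. E x f \<sigma> - E x g \<sigma>\<bar> / ?M"
      unfolding G_def right_diff_distrib[symmetric] sum_subtractf[symmetric] abs_mult using M by simp
    ultimately show "\<bar>G f \<sigma> - G g \<sigma>\<bar> \<le> e" by simp
  qed
  hence 1: "\<bar>G f \<sigma> - G f \<tau>\<bar> \<le> 3 * k * ?g powr \<alpha> * ?d"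
    using \<sigma> \<tau> unfolding hoelder_def by blast
  have bad: "\<bar>E x f \<sigma> - E x f \<tau>\<bar> \<le> 3 * k * ?K powr \<alpha> * ?d" for x
  proof -
    have "hoelder q V \<alpha> (3 * k * ?K powr \<alpha>) (E x f)"
    proof (rule hoelder_interpolate[OF fin \<alpha> k _ f])
      show "?K > 0" by (simp add: add_pos_nonneg)
      show "lip q V (j * ?K) (E x h)" if "j \<ge> 0" "lip q V j h" for h j
        unfolding E_def
        by (rule lip_cond_ex[OF fin _ bc _ _ that(2,1)])
          (use influence_le_tiling_trivial[OF L, of x c l] in \<open>auto simp: V_def\<close>)
    qed (auto simp: E_def intro: abs_cond_ex_diff_le[OF fin _ bc])
    thus ?thesis using \<sigma> \<tau> unfolding hoelder_def by blast
  qed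
  have 2: "\<bar>(1 / ?M) * (\<Sum>x\<in>?B. E x f \<sigma> - E x f \<tau>)\<bar>
    \<le> real (CARD('d) * (2 * t)) / real (L + 3) * (3 * k * ?K powr \<alpha> * ?d)"
  proof -
    have "\<bar>\<Sum>x\<in>?B. E x f \<sigma> - E x f \<tau>\<bar> \<le> (\<Sum>x\<in>?B. 3 * k * ?K powr \<alpha> * ?d)"
      by (rule order_trans[OF sum_abs sum_mono]) (rule bad)
    also have "\<dots> = real (card ?B) * (3 * k * ?K powr \<alpha> * ?d)" by simp
    also have "\<dots> \<le> (real (CARD('d) * (2 * t)) / real (L + 3) * ?M) * (3 * k * ?K powr \<alpha> * ?d)"
      using card_thin[OF L t, of c l] k by (intro mult_right_mono) auto
    finally have "\<bar>\<Sum>x\<in>?B. E x f \<sigma> - E x f \<tau>\<bar> / ?M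
      \<le> real (CARD('d) * (2 * t)) / real (L + 3) * (3 * k * ?K powr \<alpha> * ?d)"
      by (subst pos_divide_le_eq[OF M]) (simp only: mult_ac)
    thus ?thesis unfolding abs_mult using M by simp
  qed
  have split: "block_op L V \<psi> f \<rho> = G f \<rho> + (1 / ?M) * (\<Sum>x\<in>?B. E x f \<rho>)" for \<rho>
  proof -
    have "(\<Sum>x\<in>tile_index L. E x f \<rho>) = (\<Sum>x\<in>?G \<union> ?B. E x f \<rho>)"
      by (rule sum.cong) auto
    also have "\<dots> = (\<Sum>x\<in>?G. E x f \<rho>) + (\<Sum>x\<in>?B. E x f \<rho>)"
      by (rule sum.union_disjoint[OF fG]) auto
    finally show ?thesis unfolding block_op_def G_def E_def by (simp add: distrib_left)
  qed
  have "block_op L V \<psi> f \<sigma> - block_op L V \<psi> f \<tau>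
    = (G f \<sigma> - G f \<tau>) + (1 / ?M) * (\<Sum>x\<in>?B. E x f \<sigma> - E x f \<tau>)"
    unfolding split sum_subtractf right_diff_distrib by simp
  hence "\<bar>block_op L V \<psi> f \<sigma> - block_op L V \<psi> f \<tau>\<bar>
    \<le> \<bar>G f \<sigma> - G f \<tau>\<bar> + \<bar>(1 / ?M) * (\<Sum>x\<in>?B. E x f \<sigma> - E x f \<tau>)\<bar>"
    by (simp only: abs_triangle_ineq)
  also have "\<dots> \<le> 3 * k * ?g powr \<alpha> * ?d + real (CARD('d) * (2 * t)) / real (L + 3) * (3 * k * ?K powr \<alpha> * ?d)"
    using 1 2 by (rule add_mono)
  also have "\<dots> = (k * ?d) * (3 * ?g powr \<alpha> + 3 * (real (CARD('d) * (2 * t)) / real (L + 3)) * ?K powr \<alpha>)"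
    unfolding distrib_left by (simp only: mult_ac)
  also have "\<dots> \<le> (k * ?d) * (1/2)" using rate k by (intro mult_left_mono) auto
  finally show "\<bar>block_op L V \<psi> f \<sigma> - block_op L V \<psi> f \<tau>\<bar> \<le> k / 2 * ?d" by simp
qed

lemma sum_block_dyn:
  assumes fin: "finite V" and bc: "is_bc q V \<psi>" and \<sigma>: "\<sigma> \<in> Omega q U W V \<psi>"
  shows "(\<Sum>\<tau>\<in>Omega q U W V \<psi>. block_dyn q U W L V \<psi> \<sigma> \<tau> * f \<tau>) = block_op L V \<psi> f \<sigma>"
proof -
  have "(\<Sum>\<tau>\<in>Omega q U W V \<psi>. block_dyn q U W L V \<psi> \<sigma> \<tau> * f \<tau>)
    = (1 / real ((L + 3) ^ CARD('d))) * (\<Sum>\<tau>\<in>Omega q U W V \<psi>. \<Sum>x\<in>tile_index L. hb q U W V \<psi> (tileC L x \<inter> V) \<sigma> \<tau> * f \<tau>)"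
    by (simp add: block_dyn_def sum_distrib_left sum_distrib_right mult.assoc)
  also have "(\<Sum>\<tau>\<in>Omega q U W V \<psi>. \<Sum>x\<in>tile_index L. hb q U W V \<psi> (tileC L x \<inter> V) \<sigma> \<tau> * f \<tau>)
    = (\<Sum>x\<in>tile_index L. \<Sum>\<tau>\<in>Omega q U W V \<psi>. hb q U W V \<psi> (tileC L x \<inter> V) \<sigma> \<tau> * f \<tau>)"
    by (rule sum.swap)
  also have "\<dots> = (\<Sum>x\<in>tile_index L. cond_ex V (tileC L x \<inter> V) \<psi> f \<sigma>)"
    by (rule sum.cong[OF refl sum_hb[OF fin _ bc \<sigma>]]) simp
  finally show ?thesis by (simp add: block_op_def)
qed

lemma sum_mpow_block_dyn:
  assumes fin: "finite V" and bc: "is_bc q V \<psi>" and \<sigma>: "\<sigma> \<in> Omega q U W V \<psi>"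
  shows "(\<Sum>\<tau>\<in>Omega q U W V \<psi>. mpow (Omega q U W V \<psi>) (block_dyn q U W L V \<psi>) t \<sigma> \<tau> * f \<tau>)
    = (block_op L V \<psi> ^^ t) f \<sigma>"
  using \<sigma>
proof (induction t arbitrary: \<sigma>)
  case 0
  have "finite (Omega q U W V \<psi>)" using finite_configs[OF fin] by (simp add: Omega_def)
  thus ?case using 0 by (simp add: if_distrib[of "\<lambda>x. x * _"] cong: if_cong)
next
  case (Suc t)
  let ?\<Omega> = "Omega q U W V \<psi>" and ?P = "block_dyn q U W L V \<psi>"
  have "(\<Sum>\<tau>\<in>?\<Omega>. mpow ?\<Omega> ?P (Suc t) \<sigma> \<tau> * f \<tau>) = (\<Sum>\<tau>\<in>?\<Omega>. \<Sum>\<rho>\<in>?\<Omega>. ?P \<sigma> \<rho> * (mpow ?\<Omega> ?P t \<rho> \<tau> * f \<tau>))"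
    by (simp add: sum_distrib_right mult.assoc)
  also have "\<dots> = (\<Sum>\<rho>\<in>?\<Omega>. \<Sum>\<tau>\<in>?\<Omega>. ?P \<sigma> \<rho> * (mpow ?\<Omega> ?P t \<rho> \<tau> * f \<tau>))" by (rule sum.swap)
  also have "\<dots> = (\<Sum>\<rho>\<in>?\<Omega>. ?P \<sigma> \<rho> * (block_op L V \<psi> ^^ t) f \<rho>)"
    by (rule sum.cong) (auto simp: Suc.IH simp flip: sum_distrib_left)
  also have "\<dots> = (block_op L V \<psi> ^^ Suc t) f \<sigma>" by (simp add: sum_block_dyn[OF fin bc Suc.prems])
  finally show ?case .
qed

lemma ex_block_op:
  assumes "finite V" "is_bc q V \<psi>"
  shows "ex V \<psi> (block_op L V \<psi> f) = ex V \<psi> f"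
proof -
  have "ex V \<psi> (block_op L V \<psi> f)
    = (1 / real ((L + 3) ^ CARD('d))) * (\<Sum>x\<in>tile_index L. ex V \<psi> (cond_ex V (tileC L x \<inter> V) \<psi> f))"
    unfolding block_op_def[abs_def] ex_cmult ex_sum ..
  also have "(\<Sum>x\<in>tile_index L. ex V \<psi> (cond_ex V (tileC L x \<inter> V) \<psi> f))
    = (\<Sum>x\<in>(tile_index L :: (int^'d) set). ex V \<psi> f)"
    by (rule sum.cong) (auto simp: ex_cond_ex assms)
  also have "\<dots> = real ((L + 3) ^ CARD('d)) * ex V \<psi> f" by (simp add: card_tile_index)
  finally show ?thesis by simp
qed

lemma ex_block_op_power:
  assumes "finite V" "is_bc q V \<psi>"
  shows "ex V \<psi> ((block_op L V \<psi> ^^ t) f) = ex V \<psi> f"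
  by (induction t) (simp_all add: ex_block_op[OF assms])

end

subsection \<open>Mixing time and spectral gap\<close>

text \<open>\<open>abs_spectral_gap\<close> takes a \<open>Max\<close>, which is meaningful only for
  a finite set. The kernel is copied to a matrix along an enumeration of \<open>\<Omega>\<close>,
  and the spectrum of a matrix is finite.\<close>

lemma finite_eigenvalues:
  assumes "finite \<Omega>"
  shows "finite {l. is_eigenvalue \<Omega> P l}"
proof -
  define N where "N = card \<Omega>"
  obtain e where e: "bij_betw e {0..<N} \<Omega>"
    using ex_bij_betw_nat_finite[OF assms] by (auto simp: N_def)
  define A where "A = mat N N (\<lambda>(i,j). P (e i) (e j))"
  have A: "A \<in> carrier_mat N N" by (simp add: A_def)
  have "eigenvalue A l" if "is_eigenvalue \<Omega> P l" for l
  proof -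
    from that obtain f where
      "(\<exists>x\<in>\<Omega>. f x \<noteq> 0) \<and> (\<forall>x\<in>\<Omega>. (\<Sum>y\<in>\<Omega>. P x y * f y) = l * f x)"
      unfolding is_eigenvalue_def by (rule exE)
    hence nz: "\<exists>x\<in>\<Omega>. f x \<noteq> 0" and f: "\<forall>x\<in>\<Omega>. (\<Sum>y\<in>\<Omega>. P x y * f y) = l * f x"
      by (rule conjunct1, rule conjunct2)
    obtain x where x: "x \<in> \<Omega>" "f x \<noteq> 0" using nz by blast
    define v where "v = Matrix.vec N (\<lambda>i. f (e i))"
    have ran: "e i \<in> \<Omega>" if "i < N" for i using e that by (auto simp: bij_betw_def)
    obtain i where i: "i < N" "e i = x" using x e by (auto simp: bij_betw_def)
    have "v \<noteq> 0\<^sub>v N"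
    proof
      assume "v = 0\<^sub>v N"
      hence "vec_index v i = vec_index (0\<^sub>v N) i" by simp
      thus False using i x by (simp add: v_def)
    qed
    moreover have "A *\<^sub>v v = l \<cdot>\<^sub>v v"
    proof (rule eq_vecI)
      fix i assume "i < dim_vec (l \<cdot>\<^sub>v v)"
      hence i: "i < N" by (simp add: v_def)
      have "vec_index (A *\<^sub>v v) i = (\<Sum>j\<in>{0..<N}. P (e i) (e j) * f (e j))"
        using i by (simp add: A_def v_def scalar_prod_def)
      also have "\<dots> = l * f (e i)"
        using sum.reindex_bij_betw[OF e, of "\<lambda>y. P (e i) y * f y"] bspec[OF f ran[OF i]] by simp
      finally show "vec_index (A *\<^sub>v v) i = vec_index (l \<cdot>\<^sub>v v) i" using i by (simp add: v_def)
    qed (simp add: A_def v_def)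
    ultimately show ?thesis
      unfolding eigenvalue_def eigenvector_def by (intro exI[of _ v]) (simp add: A_def v_def)
  qed
  hence "{l. is_eigenvalue \<Omega> P l} \<subseteq> spectrum A" by (auto simp: spectrum_def)
  thus ?thesis using card_finite_spectrum(1)[OF A] finite_subset by blast
qed

context permissive_spin_system
begin

text \<open>Both claims come from oscillations that decay by 1/2 per step: test functions with
  values in [-1, 1] give the total variation distance, eigenfunctions give the gap.\<close>

lemma gap_and_mixing_of_contraction:
  fixes V :: "(int^'d) set"
  assumes fin: "finite V" and card: "card V \<ge> 2" and bc: "is_bc q V \<psi>" and \<alpha>: "0 < \<alpha>" "\<alpha> \<le> 1"
    and contract: "\<And>f k. k \<ge> 0 \<Longrightarrow> hoelder q V \<alpha> k f \<Longrightarrow> hoelder q V \<alpha> (k / 2) (block_op L V \<psi> f)"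
  shows "real (mixing_time (Omega q U W V \<psi>) (block_dyn q U W L V \<psi>) (gibbs q U W V \<psi>))
      \<le> 4 / ln 2 * ln (real (card V))" (is ?mix)
    and "abs_spectral_gap (Omega q U W V \<psi>) (block_dyn q U W L V \<psi>) \<ge> 1/8" (is ?gap)
proof -
  let ?\<Omega> = "Omega q U W V \<psi>" and ?P = "block_dyn q U W L V \<psi>" and ?\<mu> = "gibbs q U W V \<psi>"
  let ?n = "real (card V)"
  let ?T = "\<lambda>t. block_op L V \<psi> ^^ t"
  have f\<Omega>: "finite ?\<Omega>" using finite_configs[OF fin] by (simp add: Omega_def)
  have \<Omega>c: "\<sigma> \<in> configs q V" if "\<sigma> \<in> ?\<Omega>" for \<sigma> using that by (simp add: Omega_def)
  have off: "?\<mu> \<sigma> = 0" if "\<sigma> \<in> configs q V" "\<sigma> \<notin> ?\<Omega>" for \<sigma>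
    using that gibbs_nonneg[of V \<psi> \<sigma>] by (auto simp: Omega_def)
  have ne: "?\<Omega> \<noteq> {}"
  proof
    assume "?\<Omega> = {}"
    hence "(\<Sum>\<sigma>\<in>configs q V. ?\<mu> \<sigma>) = 0" using off by simp
    thus False using sum_gibbs[OF fin bc] by simp
  qed
  have n\<alpha>: "?n powr \<alpha> \<le> ?n"
    using powr_mono[of \<alpha> 1 ?n] \<alpha> card by simp
  have power: "hoelder q V \<alpha> (k / 2 ^ t) (?T t f)" if "k \<ge> 0" "hoelder q V \<alpha> k f" for k f t
  proof (induction t)
    case (Suc t)
    from contract[OF _ this] that(1) show ?case by (simp add: mult.commute)
  qed (use that in simp)
  \<comment> \<open>Distinct configurations are at distance at least 1, so a function bounded by
    \<open>s\<close> has Hoelder constant \<open>2 * s\<close>; the diameter is at most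
    \<open>?n powr \<alpha> \<le> ?n\<close>.\<close>
  have close: "\<bar>?T t f \<sigma> - ?T t f \<tau>\<bar> \<le> 2 * s * ?n / 2 ^ t"
    if \<sigma>: "\<sigma> \<in> configs q V" and \<tau>: "\<tau> \<in> configs q V" and f: "\<And>\<rho>. \<rho> \<in> configs q V \<Longrightarrow> \<bar>f \<rho>\<bar> \<le> s" for f s \<sigma> \<tau> t
  proof -
    have s: "s \<ge> 0" using f[OF \<sigma>] by linarith
    have "hoelder q V \<alpha> (2 * s) f" unfolding hoelder_def
    proof (intro ballI)
      fix \<rho> \<rho>' assume \<rho>: "\<rho> \<in> configs q V" "\<rho>' \<in> configs q V"
      show "\<bar>f \<rho> - f \<rho>'\<bar> \<le> 2 * s * real (hdist V \<rho> \<rho>') powr \<alpha>"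
      proof (cases "hdist V \<rho> \<rho>' = 0")
        case True
        thus ?thesis using hdist_eq_0_configs[OF fin \<rho>] by simp
      next
        case False
        hence "1 \<le> real (hdist V \<rho> \<rho>') powr \<alpha>" using \<alpha> by (intro ge_one_powr_ge_zero) auto
        hence "2 * s * 1 \<le> 2 * s * real (hdist V \<rho> \<rho>') powr \<alpha>" using s by (intro mult_left_mono) auto
        thus ?thesis using f[OF \<rho>(1)] f[OF \<rho>(2)] by linarith
      qed
    qed
    from power[OF _ this, of t] s \<sigma> \<tau>
    have "\<bar>?T t f \<sigma> - ?T t f \<tau>\<bar> \<le> 2 * s / 2 ^ t * real (hdist V \<sigma> \<tau>) powr \<alpha>"
      unfolding hoelder_def by simp
    also have "\<dots> \<le> 2 * s / 2 ^ t * ?n"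
    proof (rule mult_left_mono)
      have "real (hdist V \<sigma> \<tau>) powr \<alpha> \<le> ?n powr \<alpha>"
        using hdist_le_card[OF fin, of \<sigma> \<tau>] \<alpha> by (intro powr_mono2) auto
      thus "real (hdist V \<sigma> \<tau>) powr \<alpha> \<le> ?n" using n\<alpha> by linarith
    qed (use s in simp)
    finally show ?thesis by simp
  qed
  have tv: "tv_dist ?\<Omega> (mpow ?\<Omega> ?P t \<sigma>) ?\<mu> \<le> ?n / 2 ^ t" if \<sigma>: "\<sigma> \<in> ?\<Omega>" for t \<sigma>
  proof -
    define f where "f \<tau> = sgn (mpow ?\<Omega> ?P t \<sigma> \<tau> - ?\<mu> \<tau>)" for \<tau>
    have f1: "\<bar>f \<tau>\<bar> \<le> 1" for \<tau> by (simp add: f_def sgn_if)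
    have "(\<Sum>\<tau>\<in>?\<Omega>. \<bar>mpow ?\<Omega> ?P t \<sigma> \<tau> - ?\<mu> \<tau>\<bar>)
      = (\<Sum>\<tau>\<in>?\<Omega>. mpow ?\<Omega> ?P t \<sigma> \<tau> * f \<tau>) - (\<Sum>\<tau>\<in>?\<Omega>. ?\<mu> \<tau> * f \<tau>)"
      unfolding sum_subtractf[symmetric] f_def by (simp add: abs_sgn left_diff_distrib)
    also have "(\<Sum>\<tau>\<in>?\<Omega>. ?\<mu> \<tau> * f \<tau>) = ex V \<psi> f"
      unfolding ex_def by (rule sum.mono_neutral_left) (use finite_configs[OF fin] \<Omega>c off in auto)
    also have "\<dots> = ex V \<psi> (?T t f)" by (rule ex_block_op_power[OF fin bc, symmetric])
    also have "(\<Sum>\<tau>\<in>?\<Omega>. mpow ?\<Omega> ?P t \<sigma> \<tau> * f \<tau>) = ex V \<psi> (\<lambda>_. ?T t f \<sigma>)"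
      by (simp add: sum_mpow_block_dyn[OF fin bc \<sigma>] ex_const[OF fin bc])
    also have "ex V \<psi> (\<lambda>_. ?T t f \<sigma>) - ex V \<psi> (?T t f) \<le> 2 * 1 * ?n / 2 ^ t"
      by (rule order_trans[OF abs_ge_self], rule abs_ex_diff_le[OF fin bc])
        (rule close[OF \<Omega>c[OF \<sigma>] _ f1])
    finally show ?thesis by (simp add: tv_dist_def mult.commute)
  qed
  show ?mix
  proof -
    define t where "t = nat \<lceil>log 2 (4 * ?n)\<rceil>"
    have l2: "log 2 (4 * ?n) = 2 + log 2 ?n"
    proof -
      have "log 2 (4::real) = 2" using log_pow_cancel[of 2 2] by simp
      moreover have "?n \<noteq> 0" using card by auto
      ultimately show ?thesis using log_mult[of 2 4 ?n] by simp
    qed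
    have ln1: "log 2 ?n \<ge> 1" using card by (subst le_log_iff) auto
    have "real t \<ge> log 2 (4 * ?n)" unfolding t_def by linarith
    hence "2 powr (log 2 (4 * ?n)) \<le> 2 powr real t" by (intro powr_mono) auto
    hence "4 * ?n \<le> 2 ^ t" using card by (simp add: powr_realpow)
    hence half: "?n / 2 ^ t \<le> 1/4" by (simp add: divide_le_eq)
    have "mixing_time ?\<Omega> ?P ?\<mu> \<le> t" unfolding mixing_time_def
    proof (rule Max.boundedI)
      fix a assume "a \<in> (\<lambda>x. LEAST t. tv_dist ?\<Omega> (mpow ?\<Omega> ?P t x) ?\<mu> \<le> 1/4) ` ?\<Omega>"
      then obtain x where x: "x \<in> ?\<Omega>" "a = (LEAST t. tv_dist ?\<Omega> (mpow ?\<Omega> ?P t x) ?\<mu> \<le> 1/4)" by blast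
      show "a \<le> t" unfolding x(2) by (rule Least_le) (use tv[OF x(1), of t] half in linarith)
    qed (use f\<Omega> ne in auto)
    hence "real (mixing_time ?\<Omega> ?P ?\<mu>) \<le> real t" by simp
    also have "real t \<le> log 2 (4 * ?n) + 1" unfolding t_def using l2 ln1 by linarith
    \<comment> \<open>The left side is \<open>3 + log 2 ?n\<close>, and
      \<open>log 2 ?n \<ge> 1\<close> since \<open>card V \<ge> 2\<close>.\<close>
    also have "\<dots> \<le> 4 * log 2 ?n" using l2 ln1 by linarith
    also have "\<dots> = 4 / ln 2 * ln ?n" by (simp add: log_def)
    finally show ?thesis .
  qed
  have pow_le: "\<bar>l\<bar> \<le> 1/2" if l: "\<And>t. \<bar>l\<bar> ^ t * a \<le> b / 2 ^ t" and a: "a > 0" for l a b :: real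
  proof (rule ccontr)
    assume "\<not> \<bar>l\<bar> \<le> 1/2"
    hence "2 * \<bar>l\<bar> > 1" by simp
    then obtain t where "b / a < (2 * \<bar>l\<bar>) ^ t" using real_arch_pow by blast
    hence "b < 2 ^ t * (\<bar>l\<bar> ^ t * a)" using a by (simp add: divide_less_eq power_mult_distrib mult_ac)
    also have "\<dots> \<le> 2 ^ t * (b / 2 ^ t)" by (intro mult_left_mono l) auto
    finally show False by simp
  qed
  have eigen: "\<bar>l\<bar> \<le> 1/2 \<or> (\<exists>k. \<forall>\<sigma>\<in>?\<Omega>. f \<sigma> = k)"
    if f: "\<And>\<sigma>. \<sigma> \<in> ?\<Omega> \<Longrightarrow> (\<Sum>\<tau>\<in>?\<Omega>. ?P \<sigma> \<tau> * f \<tau>) = l * f \<sigma>" for f l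
  proof (rule disjCI)
    assume "\<not> (\<exists>k. \<forall>\<sigma>\<in>?\<Omega>. f \<sigma> = k)"
    then obtain \<sigma> \<tau> where st: "\<sigma> \<in> ?\<Omega>" "\<tau> \<in> ?\<Omega>" "f \<sigma> \<noteq> f \<tau>" by blast
    have it: "?T t f \<rho> = l ^ t * f \<rho>" if "\<rho> \<in> ?\<Omega>" for t \<rho>
      using that
    proof (induction t arbitrary: \<rho>)
      case (Suc t)
      have "?T (Suc t) f \<rho> = (\<Sum>\<tau>\<in>?\<Omega>. ?P \<rho> \<tau> * ?T t f \<tau>)"
        by (simp add: sum_block_dyn[OF fin bc Suc.prems])
      also have "\<dots> = l ^ t * (\<Sum>\<tau>\<in>?\<Omega>. ?P \<rho> \<tau> * f \<tau>)"
        unfolding sum_distrib_left by (rule sum.cong) (auto simp: Suc.IH)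
      finally show ?case by (simp add: f[OF Suc.prems])
    qed simp
    \<comment> \<open>The eigenvector equation leaves \<open>f\<close> arbitrary off
      \<open>Omega\<close>. Any finite bound on \<open>configs\<close> will do, since
      \<open>pow_le\<close> compares growth rates only.\<close>
    define s where "s = (\<Sum>\<rho>\<in>configs q V. \<bar>f \<rho>\<bar>)"
    have s: "\<bar>f \<rho>\<bar> \<le> s" if "\<rho> \<in> configs q V" for \<rho>
      unfolding s_def by (rule member_le_sum) (use that finite_configs[OF fin] in auto)
    show "\<bar>l\<bar> \<le> 1/2"
    proof (rule pow_le)
      fix t
      have "\<bar>l\<bar> ^ t * \<bar>f \<sigma> - f \<tau>\<bar> = \<bar>?T t f \<sigma> - ?T t f \<tau>\<bar>"
        unfolding it[OF st(1)] it[OF st(2)] right_diff_distrib[symmetric] abs_mult power_abs ..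
      also have "\<dots> \<le> 2 * s * ?n / 2 ^ t" by (rule close[OF \<Omega>c[OF st(1)] \<Omega>c[OF st(2)] s])
      finally show "\<bar>l\<bar> ^ t * \<bar>f \<sigma> - f \<tau>\<bar> \<le> 2 * s * ?n / 2 ^ t" .
    qed (use st in simp)
  qed
  have block1: "(\<Sum>\<tau>\<in>?\<Omega>. ?P \<sigma> \<tau> * k) = k" if "\<sigma> \<in> ?\<Omega>" for \<sigma> k
  proof -
    have "cond_ex V (tileC L x \<inter> V) \<psi> (\<lambda>_. k) \<sigma> = k" for x
      unfolding cond_ex_def
      by (rule ex_const[OF _ is_bc_inner[OF bc \<Omega>c[OF that]]]) (use fin in auto)
    thus ?thesis
      by (simp add: sum_block_dyn[OF fin bc that] block_op_def card_tile_index)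
  qed
  have bound: "\<bar>l\<bar> \<le> 1/2" if l: "is_eigenvalue ?\<Omega> ?P l" "l \<noteq> 1" for l
  proof -
    obtain f \<sigma> where \<sigma>: "\<sigma> \<in> ?\<Omega>" "f \<sigma> \<noteq> 0"
      and f: "\<And>\<sigma>. \<sigma> \<in> ?\<Omega> \<Longrightarrow> (\<Sum>\<tau>\<in>?\<Omega>. ?P \<sigma> \<tau> * f \<tau>) = l * f \<sigma>"
      using l(1) unfolding is_eigenvalue_def by blast
    have False if c: "\<forall>\<sigma>\<in>?\<Omega>. f \<sigma> = k" for k
    proof -
      have "l * f \<sigma> = (\<Sum>\<tau>\<in>?\<Omega>. ?P \<sigma> \<tau> * f \<tau>)" by (rule f[OF \<sigma>(1), symmetric])
      also have "\<dots> = (\<Sum>\<tau>\<in>?\<Omega>. ?P \<sigma> \<tau> * k)" by (rule sum.cong) (use c in auto)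
      also have "\<dots> = f \<sigma>" using block1[OF \<sigma>(1)] c \<sigma>(1) by simp
      finally show False using \<sigma>(2) l(2) by simp
    qed
    thus ?thesis using eigen[OF f] by blast
  qed
  have simple: "\<not> eig1_multiple ?\<Omega> ?P"
  proof
    assume "eig1_multiple ?\<Omega> ?P"
    then obtain f g where f: "\<forall>x\<in>?\<Omega>. (\<Sum>y\<in>?\<Omega>. ?P x y * f y) = f x"
      and g: "\<forall>x\<in>?\<Omega>. (\<Sum>y\<in>?\<Omega>. ?P x y * g y) = g x"
      and ind: "\<forall>c1 c2::real. (\<forall>x\<in>?\<Omega>. c1 * f x + c2 * g x = 0) \<longrightarrow> c1 = 0 \<and> c2 = 0"
      unfolding eig1_multiple_def by blast
    obtain k where k: "\<forall>x\<in>?\<Omega>. f x = k" using eigen[of f 1] f by auto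
    obtain m where m: "\<forall>x\<in>?\<Omega>. g x = m" using eigen[of g 1] g by auto
    \<comment> \<open>Both eigenfunctions are constant on \<open>Omega\<close>, hence
      proportional.\<close>
    have "\<forall>y\<in>?\<Omega>. m * f y + (- k) * g y = 0" using k m by simp
    from ind[THEN spec, THEN spec, THEN mp, OF this] have "k = 0" by simp
    hence "\<forall>y\<in>?\<Omega>. 1 * f y + 0 * g y = 0" using k by simp
    from ind[THEN spec, THEN spec, THEN mp, OF this] show False by simp
  qed
  show ?gap
  proof -
    let ?S = "{0} \<union> {\<bar>l\<bar> | l. is_eigenvalue ?\<Omega> ?P l \<and> l \<noteq> 1}"
    have "finite ?S"
      by (rule finite_subset[of _ "{0} \<union> abs ` {l. is_eigenvalue ?\<Omega> ?P l}"])
        (use finite_eigenvalues[OF f\<Omega>, of ?P] in auto)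
    hence "Max ?S \<le> 1/2" by (subst Max_le_iff) (use bound in auto)
    thus ?thesis using simple by (simp add: abs_spectral_gap_def)
  qed
qed

end

text \<open>With exponent 1 / (2 d) the volume factor is at most \<open>2 * sqrt L\<close>, which
  loses against the denominator \<open>L + 3\<close>.\<close>

lemma eventually_contraction_rate:
  fixes A B :: real and d :: nat
  assumes A: "A > 0" and d: "d \<ge> 1"
  shows "\<exists>L0. \<forall>L\<ge>L0. 3 * (A / real (L + 3)) powr (1 / (2 * real d))
    + 3 * (B / real (L + 3)) * (1 + real (L ^ d)) powr (1 / (2 * real d)) \<le> 1/2"
proof -
  let ?\<alpha> = "1 / (2 * real d)"
  have 1: "(\<lambda>L. 3 * (A / real (L + 3)) powr ?\<alpha>) \<longlonglongrightarrow> 3 * 0"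
  proof (intro tendsto_mult tendsto_const tendsto_zero_powrI)
    show "(\<lambda>L. A / real (L + 3)) \<longlonglongrightarrow> 0" by real_asymp
    show "\<forall>\<^sub>F L in sequentially. 0 \<le> A / real (L + 3)" using A by simp
  qed (use d in auto)
  have 2: "(\<lambda>L. 3 * (\<bar>B\<bar> / real (L + 3)) * (2 * sqrt (real L))) \<longlonglongrightarrow> 0" by real_asymp
  have "(\<lambda>L. 3 * (A / real (L + 3)) powr ?\<alpha> + 3 * (\<bar>B\<bar> / real (L + 3)) * (2 * sqrt (real L))) \<longlonglongrightarrow> 0"
    using tendsto_add[OF 1 2] by simp
  hence "\<forall>\<^sub>F L in sequentially. 3 * (A / real (L + 3)) powr ?\<alpha> + 3 * (\<bar>B\<bar> / real (L + 3)) * (2 * sqrt (real L)) < 1/2"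
    by (rule order_tendstoD) simp
  then obtain L1 where L1: "\<And>L. L \<ge> L1 \<Longrightarrow>
      3 * (A / real (L + 3)) powr ?\<alpha> + 3 * (\<bar>B\<bar> / real (L + 3)) * (2 * sqrt (real L)) < 1/2"
    by (auto simp: eventually_sequentially)
  show ?thesis
  proof (intro exI allI impI)
    fix L assume L: "L \<ge> max 1 L1"
    have Lr: "real L > 0" using L by simp
    have "1 + real (L ^ d) \<le> 2 * real L ^ d"
    proof -
      have "1 \<le> real L ^ d" using L by (intro one_le_power) auto
      thus ?thesis by simp
    qed
    hence "(1 + real (L ^ d)) powr ?\<alpha> \<le> (2 * real L ^ d) powr ?\<alpha>" by (intro powr_mono2) auto
    also have "\<dots> = 2 powr ?\<alpha> * (real L powr real d) powr ?\<alpha>"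
      using Lr by (simp add: powr_mult powr_realpow)
    also have "(real L powr real d) powr ?\<alpha> = sqrt (real L)"
      using d Lr by (simp add: powr_powr powr_half_sqrt)
    also have "2 powr ?\<alpha> * sqrt (real L) \<le> 2 * sqrt (real L)"
    proof (rule mult_right_mono)
      have "(2::real) powr ?\<alpha> \<le> 2 powr 1" using d by (intro powr_mono) auto
      thus "(2::real) powr ?\<alpha> \<le> 2" by simp
    qed simp
    finally have p: "(1 + real (L ^ d)) powr ?\<alpha> \<le> 2 * sqrt (real L)" .
    have "3 * (B / real (L + 3)) * (1 + real (L ^ d)) powr ?\<alpha>
      \<le> 3 * (\<bar>B\<bar> / real (L + 3)) * (1 + real (L ^ d)) powr ?\<alpha>"
      by (intro mult_right_mono mult_left_mono divide_right_mono) auto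
    also have "\<dots> \<le> 3 * (\<bar>B\<bar> / real (L + 3)) * (2 * sqrt (real L))"
      using p by (intro mult_left_mono) auto
    finally show "3 * (A / real (L + 3)) powr ?\<alpha> + 3 * (B / real (L + 3)) * (1 + real (L ^ d)) powr ?\<alpha> \<le> 1/2"
      using L1[of L] L by simp
  qed
qed

theorem theorem1:
  fixes a b :: real
  assumes "a > 0" and "b > 0"
  shows "\<exists>L0::nat. \<forall>(q::nat) U W.
    spin_system q U \<and> permissive q U W TYPE('d) \<and> glauber_irreducible q U W TYPE('d)
      \<and> has_SSM q U W a b TYPE('d) \<longrightarrow>
    (\<forall>L::nat. odd L \<and> L \<ge> L0 \<longrightarrow>
      (\<exists>C::real. \<forall>(V::(int^'d) set) \<psi>.
         is_cube V \<and> card V \<ge> 2 \<and> is_bc q V \<psi> \<longrightarrow>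
           real (mixing_time (Omega q U W V \<psi>) (block_dyn q U W L V \<psi>) (gibbs q U W V \<psi>))
             \<le> C * ln (real (card V))
           \<and> abs_spectral_gap (Omega q U W V \<psi>) (block_dyn q U W L V \<psi>) \<ge> 1/8))"
proof -
  let ?d = "CARD('d)"
  define \<alpha> where "\<alpha> = 1 / (2 * real ?d)"
  have d: "?d \<ge> 1" by (simp add: Suc_leI)
  have "2 * real ?d \<ge> 1" "2 * real ?d > 0" using d by linarith+
  hence \<alpha>: "0 < \<alpha>" "\<alpha> \<le> 1" unfolding \<alpha>_def by (subst divide_le_eq_1_pos | simp)+
  \<comment> \<open>\<open>r\<close>, and with it \<open>t\<close>, \<open>\<phi>\<close> and the
    threshold, depends on d, a and b only; the spin system is fixed afterwards.\<close>
  obtain r where r: "2 * b * real (slice_width ?d r ^ ?d) * exp (- a * real r) \<le> 1"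
    using exp_beats_slice_width[OF assms(1)] by blast
  \<comment> \<open>Widening needs sides of at least twice the slice width.\<close>
  define t where "t = 2 * slice_width ?d r"
  define \<phi> where "\<phi> = widened (near_bound ?d r) ?d"
  have \<phi>: "\<phi> \<ge> 0" using widened_ge_1[OF near_bound_ge_1, of ?d r ?d] by (simp add: \<phi>_def)
  obtain L1 where L1: "\<And>L. L \<ge> L1 \<Longrightarrow>
      3 * ((1 + \<phi>) * real (?d * 3) / real (L + 3)) powr \<alpha>
      + 3 * (real (?d * (2 * t)) / real (L + 3)) * (1 + real (L ^ ?d)) powr \<alpha> \<le> 1/2"
    using eventually_contraction_rate[of "(1 + \<phi>) * real (?d * 3)" ?d "real (?d * (2 * t))"] d \<phi>
    unfolding \<alpha>_def by (auto simp: add_pos_nonneg)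
  show ?thesis
  \<comment> \<open>\<open>L \<ge> t\<close> is what \<open>card_thin\<close> asks for,
    \<open>L \<ge> L1\<close> gives the rate; the constant \<open>4 / ln 2\<close> serves every
    \<open>L\<close>.\<close>
  proof (intro exI[of _ "max t L1"] allI impI exI[of _ "4 / ln 2"])
    fix q U W L and V :: "(int^'d) set" and \<psi>
    assume sys: "spin_system q U \<and> permissive q U W TYPE('d) \<and> glauber_irreducible q U W TYPE('d)
      \<and> has_SSM q U W a b TYPE('d)"
    assume L: "odd L \<and> L \<ge> max t L1"
    assume V: "is_cube V \<and> card V \<ge> 2 \<and> is_bc q V \<psi>"
    interpret permissive_spin_system q U W "TYPE('d)"
      by unfold_locales (use sys in auto)
    obtain c l where cl: "V = ibox c (\<chi> i. c$i + int l)"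
      using V by (auto simp: is_cube_def ibox_def)
    have fin: "finite V" by (simp add: cl finite_ibox)
    have box: "influence_le (ibox lo hi) w \<phi>" if "\<And>i. hi$i - lo$i \<ge> int t" for lo hi w :: "int^'d"
      unfolding \<phi>_def by (rule influence_le_fat_ibox[OF _ r]) (use sys that in \<open>auto simp: t_def\<close>)
    have "hoelder q V \<alpha> (k / 2) (block_op L V \<psi> f)" if "k \<ge> 0" "hoelder q V \<alpha> k f" for k f
      unfolding cl
    proof (rule hoelder_block_op[OF _ _ \<phi> \<alpha> box])
      show "3 * ((1 + \<phi>) * (real (?d * 3) / real (L + 3))) powr \<alpha>
        + 3 * (real (?d * (2 * t)) / real (L + 3)) * (1 + real (L ^ ?d)) powr \<alpha> \<le> 1/2"
        using L1[of L] L by simp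
    qed (use L V that in \<open>auto simp: cl\<close>)
    from gap_and_mixing_of_contraction[OF fin _ _ \<alpha> this]
    show "real (mixing_time (Omega q U W V \<psi>) (block_dyn q U W L V \<psi>) (gibbs q U W V \<psi>))
        \<le> 4 / ln 2 * ln (real (card V))
      \<and> abs_spectral_gap (Omega q U W V \<psi>) (block_dyn q U W L V \<psi>) \<ge> 1/8"
      using V by auto
  qed
qed

end
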